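(* Let $N\in\mathbb{N}$, let $p\in(1,\infty)$ and let $\Omega\subset\mathbb{R}^N$ be a (bounded) domain which has the outer ball portion property and for which there exist constants $C>0$ and $s_0>0$ such that its isoperimetric function satisfies $I_\Omega(s)\ge Cs$ for all $s\in(0,s_0)$. Let $u\colon\Omega\to\mathbb{R}$ be a weakly differentiable function and let $d(x)=\operatorname{dist}(x,\partial\Omega)$ for $x\in\Omega$. Then $$|\nabla u|\in L^p(\Omega)\quad\text{and}\quad \frac{u}{d}\in L^{1,\infty}_a(\Omega)$$ if and only if $$u\in W^{1,p}_0(\Omega).$$
   Context: A domain is an open connected subset of $\mathbb{R}^N$. $\lambda^N$ is the $N$-dimensional Lebesgue measure and $\mathcal{H}^{N-1}$ the $(N-1)$-dimensional Hausdorff measure. A function is weakly differentiable if it is locally integrable and has locally integrable first-order weak derivatives; $\nabla u$ is the weak gradient. $W^{1,p}(\Omega)$ is the Sobolev space of all $u\in L^p(\Omega)$ with all first-order weak derivatives in $L^p(\Omega)$, with its usual norm; $W^{1,p}_0(\Omega)$ is the closure in $W^{1,p}(\Omega)$ of $C^\infty_0(\Omega)$, the infinitely differentiable functions with compact support in $\Omega$. Outer ball portion property: a bounded domain $\Omega$ has this property if there exist $b>0$ and $r_0>0$ such that for all $x\in\partial\Omega$ and all $r\in(0,r_0]$, $\lambda^N(B(x,r)\cap(\mathbb{R}^N\setminus\Omega))\ge b\,\lambda^N(B(x,r))$. Isoperimetric function: for measurable $E\subset\mathbb{R}^N$, the essential boundary $\partial^M E$ is the set of all $x\in\mathbb{R}^N$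 for which it is not the case that $\lim_{r\to0_+}\lambda^N(E\cap B(x,r))/\lambda^N(B(x,r))$ exists and equals $0$ or $1$. For measurable $E\subset\Omega$ put $P(E,\Omega)=\mathcal{H}^{N-1}(\Omega\cap\partial^M E)$. Then $I_\Omega(s)=\inf\{P(E,\Omega): E\subset\Omega \text{ measurable},\ s\le\lambda^N(E)\le\lambda^N(\Omega)/2\}$ for $s\in[0,\lambda^N(\Omega)/2]$, and $I_\Omega(s)=I_\Omega(\lambda^N(\Omega)-s)$ for $s\in[\lambda^N(\Omega)/2,\lambda^N(\Omega)]$. Weak Lebesgue space: for measurable $f$ on $\Omega$, $f^*(t)=\inf\{\xi\ge0:\lambda^N(\{x\in\Omega:|f(x)|>\xi\})\le t\}$, $t\ge 0$, and $L^{1,\infty}(\Omega)$ is the set of a.e. finite measurable $f$ with $\|f\|_{L^{1,\infty}(\Omega)}=\sup_{0<t<\infty}t f^*(t)<\infty$. $L^{1,\infty}_a(\Omega)$ is the set of all $f\in L^{1,\infty}(\Omega)$ such that $\|f\chi_{E_k}\|_{L^{1,\infty}(\Omega)}\to0$ for every sequence $\{E_k\}$ of measurable subsets of $\Omega$ with $\chi_{E_k}\to0$ a.e. on $\Omega$. *)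

theory Defs
  imports "HOL-Analysis.Analysis"
begin

text \<open>
  A function on an open set \<open>\<Omega>\<close> is represented by a total function of which only the values on \<open>\<Omega>\<close>
  matter. Membership in the Lebesgue and Sobolev spaces below is invariant under changes on null subsets of
  \<open>\<Omega>\<close>, so no quotient by almost-everywhere equality is formed.
\<close>

section \<open>Test functions and weak derivatives\<close>

primrec Ck :: "nat \<Rightarrow> ('a::euclidean_space \<Rightarrow> real) \<Rightarrow> bool" where
  "Ck 0 f \<longleftrightarrow> continuous_on UNIV f"
| "Ck (Suc k) f \<longleftrightarrow>
     (\<forall>x. f differentiable (at x)) \<and> (\<forall>b\<in>Basis. Ck k (\<lambda>x. frechet_derivative f (at x) b))"

text \<open>
  \<open>C\<^sub>0\<^sup>\<infinity>(\<Omega>)\<close>. A smooth function on \<open>\<Omega>\<close> with compact support in \<open>\<Omega>\<close> is identified with its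
  extension by zero to the whole space.
\<close>

definition test_functions :: "'a::euclidean_space set \<Rightarrow> ('a \<Rightarrow> real) set" where
  "test_functions \<Omega> = {\<phi>. (\<forall>k. Ck k \<phi>) \<and>
     compact (closure {x. \<phi> x \<noteq> 0}) \<and> closure {x. \<phi> x \<noteq> 0} \<subseteq> \<Omega>}"

definition locally_integrable :: "'a::euclidean_space set \<Rightarrow> ('a \<Rightarrow> real) \<Rightarrow> bool" where
  "locally_integrable \<Omega> f \<longleftrightarrow> (\<forall>K. compact K \<and> K \<subseteq> \<Omega> \<longrightarrow> set_integrable lebesgue K f)"

definition has_weak_partial ::
    "'a::euclidean_space set \<Rightarrow> 'a \<Rightarrow> ('a \<Rightarrow> real) \<Rightarrow> ('a \<Rightarrow> real) \<Rightarrow> bool" where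
  "has_weak_partial \<Omega> b u v \<longleftrightarrow> locally_integrable \<Omega> v \<and>
     (\<forall>\<phi>\<in>test_functions \<Omega>.
        (LINT x|lebesgue_on \<Omega>. u x * frechet_derivative \<phi> (at x) b)
          = - (LINT x|lebesgue_on \<Omega>. v x * \<phi> x))"

definition weakly_differentiable :: "'a::euclidean_space set \<Rightarrow> ('a \<Rightarrow> real) \<Rightarrow> bool" where
  "weakly_differentiable \<Omega> u \<longleftrightarrow>
     locally_integrable \<Omega> u \<and> (\<forall>b\<in>Basis. \<exists>v. has_weak_partial \<Omega> b u v)"

text \<open>Weak partial derivatives are unique almost everywhere in \<open>\<Omega>\<close>; a representative is chosen.\<close>

definition weak_partial ::
    "'a::euclidean_space set \<Rightarrow> 'a \<Rightarrow> ('a \<Rightarrow> real) \<Rightarrow> 'a \<Rightarrow> real" where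
  "weak_partial \<Omega> b u = (SOME v. has_weak_partial \<Omega> b u v)"

definition weak_grad :: "'a::euclidean_space set \<Rightarrow> ('a \<Rightarrow> real) \<Rightarrow> 'a \<Rightarrow> 'a" where
  "weak_grad \<Omega> u x = (\<Sum>b\<in>Basis. weak_partial \<Omega> b u x *\<^sub>R b)"


section \<open>Lebesgue and Sobolev spaces\<close>

definition Lp_space :: "'a::euclidean_space set \<Rightarrow> real \<Rightarrow> ('a \<Rightarrow> real) set" where
  "Lp_space \<Omega> p = {f \<in> borel_measurable (lebesgue_on \<Omega>).
     integrable (lebesgue_on \<Omega>) (\<lambda>x. \<bar>f x\<bar> powr p)}"

definition W1p :: "'a::euclidean_space set \<Rightarrow> real \<Rightarrow> ('a \<Rightarrow> real) set" where
  "W1p \<Omega> p = {u \<in> Lp_space \<Omega> p. weakly_differentiable \<Omega> u \<and>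
     (\<forall>b\<in>Basis. weak_partial \<Omega> b u \<in> Lp_space \<Omega> p)}"

definition W1p_norm :: "'a::euclidean_space set \<Rightarrow> real \<Rightarrow> ('a \<Rightarrow> real) \<Rightarrow> real" where
  "W1p_norm \<Omega> p u =
     ((LINT x|lebesgue_on \<Omega>. \<bar>u x\<bar> powr p)
       + (\<Sum>b\<in>Basis. LINT x|lebesgue_on \<Omega>. \<bar>weak_partial \<Omega> b u x\<bar> powr p)) powr (1 / p)"

definition W1p_0 :: "'a::euclidean_space set \<Rightarrow> real \<Rightarrow> ('a \<Rightarrow> real) set" where
  "W1p_0 \<Omega> p = {u \<in> W1p \<Omega> p.
     \<forall>\<epsilon>>0. \<exists>\<phi>\<in>test_functions \<Omega>. W1p_norm \<Omega> p (\<lambda>x. u x - \<phi> x) < \<epsilon>}"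


section \<open>The outer ball portion property\<close>

definition outer_ball_portion :: "'a::euclidean_space set \<Rightarrow> bool" where
  "outer_ball_portion \<Omega> \<longleftrightarrow>
     (\<exists>b>0. \<exists>r\<^sub>0>0. \<forall>x\<in>frontier \<Omega>. \<forall>r\<in>{0<..r\<^sub>0}.
        measure lebesgue (ball x r \<inter> - \<Omega>) \<ge> b * measure lebesgue (ball x r))"


section \<open>Hausdorff measure and the isoperimetric function\<close>

text \<open>
  Hausdorff (outer) measure of integer dimension \<open>k\<close> with the usual normalisation, by which the
  \<open>k\<close>-dimensional unit ball has measure \<open>unit_ball_vol k\<close>. The natural power satisfies \<open>0 ^ 0 = 1\<close>,
  so that for \<open>k = 0\<close> each nonempty covering set contributes 1 and the result is the counting
  measure; empty covering sets contribute 0. Boundedness is required since \<^const>\<open>diameter\<close> is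
  unspecified on unbounded sets.
\<close>

definition hausdorff_pre :: "nat \<Rightarrow> real \<Rightarrow> 'a::euclidean_space set \<Rightarrow> ennreal" where
  "hausdorff_pre k \<delta> A =
     (INF F \<in> {F :: nat \<Rightarrow> 'a set. A \<subseteq> (\<Union>i. F i) \<and> (\<forall>i. bounded (F i) \<and> diameter (F i) \<le> \<delta>)}.
        \<Sum>i. if F i = {} then 0
            else ennreal (unit_ball_vol (real k) * (diameter (F i) / 2) ^ k))"

definition hausdorff_measure :: "nat \<Rightarrow> 'a::euclidean_space set \<Rightarrow> ennreal" where
  "hausdorff_measure k A = (SUP \<delta>\<in>{0<..}. hausdorff_pre k \<delta> A)"

definition essential_boundary :: "'a::euclidean_space set \<Rightarrow> 'a set" where
  "essential_boundary E =
     {x. \<not> (\<exists>l\<in>{0, 1 :: real}.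
        ((\<lambda>r. measure lebesgue (E \<inter> ball x r) / measure lebesgue (ball x r)) \<longlongrightarrow> l) (at_right 0))}"

definition perimeter_in :: "'a::euclidean_space set \<Rightarrow> 'a set \<Rightarrow> ennreal" where
  "perimeter_in E \<Omega> = hausdorff_measure (DIM('a) - 1) (\<Omega> \<inter> essential_boundary E)"

text \<open>
  Meaningful for \<open>\<Omega>\<close> of finite measure and \<open>0 \<le> s \<le> measure lebesgue \<Omega>\<close>.
\<close>

definition isoperimetric_fun :: "'a::euclidean_space set \<Rightarrow> real \<Rightarrow> ennreal" where
  "isoperimetric_fun \<Omega> s =
     (let V = measure lebesgue \<Omega>;
          s' = (if s \<le> V / 2 then s else V - s)
      in INF E \<in> {E \<in> sets lebesgue. E \<subseteq> \<Omega> \<and> s' \<le> measure lebesgue E \<and> measure lebesgue E \<le> V / 2}.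
           perimeter_in E \<Omega>)"


section \<open>The weak Lebesgue space\<close>

definition decr_rearrangement ::
    "'a::euclidean_space set \<Rightarrow> ('a \<Rightarrow> real) \<Rightarrow> real \<Rightarrow> ennreal" where
  "decr_rearrangement \<Omega> f t =
     (INF \<xi> \<in> {\<xi>. 0 \<le> \<xi> \<and> emeasure lebesgue {x \<in> \<Omega>. \<bar>f x\<bar> > \<xi>} \<le> ennreal t}. ennreal \<xi>)"

definition weak_L1_norm :: "'a::euclidean_space set \<Rightarrow> ('a \<Rightarrow> real) \<Rightarrow> ennreal" where
  "weak_L1_norm \<Omega> f = (SUP t\<in>{0<..}. ennreal t * decr_rearrangement \<Omega> f t)"

text \<open>Finiteness almost everywhere is automatic for real-valued functions.\<close>

definition weak_L1 :: "'a::euclidean_space set \<Rightarrow> ('a \<Rightarrow> real) set" where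
  "weak_L1 \<Omega> = {f \<in> borel_measurable (lebesgue_on \<Omega>). weak_L1_norm \<Omega> f < \<infinity>}"

definition weak_L1_a :: "'a::euclidean_space set \<Rightarrow> ('a \<Rightarrow> real) set" where
  "weak_L1_a \<Omega> = {f \<in> weak_L1 \<Omega>.
     \<forall>E :: nat \<Rightarrow> 'a set.
       (\<forall>k. E k \<in> sets lebesgue \<and> E k \<subseteq> \<Omega>) \<and>
       (AE x in lebesgue_on \<Omega>. (\<lambda>k. indicator (E k) x :: real) \<longlonglongrightarrow> 0)
       \<longrightarrow> (\<lambda>k. weak_L1_norm \<Omega> (\<lambda>x. f x * indicator (E k) x)) \<longlonglongrightarrow> 0}"

end

theory Submission
  imports Defs
begin

text \<open>
  Let \<open>d\<close> be the distance to the complement of \<open>\<Omega>\<close> and extend \<open>u\<close> by zero.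

  If \<open>u / d\<close> lies in \<open>L\<^sup>1\<^sup>,\<^sup>\<infinity>\<^sub>a\<close>, truncate \<open>u\<close> between \<open>- k d\<close> and \<open>k d\<close>. The truncated function vanishes
  on the boundary at a linear rate, and its derivative differs from that of \<open>u\<close> only on \<open>{\<bar>u\<bar> > k d}\<close>, by
  at most about \<open>\<bar>\<nabla>u\<bar> + k\<close>. As \<open>k |{\<bar>u\<bar> > k d}|\<close> is bounded by the weak norm of \<open>u / d\<close> on \<open>{\<bar>u\<bar> > k d}\<close>, it
  tends to 0, so that in the limit the increments of the zero extension along segments in the whole space
  are the integrals of the weak partial derivatives. A large translation now gives \<open>u \<in> L\<^sup>p\<close>; small
  translations into the complement, which fills a fixed portion of the balls centred at the boundary, give
  \<open>\<integral>\<^bsub>{d < r}\<^esub> \<bar>u\<bar>\<^sup>p \<le> C r\<^sup>p \<integral>\<^bsub>{d < c r}\<^esub> \<bar>\<nabla>u\<bar>\<^sup>p\<close>. Hence cutting \<open>u\<close> off near the boundary and mollifying yields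
  approximating test functions.

  Conversely, let \<open>\<phi>\<close> be a test function with \<open>\<bar>\<phi>(x)\<bar> > t d(x)\<close>. Averaging \<open>\<phi>(x) - \<phi>(y)\<close> over the points
  \<open>y\<close> of the complement near \<open>x\<close> produces a ball centred at \<open>x\<close> on which the mean of \<open>\<bar>\<nabla>\<phi>\<bar>\<close> is at least
  \<open>c t\<close>, and Vitali's covering lemma bounds \<open>t |{\<bar>\<phi>\<bar> > t d}|\<close> by \<open>C \<parallel>\<nabla>\<phi>\<parallel>\<^sub>1\<close>. Therefore \<open>u / d\<close> is the sum of a bounded
  function \<open>\<phi> / d\<close> and a function of small weak norm, so it belongs to \<open>L\<^sup>1\<^sup>,\<^sup>\<infinity>\<^sub>a\<close>.
\<close>


section \<open>Smooth functions and mollifiers\<close>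

text \<open>Zero boundary values are never expressed by a trace. They are encoded in one statement,
  \<open>translation_formula\<close>: the increment formula holds for almost every starting point,
  also when the segment leaves \<open>\<Omega>\<close>. No chain rule or product rule for weak
  derivatives is proved; truncation and cutoff act on increments, where clipping is 1-Lipschitz and
  the discrete product rule is algebra. Finiteness of the weak norm alone would leave a truncation
  error of fixed size; its absolute continuity, applied to the superlevel sets of
  \<open>u / d\<close> themselves, removes it. The approximation closes because the decay
  \<open>r^p\<close> in the boundary layer cancels the p-th power of the slope \<open>1 / r\<close>
  of the cutoff. For the converse a weak-type bound for exponent 1 is enough, since
  \<open>\<Omega>\<close> is bounded and L^p approximation implies L^1 approximation. The obstacle
  there is that approximants of \<open>u - \<phi>\<close> are close in L^1 but not relative to
  \<open>d\<close>; points at distance more than \<eta> from the complement are treated first, with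
  a bound free of \<eta>.\<close>

lemma Ck_SucI:
  assumes "\<And>x. (f has_derivative D x) (at x)" and "\<And>b. b \<in> Basis \<Longrightarrow> Ck k (\<lambda>x. D x b)"
  shows "Ck (Suc k) f"
proof -
  have D: "frechet_derivative f (at x) = D x" for x
    using frechet_derivative_at[OF assms(1)[of x]] by simp
  show ?thesis
    using assms by (auto simp: D differentiable_def)
qed

lemma Ck_has_derivative: "Ck (Suc k) f \<Longrightarrow> (f has_derivative frechet_derivative f (at x)) (at x)"
  by (simp add: frechet_derivative_works)

lemma Ck_mono: "Ck (Suc k) f \<Longrightarrow> Ck k f"
proof (induction k arbitrary: f)
  case 0
  then show ?case
    by (auto intro!: continuous_at_imp_continuous_on differentiable_imp_continuous_within)
qed auto

lemma Ck_const: "Ck k (\<lambda>x. c)"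
proof (induction k arbitrary: c)
  case (Suc k)
  show ?case by (rule Ck_SucI[where D="\<lambda>x h. 0"]) (auto intro: Suc)
qed auto

lemma Ck_inner: "Ck k (\<lambda>x. x \<bullet> a)"
proof (cases k)
  case (Suc j)
  show ?thesis unfolding Suc
    by (rule Ck_SucI[where D="\<lambda>x h. h \<bullet> a"]) (auto intro: Ck_const intro!: derivative_eq_intros)
qed (auto intro!: continuous_intros)

lemma Ck_add: "Ck k f \<Longrightarrow> Ck k g \<Longrightarrow> Ck k (\<lambda>x. f x + g x)"
proof (induction k arbitrary: f g)
  case (Suc k)
  show ?case
    by (rule Ck_SucI[where D="\<lambda>x h. frechet_derivative f (at x) h + frechet_derivative g (at x) h"])
      (use Suc in \<open>auto intro!: has_derivative_add Ck_has_derivative Suc.IH\<close>)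
qed (auto intro!: continuous_intros)

lemma Ck_mult: "Ck k f \<Longrightarrow> Ck k g \<Longrightarrow> Ck k (\<lambda>x. f x * g x)"
proof (induction k arbitrary: f g)
  case (Suc k)
  have "Ck k f" "Ck k g" using Suc.prems by (auto intro: Ck_mono simp del: Ck.simps)
  then show ?case
    by (intro Ck_SucI[where D="\<lambda>x h. f x * frechet_derivative g (at x) h + frechet_derivative f (at x) h * g x"])
      (use Suc in \<open>auto intro!: has_derivative_mult Ck_has_derivative Suc.IH Ck_add\<close>)
qed (auto intro!: continuous_intros)

lemma Ck_diff: assumes "Ck k f" "Ck k g" shows "Ck k (\<lambda>x. f x - g x)"
  using Ck_add[OF assms(1) Ck_mult[OF Ck_const[of k "-1"] assms(2)]] by simp

lemma Ck_continuous: "Ck k f \<Longrightarrow> continuous_on UNIV f"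
  by (induction k) (auto simp del: Ck.simps(2) dest: Ck_mono)

text \<open>The flat function \<open>exp (- 1 / t)\<close>, divided by powers of \<open>t\<close> so
  that the derivative of a member is a combination of two other members. Smoothness then follows by
  induction on the order with \<open>n\<close> arbitrary.\<close>

definition flat_exp :: "nat \<Rightarrow> real \<Rightarrow> real" where
  "flat_exp n t = (if t > 0 then exp (- 1 / t) / t ^ n else 0)"

lemma tendsto_flat_exp: "(flat_exp n \<longlongrightarrow> 0) (at_right 0)"
proof -
  have "((\<lambda>t. inverse t ^ n / exp (inverse t)) \<longlongrightarrow> (0::real)) (at_right 0)"
    by (rule filterlim_compose[OF tendsto_power_div_exp_0 filterlim_inverse_at_top_right])
  then show ?thesis
  proof (rule Lim_transform_eventually)
    show "\<forall>\<^sub>F t in at_right 0. inverse t ^ n / exp (inverse t) = flat_exp n t"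
      using eventually_at_right_less[of 0]
      by eventually_elim (simp add: flat_exp_def exp_minus field_simps)
  qed
qed

lemma DERIV_flat_exp: "(flat_exp n has_real_derivative flat_exp (n + 2) t - n * flat_exp (n + 1) t) (at t)"
proof (cases t "0::real" rule: linorder_cases)
  case less
  have "((\<lambda>t. 0) has_real_derivative 0) (at t)" by simp
  then have "(flat_exp n has_real_derivative 0) (at t)"
    by (rule has_field_derivative_transform_within_open[where S="{..<0}"]) (use less in \<open>auto simp: flat_exp_def\<close>)
  with less show ?thesis by (simp add: flat_exp_def)
next
  case equal
  \<comment> \<open>On the right the difference quotient at 0 is the next member of the family,
    which tends to 0; on the left the function vanishes.\<close>
  have R: "((\<lambda>t. flat_exp n t / t) \<longlongrightarrow> 0) (at_right 0)"
  proof (rule Lim_transform_eventually[OF tendsto_flat_exp[of "Suc n"]])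
    show "\<forall>\<^sub>F t in at_right 0. flat_exp (Suc n) t = flat_exp n t / t"
      using eventually_at_right_less[of 0]
      by eventually_elim (simp add: flat_exp_def field_simps)
  qed
  have L: "((\<lambda>t. flat_exp n t / t) \<longlongrightarrow> 0) (at_left 0)"
  proof (rule Lim_transform_eventually[OF tendsto_const])
    show "\<forall>\<^sub>F t in at_left 0. 0 = flat_exp n t / t"
      unfolding eventually_at_filter by (simp add: flat_exp_def)
  qed
  have "(flat_exp n has_real_derivative 0) (at 0)"
    unfolding has_field_derivative_iff using filterlim_split_at[OF L R] by (simp add: flat_exp_def)
  with equal show ?thesis by (simp add: flat_exp_def)
next
  case greater
  have "((\<lambda>t. exp (- 1 / t) / t ^ n) has_real_derivative flat_exp (n + 2) t - n * flat_exp (n + 1) t) (at t)"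
  proof (cases n)
    case 0
    show ?thesis
      using greater by (auto intro!: derivative_eq_intros simp: 0 flat_exp_def field_simps power2_eq_square)
  next
    case (Suc m)
    show ?thesis
      using greater
      by (auto intro!: derivative_eq_intros simp: Suc flat_exp_def)
        (cases m; simp add: field_simps power_add power2_eq_square)
  qed
  then show ?thesis
    by (rule has_field_derivative_transform_within_open[where S="{0<..}"]) (use greater in \<open>auto simp: flat_exp_def\<close>)
qed

text \<open>The square \<open>x \<bullet> x\<close> is a polynomial, so the singularity of the norm
  at 0 does not enter. For \<open>n = 0\<close> and \<open>c = \<epsilon>^2\<close> this is the
  standard bump on the ball of radius \<epsilon>.\<close>

lemma Ck_flat_exp_ball: "Ck k (\<lambda>x::'a::euclidean_space. flat_exp n (c - x \<bullet> x))"
proof (induction k arbitrary: n)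
  case 0
  have "isCont (flat_exp n) t" for t using DERIV_isCont[OF DERIV_flat_exp] .
  then have "continuous_on UNIV (flat_exp n)" by (simp add: continuous_at_imp_continuous_on)
  then show ?case
    by (auto intro!: continuous_on_compose2[of UNIV "flat_exp n"] continuous_intros)
next
  case (Suc k)
  let ?d = "\<lambda>t. flat_exp (n + 2) t - n * flat_exp (n + 1) t"
  show ?case
  proof (rule Ck_SucI[where D="\<lambda>x h. ?d (c - x \<bullet> x) * (-2 * (h \<bullet> x))"])
    fix x :: 'a
    have 1: "((\<lambda>x. c - x \<bullet> x) has_derivative (\<lambda>h. -2 * (h \<bullet> x))) (at x)"
      by (auto intro!: derivative_eq_intros simp: inner_commute)
    show "((\<lambda>x. flat_exp n (c - x \<bullet> x)) has_derivative (\<lambda>h. ?d (c - x \<bullet> x) * (-2 * (h \<bullet> x)))) (at x)"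
      using has_derivative_compose[OF 1 DERIV_flat_exp[unfolded has_field_derivative_def]] by simp
  next
    fix b :: 'a assume "b \<in> Basis"
    have "Ck k (\<lambda>x::'a. ?d (c - x \<bullet> x))"
      by (intro Ck_diff Ck_mult Ck_const Suc)
    moreover have "Ck k (\<lambda>x::'a. -2 * (b \<bullet> x))"
      by (subst inner_commute) (intro Ck_mult Ck_const Ck_inner)
    ultimately show "Ck k (\<lambda>x. ?d (c - x \<bullet> x) * (-2 * (b \<bullet> x)))" by (rule Ck_mult)
  qed
qed

section \<open>Mollifiers and uniform continuity under bounded support\<close>

lemma integrable_continuous_bounded_support:
  fixes f :: "'a::euclidean_space \<Rightarrow> real"
  assumes "continuous_on UNIV f" "\<And>x. norm x > R \<Longrightarrow> f x = 0"
  shows "integrable lborel f"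
proof -
  have "set_integrable lborel (cball 0 R) f"
    unfolding set_integrable_def
    by (rule borel_integrable_compact) (auto intro: continuous_on_subset[OF assms(1)])
  moreover have "(\<lambda>x. indicator (cball 0 R) x *\<^sub>R f x) = f"
    using assms(2) by (force simp: indicator_def)
  ultimately show ?thesis by (simp add: set_integrable_def)
qed

text \<open>The bump \<open>\<sigma>\<close> is normalised by its integral. The integral is not 0,
  because a nonnegative function with integral 0 vanishes almost everywhere, whereas
  \<open>\<sigma>\<close> is nonzero on a ball of positive measure.\<close>

lemma mollifier_exists:
  assumes "\<epsilon> > 0"
  obtains \<rho> :: "'a::euclidean_space \<Rightarrow> real"
  where "\<And>k. Ck k \<rho>" "\<And>x. \<rho> x \<ge> 0" "\<And>x. norm x > \<epsilon> \<Longrightarrow> \<rho> x = 0" "integrable lborel \<rho>"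
    "integral\<^sup>L lborel \<rho> = 1" "\<And>x. \<rho> (- x) = \<rho> x"
proof -
  define \<sigma> :: "'a \<Rightarrow> real" where "\<sigma> x = flat_exp 0 (\<epsilon>^2 - x \<bullet> x)" for x
  have Ck: "Ck k \<sigma>" for k unfolding \<sigma>_def[abs_def] by (rule Ck_flat_exp_ball)
  have nn: "\<sigma> x \<ge> 0" for x by (simp add: \<sigma>_def flat_exp_def)
  have supp: "\<sigma> x = 0 \<longleftrightarrow> norm x \<ge> \<epsilon>" for x
  proof -
    have "\<epsilon>^2 - x \<bullet> x > 0 \<longleftrightarrow> norm x < \<epsilon>"
      using abs_square_less_1[of "norm x / \<epsilon>"] assms by (simp add: dot_square_norm power_divide field_simps)
    then show ?thesis by (auto simp: \<sigma>_def flat_exp_def)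
  qed
  have cont: "continuous_on UNIV \<sigma>" using Ck_continuous[OF Ck[of 0]] .
  have int: "integrable lborel \<sigma>"
    by (rule integrable_continuous_bounded_support[OF cont, of \<epsilon>]) (simp add: supp)
  have "integral\<^sup>L lborel \<sigma> \<noteq> 0"
  proof
    assume "integral\<^sup>L lborel \<sigma> = 0"
    then have "AE x in lborel. \<sigma> x = 0"
      using integral_nonneg_eq_0_iff_AE[OF int] nn by simp
    then have "AE x in lborel. x \<notin> ball (0::'a) \<epsilon>"
      by (rule eventually_mono) (simp add: supp)
    then have "emeasure lborel (ball (0::'a) \<epsilon>) = 0"
      by (subst (asm) AE_iff_measurable[OF _ refl]) (auto simp: ball_def)
    then show False
      using assms unit_ball_vol_pos[of "real DIM('a)"] by (simp add: emeasure_ball)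
  qed
  then have pos: "integral\<^sup>L lborel \<sigma> > 0"
    using Bochner_Integration.integral_nonneg[of lborel \<sigma>] nn by (simp add: less_le)
  show thesis
  proof (rule that[of "\<lambda>x. inverse (integral\<^sup>L lborel \<sigma>) * \<sigma> x"])
    show "Ck k (\<lambda>x. inverse (integral\<^sup>L lborel \<sigma>) * \<sigma> x)" for k
      by (intro Ck_mult Ck Ck_const)
    show "inverse (integral\<^sup>L lborel \<sigma>) * \<sigma> (- x) = inverse (integral\<^sup>L lborel \<sigma>) * \<sigma> x" for x
      by (simp add: \<sigma>_def)
  qed (use pos nn int supp in auto)
qed

text \<open>Enlarging the ball by 1 and keeping the modulus at most 1 leaves two cases: both points
  lie in the compact ball, where Heine-Cantor applies, or both lie where \<open>f\<close>
  vanishes.\<close>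

lemma uniformly_continuous_bounded_support:
  fixes f :: "'a::euclidean_space \<Rightarrow> real"
  assumes "continuous_on UNIV f" "\<And>x. norm x > R \<Longrightarrow> f x = 0" "e > 0"
  obtains d where "d > 0" "\<And>x y. dist x y < d \<Longrightarrow> \<bar>f x - f y\<bar> < e"
proof -
  have "uniformly_continuous_on (cball 0 (R + 1)) f"
    by (rule compact_uniformly_continuous) (auto intro: continuous_on_subset[OF assms(1)])
  then obtain d where d: "d > 0"
    "\<And>x y. x \<in> cball 0 (R + 1) \<Longrightarrow> y \<in> cball 0 (R + 1) \<Longrightarrow> dist y x < d \<Longrightarrow> dist (f y) (f x) < e"
    using assms(3) unfolding uniformly_continuous_on_def by metis
  show thesis
  proof (rule that[of "min d 1"])
    fix x y :: 'a assume xy: "dist x y < min d 1"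
    show "\<bar>f x - f y\<bar> < e"
    proof (cases "x \<in> cball 0 (R + 1) \<and> y \<in> cball 0 (R + 1)")
      case True
      with d(2)[of y x] xy show ?thesis by (auto simp: dist_real_def)
    next
      case False
      have "norm x \<le> norm y + dist x y" "norm y \<le> norm x + dist x y"
        using norm_triangle_sub[of x y] norm_triangle_sub[of y x] by (simp_all add: dist_norm norm_minus_commute)
      with False xy have "norm x > R" "norm y > R" by auto
      with assms(2,3) show ?thesis by simp
    qed
  qed (use d in auto)
qed

section \<open>Differentiation of convolutions\<close>

lemma frechet_derivative_zero_outside:
  fixes f :: "'a::euclidean_space \<Rightarrow> real"
  assumes "\<And>x. norm x > R \<Longrightarrow> f x = 0" "norm x > R"
  shows "frechet_derivative f (at x) = (\<lambda>h. 0)"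
proof -
  have "open {x::'a. norm x > R}"
    by (simp add: open_Collect_less continuous_on_norm_id)
  then have "(f has_derivative (\<lambda>h. 0)) (at x)"
    using has_derivative_transform_within_open[of "\<lambda>x. 0" "\<lambda>h. 0" x UNIV "{x. norm x > R}" f] assms by auto
  then show ?thesis using frechet_derivative_at by metis
qed

lemma has_derivative_Basis_sum:
  assumes "(f has_derivative D) (at x)"
  shows "D h = (\<Sum>b\<in>Basis. (h \<bullet> b) * D (b::'a::euclidean_space) :: real)"
proof -
  interpret bounded_linear D using assms by (rule has_derivative_bounded_linear)
  have "D h = D (\<Sum>b\<in>Basis. (h \<bullet> b) *\<^sub>R b)" by (simp add: euclidean_representation)
  also have "\<dots> = (\<Sum>b\<in>Basis. (h \<bullet> b) * D b)" by (simp add: sum scaleR)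
  finally show ?thesis .
qed

text \<open>The partial derivatives are uniformly continuous by bounded support, so the remainder in
  the mean value inequality does not depend on \<open>z\<close>. This uniformity is what
  differentiation under the integral needs when the other factor is only integrable.\<close>

lemma C1_uniform_linearization:
  fixes \<rho> :: "'a::euclidean_space \<Rightarrow> real"
  assumes "Ck 1 \<rho>" "\<And>x. norm x > R \<Longrightarrow> \<rho> x = 0" "e > 0"
  obtains d where "d > 0" "\<And>z h. norm h < d \<Longrightarrow> \<bar>\<rho> (z + h) - \<rho> z - frechet_derivative \<rho> (at z) h\<bar> \<le> e * norm h"
proof -
  define D where "D = (\<lambda>z. frechet_derivative \<rho> (at z))"
  have hd: "(\<rho> has_derivative D z) (at z)" for z
    unfolding D_def using assms(1) by (intro Ck_has_derivative[of 0]) simp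
  define e' where "e' = e / (DIM('a))"
  have e': "e' > 0" using assms(3) by (simp add: e'_def)
  have "\<exists>d>0. \<forall>x y. dist x y < d \<longrightarrow> \<bar>D x b - D y b\<bar> < e'" if "b \<in> Basis" for b
  proof -
    have "continuous_on UNIV (\<lambda>x. D x b)" using assms(1) that by (simp add: D_def)
    moreover have "D x b = 0" if "norm x > R" for x
      using frechet_derivative_zero_outside[of R \<rho> x] assms(2) that by (simp add: D_def)
    ultimately show ?thesis
      using uniformly_continuous_bounded_support[of "\<lambda>x. D x b" R e'] e' by metis
  qed
  then obtain d where d: "\<And>b. b \<in> Basis \<Longrightarrow> d b > 0"
    "\<And>b x y. b \<in> Basis \<Longrightarrow> dist x y < d b \<Longrightarrow> \<bar>D x b - D y b\<bar> < e'"
    by metis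
  define \<delta> where "\<delta> = Min (d ` Basis)"
  have \<delta>: "\<delta> > 0" "\<And>b. b \<in> Basis \<Longrightarrow> \<delta> \<le> d b"
    unfolding \<delta>_def using d(1) by (auto simp: Min_gr_iff)
  show thesis
  proof (rule that[OF \<delta>(1)])
    fix z h :: 'a assume h: "norm h < \<delta>"
    have on: "onorm (D x - D z) \<le> e" if "x \<in> ball z \<delta>" for x
    proof (rule onorm_le)
      fix k :: 'a
      have "norm ((D x - D z) k) = \<bar>\<Sum>b\<in>Basis. (k \<bullet> b) * (D x b - D z b)\<bar>"
        using has_derivative_Basis_sum[OF hd, of x k] has_derivative_Basis_sum[OF hd, of z k]
        by (simp add: fun_diff_def right_diff_distrib sum_subtractf)
      also have "\<dots> \<le> (\<Sum>b\<in>Basis. \<bar>(k \<bullet> b) * (D x b - D z b)\<bar>)" by (rule sum_abs)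
      also have "\<dots> \<le> (\<Sum>b\<in>(Basis::'a set). norm k * e')"
      proof (rule sum_mono)
        fix b :: 'a assume b: "b \<in> Basis"
        have "dist x z < d b" using that \<delta>(2)[OF b] by (simp add: dist_commute)
        then show "\<bar>(k \<bullet> b) * (D x b - D z b)\<bar> \<le> norm k * e'"
          using d(2)[OF b, of x z] Basis_le_norm[OF b, of k] by (auto simp: abs_mult intro!: mult_mono)
      qed
      also have "\<dots> = e * norm k" by (simp add: e'_def)
      finally show "norm ((D x - D z) k) \<le> e * norm k" .
    qed
    have "norm (\<rho> (z + h) - \<rho> z - D z (z + h - z)) \<le> norm (z + h - z) * e"
    proof (rule differentiable_bound_linearization[where S="ball z \<delta>"])
      show "z + t *\<^sub>R (z + h - z) \<in> ball z \<delta>" if "t \<in> {0..1}" for t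
      proof -
        have "norm (t *\<^sub>R h) \<le> norm h" using that by (auto intro!: mult_left_le_one_le)
        then show ?thesis using h by (simp add: dist_norm)
      qed
    qed (use on hd \<delta>(1) in \<open>auto intro: has_derivative_at_withinI\<close>)
    then show "\<bar>\<rho> (z + h) - \<rho> z - frechet_derivative \<rho> (at z) h\<bar> \<le> e * norm h"
      by (simp add: D_def mult.commute)
  qed
qed

lemma bounded_continuous_bounded_support:
  fixes f :: "'a::euclidean_space \<Rightarrow> real"
  assumes "continuous_on UNIV f" "\<And>x. norm x > R \<Longrightarrow> f x = 0"
  obtains B where "B \<ge> 0" "\<And>x. \<bar>f x\<bar> \<le> B"
proof -
  have "compact (f ` cball 0 R)"
    by (intro compact_continuous_image) (auto intro: continuous_on_subset[OF assms(1)])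
  then have "bounded (f ` cball 0 R)" by (rule compact_imp_bounded)
  then obtain B where B: "\<And>x. x \<in> cball 0 R \<Longrightarrow> \<bar>f x\<bar> \<le> B"
    unfolding bounded_iff by (metis imageI real_norm_def)
  show thesis
  proof (rule that[of "max B 0"])
    show "\<bar>f x\<bar> \<le> max B 0" for x
      using B[of x] assms(2)[of x] by (cases "norm x \<le> R") auto
  qed simp
qed

lemma smooth_frechet_derivative:
  assumes "\<And>k. Ck k \<rho>" "b \<in> Basis"
  shows "Ck k (\<lambda>x. frechet_derivative \<rho> (at x) b)"
  using assms(1)[of "Suc k"] assms(2) by simp

text \<open>The measure \<open>M\<close> and the map \<open>T\<close> are general because three
  cases occur: mollification (\<open>lborel\<close>, identity), averages along a segment
  (\<open>seg_measure\<close>) and a single translate (counting measure on one point). The uniform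
  linearization of the kernel bounds the remainder by its rate times the L^1 norm of
  \<open>f\<close>.\<close>

lemma has_derivative_convolution:
  fixes \<rho> :: "'a::euclidean_space \<Rightarrow> real" and f :: "'b \<Rightarrow> real" and T :: "'b \<Rightarrow> 'a"
  assumes "\<And>k. Ck k \<rho>" "\<And>x. norm x > R \<Longrightarrow> \<rho> x = 0"
    and f: "integrable M f" and T [measurable]: "T \<in> borel_measurable M"
  shows "((\<lambda>x. \<integral>y. f y * \<rho> (x - T y) \<partial>M) has_derivative
     (\<lambda>h. \<Sum>b\<in>Basis. (h \<bullet> b) * (\<integral>y. f y * frechet_derivative \<rho> (at (x - T y)) b \<partial>M))) (at x)"
    (is "(?F has_derivative ?D) _")
proof -
  define D where "D = (\<lambda>z. frechet_derivative \<rho> (at z))"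
  note [measurable] = borel_measurable_integrable[OF f]
  have hd: "(\<rho> has_derivative D z) (at z)" for z
    unfolding D_def using assms(1)[of 1] by (intro Ck_has_derivative[of 0]) simp
  have int: "integrable M (\<lambda>y. f y * \<sigma> (x - T y))"
    if \<sigma>: "continuous_on UNIV \<sigma>" "\<And>x. norm x > R \<Longrightarrow> \<sigma> x = 0" for \<sigma> :: "'a \<Rightarrow> real" and x
  proof -
    obtain B where B: "B \<ge> 0" "\<And>x. \<bar>\<sigma> x\<bar> \<le> B"
      using bounded_continuous_bounded_support[OF \<sigma>] by metis
    have [measurable]: "\<sigma> \<in> borel_measurable borel"
      using \<sigma>(1) by (simp add: borel_measurable_continuous_onI)
    show ?thesis
    proof (rule Bochner_Integration.integrable_bound[where f="\<lambda>y. B * f y"])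
      show "AE y in M. norm (f y * \<sigma> (x - T y)) \<le> norm (B * f y)"
        using B by (auto simp: abs_mult intro!: AE_I2 intro: order_trans[OF mult_right_mono[of _ B]] simp: mult.commute[of "\<bar>f _\<bar>"])
    qed (use f in auto)
  qed
  have int\<rho>: "integrable M (\<lambda>y. f y * \<rho> (x - T y))" for x
    using Ck_continuous[OF assms(1)[of 0]] assms(2) by (rule int)
  have intD: "integrable M (\<lambda>y. f y * D (x - T y) b)" if "b \<in> Basis" for x b
    using Ck_continuous[OF smooth_frechet_derivative[OF assms(1) that, of 0]]
    by (intro int) (auto simp: D_def frechet_derivative_zero_outside[OF assms(2)])
  \<comment> \<open>The candidate derivative is stated through partial derivatives, which makes its
    linearity evident; here it is recognised as the integral of the full derivative of the
    kernel.\<close>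
  have D_sum: "?D h = (\<integral>y. f y * D (x - T y) h \<partial>M)" for h
  proof -
    have "(\<integral>y. f y * D (x - T y) h \<partial>M) = (\<integral>y. (\<Sum>b\<in>Basis. (h \<bullet> b) * (f y * D (x - T y) b)) \<partial>M)"
      using has_derivative_Basis_sum[OF hd, of _ h]
      by (intro Bochner_Integration.integral_cong refl) (simp add: sum_distrib_left ac_simps)
    also have "\<dots> = (\<Sum>b\<in>Basis. (h \<bullet> b) * (\<integral>y. f y * D (x - T y) b \<partial>M))"
      by (subst Bochner_Integration.integral_sum) (auto intro!: intD)
    finally show ?thesis by (simp add: D_def)
  qed
  have intDh: "integrable M (\<lambda>y. f y * D (x - T y) h)" for h
  proof -
    have "integrable M (\<lambda>y. (\<Sum>b\<in>Basis. (h \<bullet> b) * (f y * D (x - T y) b)))"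
      by (auto intro!: intD)
    also have "(\<lambda>y. (\<Sum>b\<in>Basis. (h \<bullet> b) * (f y * D (x - T y) b))) = (\<lambda>y. f y * D (x - T y) h)"
      using has_derivative_Basis_sum[OF hd, of _ h] by (simp add: sum_distrib_left ac_simps)
    finally show ?thesis .
  qed
  have "bounded_linear ?D"
    by (intro bounded_linear_sum bounded_linear_mult_left[THEN bounded_linear_compose] bounded_linear_inner_left)
  moreover have "\<exists>d>0. \<forall>y. norm (y - x) < d \<longrightarrow> norm (?F y - ?F x - ?D (y - x)) \<le> e * norm (y - x)" if "e > 0" for e
  proof -
    define N where "N = (\<integral>y. \<bar>f y\<bar> \<partial>M)"
    have N: "N \<ge> 0" unfolding N_def by simp
    define e' where "e' = e / (N + 1)"
    have e': "e' > 0" using that N by (simp add: e'_def)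
    obtain d where d: "d > 0" "\<And>z h. norm h < d \<Longrightarrow> \<bar>\<rho> (z + h) - \<rho> z - D z h\<bar> \<le> e' * norm h"
      using C1_uniform_linearization[OF assms(1)[of 1] assms(2) e'] unfolding D_def by metis
    have "norm (?F y - ?F x - ?D (y - x)) \<le> e * norm (y - x)" if y: "norm (y - x) < d" for y
    proof -
      have "?F y - ?F x - ?D (y - x)
          = (\<integral>z. f z * \<rho> (y - T z) - f z * \<rho> (x - T z) - f z * D (x - T z) (y - x) \<partial>M)"
        unfolding D_sum by (subst Bochner_Integration.integral_diff Bochner_Integration.integral_diff;
            (intro Bochner_Integration.integrable_diff int\<rho> intDh)?)+ simp
      also have "norm \<dots> \<le> (\<integral>z. e' * norm (y - x) * \<bar>f z\<bar> \<partial>M)"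
      proof (rule order_trans[OF integral_norm_bound integral_mono])
        fix z
        have "f z * \<rho> (y - T z) - f z * \<rho> (x - T z) - f z * D (x - T z) (y - x)
           = f z * (\<rho> (x - T z + (y - x)) - \<rho> (x - T z) - D (x - T z) (y - x))"
          by (simp add: algebra_simps)
        then have "norm (f z * \<rho> (y - T z) - f z * \<rho> (x - T z) - f z * D (x - T z) (y - x))
           = \<bar>f z\<bar> * \<bar>\<rho> (x - T z + (y - x)) - \<rho> (x - T z) - D (x - T z) (y - x)\<bar>"
          by (simp add: abs_mult)
        also have "\<dots> \<le> \<bar>f z\<bar> * (e' * norm (y - x))"
          using d(2)[OF y, of "x - T z"] by (intro mult_left_mono) auto
        finally show "norm (f z * \<rho> (y - T z) - f z * \<rho> (x - T z) - f z * D (x - T z) (y - x))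
            \<le> e' * norm (y - x) * \<bar>f z\<bar>" by (simp add: mult_ac)
      qed (intro Bochner_Integration.integrable_diff int\<rho> intDh integrable_mult_right integrable_abs integrable_norm f)+
      also have "\<dots> = e' * N * norm (y - x)" by (simp add: N_def)
      also have "\<dots> \<le> e * norm (y - x)"
        using N that \<open>e > 0\<close> by (intro mult_right_mono) (auto simp: e'_def field_simps)
      finally show ?thesis .
    qed
    with d(1) show ?thesis by blast
  qed
  ultimately show ?thesis unfolding has_derivative_at_alt by blast
qed

text \<open>All derivatives fall on the kernel, and the partial derivatives of a smooth kernel are
  smooth kernels with the same support bound; hence the induction generalises over
  \<open>\<rho>\<close>.\<close>

lemma Ck_convolution:
  fixes \<rho> :: "'a::euclidean_space \<Rightarrow> real" and f :: "'b \<Rightarrow> real" and T :: "'b \<Rightarrow> 'a"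
  assumes "\<And>k. Ck k \<rho>" "\<And>x. norm x > R \<Longrightarrow> \<rho> x = 0" "integrable M f" "T \<in> borel_measurable M"
  shows "Ck k (\<lambda>x. \<integral>y. f y * \<rho> (x - T y) \<partial>M)"
  using assms(1,2)
proof (induction k arbitrary: \<rho>)
  case 0
  have "(\<lambda>x. \<integral>y. f y * \<rho> (x - T y) \<partial>M) differentiable (at x)" for x
    unfolding differentiable_def using has_derivative_convolution[OF 0 assms(3,4)] by blast
  then show ?case
    by (auto intro!: continuous_at_imp_continuous_on differentiable_imp_continuous_within)
next
  case (Suc k)
  show ?case
  proof (rule Ck_SucI[OF has_derivative_convolution[OF Suc.prems assms(3,4)]])
    fix b :: 'a assume b: "b \<in> Basis"
    have "Ck k (\<lambda>x. \<integral>y. f y * frechet_derivative \<rho> (at (x - T y)) b \<partial>M)"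
      using smooth_frechet_derivative[OF Suc.prems(1) b]
      by (intro Suc.IH) (simp_all add: frechet_derivative_zero_outside[of R \<rho>, OF Suc.prems(2)])
    also have "(\<lambda>x. \<integral>y. f y * frechet_derivative \<rho> (at (x - T y)) b \<partial>M)
       = (\<lambda>x. \<Sum>c\<in>Basis. (b \<bullet> c) * (\<integral>y. f y * frechet_derivative \<rho> (at (x - T y)) c \<partial>M))"
      using b by (simp add: inner_Basis if_distrib[where f="\<lambda>t. t * _"] sum.delta cong: if_cong)
    finally show "Ck k (\<lambda>x. \<Sum>c\<in>Basis. (b \<bullet> c) * (\<integral>y. f y * frechet_derivative \<rho> (at (x - T y)) c \<partial>M))" .
  qed
qed

lemma frechet_derivative_convolution:
  fixes \<rho> :: "'a::euclidean_space \<Rightarrow> real" and f :: "'b \<Rightarrow> real" and T :: "'b \<Rightarrow> 'a"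
  assumes "\<And>k. Ck k \<rho>" "\<And>x. norm x > R \<Longrightarrow> \<rho> x = 0" "integrable M f" "T \<in> borel_measurable M" "b \<in> Basis"
  shows "frechet_derivative (\<lambda>x. \<integral>y. f y * \<rho> (x - T y) \<partial>M) (at (x::'a)) b
    = (\<integral>y. f y * frechet_derivative \<rho> (at (x - T y)) b \<partial>M)"
  using frechet_derivative_at[OF has_derivative_convolution[OF assms(1-4)], symmetric] assms(5)
  by (simp add: inner_Basis if_distrib[where f="\<lambda>t. t * _"] sum.delta cong: if_cong)


section \<open>Powers, Jensen averages and continuity of translations\<close>

text \<open>The p-th power of the L^p norm on the whole space. Values in \<open>ennreal\<close> make
  sense before finiteness is known, and since no root is taken, the quasi-triangle inequality with
  factor \<open>2 powr p\<close> does the work of Minkowski's inequality.\<close>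

definition Lp_pow :: "real \<Rightarrow> ('a::euclidean_space \<Rightarrow> real) \<Rightarrow> ennreal" where
  "Lp_pow p f = (\<integral>\<^sup>+x. ennreal (\<bar>f x\<bar> powr p) \<partial>lborel)"

lemma powr_abs_add_le:
  fixes a b :: real assumes "p \<ge> 0"
  shows "\<bar>a + b\<bar> powr p \<le> 2 powr p * (\<bar>a\<bar> powr p + \<bar>b\<bar> powr p)"
proof -
  have "\<bar>a + b\<bar> powr p \<le> (2 * max \<bar>a\<bar> \<bar>b\<bar>) powr p"
    using assms by (intro powr_mono2) auto
  also have "\<dots> = 2 powr p * max \<bar>a\<bar> \<bar>b\<bar> powr p" by (simp add: powr_mult)
  also have "max \<bar>a\<bar> \<bar>b\<bar> powr p \<le> \<bar>a\<bar> powr p + \<bar>b\<bar> powr p" by (auto simp: max_def)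
  finally show ?thesis by simp
qed

lemma ennreal_powr_abs_add_le:
  fixes a b :: real assumes "p \<ge> 0"
  shows "ennreal (\<bar>a + b\<bar> powr p) \<le> ennreal (2 powr p) * (ennreal (\<bar>a\<bar> powr p) + ennreal (\<bar>b\<bar> powr p))"
  using powr_abs_add_le[OF assms, of a b]
  by (simp add: ennreal_plus[symmetric] ennreal_mult[symmetric] ennreal_leI del: ennreal_plus)

lemma Lp_pow_mono_AE:
  assumes "p \<ge> 0" "AE x in lborel. \<bar>f x\<bar> \<le> \<bar>g x\<bar>"
  shows "Lp_pow p f \<le> Lp_pow p g"
  unfolding Lp_pow_def using assms by (intro nn_integral_mono_AE) (auto intro!: powr_mono2 ennreal_leI)

lemma Lp_pow_add:
  assumes [measurable]: "f \<in> borel_measurable borel" "g \<in> borel_measurable borel" and "p \<ge> 0"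
  shows "Lp_pow p (\<lambda>x. f x + g x) \<le> ennreal (2 powr p) * (Lp_pow p f + Lp_pow p g)"
proof -
  have "Lp_pow p (\<lambda>x. f x + g x) \<le> (\<integral>\<^sup>+x. ennreal (2 powr p) * (ennreal (\<bar>f x\<bar> powr p) + ennreal (\<bar>g x\<bar> powr p)) \<partial>lborel)"
    unfolding Lp_pow_def by (intro nn_integral_mono ennreal_powr_abs_add_le assms)
  also have "\<dots> = ennreal (2 powr p) * (Lp_pow p f + Lp_pow p g)"
    unfolding Lp_pow_def by (subst nn_integral_cmult) (auto simp: nn_integral_add)
  finally show ?thesis .
qed

lemma Lp_pow_diff:
  assumes [measurable]: "f \<in> borel_measurable borel" "g \<in> borel_measurable borel" and "p \<ge> 0"
  shows "Lp_pow p (\<lambda>x. f x - g x) \<le> ennreal (2 powr p) * (Lp_pow p f + Lp_pow p g)"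
  using Lp_pow_add[of f "\<lambda>x. - g x" p] assms by (simp add: Lp_pow_def)

lemma Lp_pow_cmult:
  assumes [measurable]: "f \<in> borel_measurable borel"
  shows "Lp_pow p (\<lambda>x. c * f x) = ennreal (\<bar>c\<bar> powr p) * Lp_pow p f"
  unfolding Lp_pow_def by (subst nn_integral_cmult[symmetric]) (auto simp: abs_mult powr_mult ennreal_mult)

lemma Lp_pow_1: "Lp_pow 1 f = (\<integral>\<^sup>+x. ennreal \<bar>f x\<bar> \<partial>lborel)"
  by (simp add: Lp_pow_def)

section \<open>Translations of integrals\<close>

lemma nn_integral_translate:
  assumes [measurable]: "f \<in> borel_measurable borel"
  shows "(\<integral>\<^sup>+x. f (x + a) \<partial>lborel) = (\<integral>\<^sup>+x. f x \<partial>(lborel :: 'a::euclidean_space measure))"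
proof -
  have "(\<integral>\<^sup>+x. f x \<partial>(distr lborel borel ((+) a))) = (\<integral>\<^sup>+x. f (a + x) \<partial>lborel)"
    by (subst nn_integral_distr) auto
  then show ?thesis by (simp add: lborel_distr_plus add.commute)
qed

lemma nn_integral_translate_indicator:
  assumes [measurable]: "f \<in> borel_measurable borel" and "\<And>x. x \<in> A \<Longrightarrow> x + a \<in> B"
    and [measurable]: "A \<in> sets borel" "B \<in> sets borel"
  shows "(\<integral>\<^sup>+x. f (x + a) * indicator A x \<partial>lborel) \<le> (\<integral>\<^sup>+x. f x * indicator B x \<partial>(lborel :: 'a::euclidean_space measure))"
proof -
  have "(\<integral>\<^sup>+x. f (x + a) * indicator A x \<partial>lborel) \<le> (\<integral>\<^sup>+x. f (x + a) * indicator B (x + a) \<partial>lborel)"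
    using assms(2) by (intro nn_integral_mono) (auto simp: indicator_def)
  also have "\<dots> = (\<integral>\<^sup>+x. f x * indicator B x \<partial>lborel)"
    by (rule nn_integral_translate) measurable
  finally show ?thesis .
qed

lemma Lp_pow_translate:
  assumes [measurable]: "f \<in> borel_measurable borel"
  shows "Lp_pow p (\<lambda>x. f (x + a)) = Lp_pow p f"
  unfolding Lp_pow_def by (rule nn_integral_translate[where f="\<lambda>x. ennreal (\<bar>f x\<bar> powr p)"]) measurable

lemma integrable_iff_Lp_pow_1:
  assumes "f \<in> borel_measurable borel"
  shows "integrable lborel f \<longleftrightarrow> Lp_pow 1 f < \<infinity>"
  using assms by (simp add: integrable_iff_bounded Lp_pow_1)

lemma le_one_add_powr:
  fixes t :: real assumes "p \<ge> 1" "t \<ge> 0" shows "t \<le> 1 + t powr p"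
proof (cases "t \<le> 1")
  case False
  then have "t powr 1 \<le> t powr p" using assms by (intro powr_mono) auto
  with False show ?thesis by simp
qed (use powr_ge_zero[of t p] in linarith)

text \<open>On the bounded support \<open>t \<le> 1 + t powr p\<close> dominates the function by an
  integrable one.\<close>

lemma integrable_if_Lp_pow_bounded_support:
  fixes f :: "'a::euclidean_space \<Rightarrow> real"
  assumes [measurable]: "f \<in> borel_measurable borel" and "Lp_pow p f < \<infinity>" "p \<ge> 1" "bounded S" "\<And>x. x \<notin> S \<Longrightarrow> f x = 0"
  shows "integrable lborel f"
proof -
  obtain R where R: "S \<subseteq> cball 0 R" using assms(4) bounded_iff[of S] by (metis mem_cball_0 subsetI)
  have "Lp_pow 1 f \<le> (\<integral>\<^sup>+x. indicator (cball 0 R) x + ennreal (\<bar>f x\<bar> powr p) \<partial>lborel)"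
    unfolding Lp_pow_1
  proof (intro nn_integral_mono)
    fix x :: 'a
    show "ennreal \<bar>f x\<bar> \<le> indicator (cball 0 R) x + ennreal (\<bar>f x\<bar> powr p)"
    proof (cases "x \<in> cball 0 R")
      case True
      have "ennreal \<bar>f x\<bar> \<le> ennreal (1 + \<bar>f x\<bar> powr p)"
        using le_one_add_powr[OF assms(3), of "\<bar>f x\<bar>"] by (intro ennreal_leI) auto
      with True show ?thesis by simp
    next
      case False
      then have "f x = 0" using assms(5)[of x] R by blast
      then show ?thesis using assms(3) by simp
    qed
  qed
  also have "\<dots> = emeasure lborel (cball (0::'a) R) + Lp_pow p f"
    unfolding Lp_pow_def by (subst nn_integral_add) (auto intro!: borel_measurable_indicator)
  also have "\<dots> < \<infinity>"
    using assms(2) emeasure_bounded_finite[of "cball (0::'a) R"] by (simp add: ennreal_add_less_top)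
  finally show ?thesis using integrable_iff_Lp_pow_1[of f] by simp
qed

text \<open>Young's inequality with weight \<open>1 / p\<close> for the numbers
  \<open>t powr p\<close> and 1. It is the tangent line bound for the p-th power at
  \<open>t = 1\<close>.\<close>

lemma powr_Bernoulli:
  fixes t :: real assumes "p \<ge> 1" "t \<ge> 0"
  shows "t \<le> t powr p / p + (1 - 1 / p)"
proof (cases "t = 0")
  case False
  then have "(t powr p) powr (1 / p) * 1 powr (1 - 1 / p) \<le> 1 / p * t powr p + (1 - 1 / p) * 1"
    using assms by (intro Youngs_inequality_0) auto
  then show ?thesis using assms by (simp add: powr_powr)
qed (use assms in simp)

text \<open>Integrating \<open>powr_Bernoulli\<close> for \<open>\<bar>f\<bar> / A\<close>, with
  \<open>A\<close> the mean of \<open>\<bar>f\<bar>\<close>, gives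
  \<open>1 / p \<le> I / (A powr p * p)\<close>, that is \<open>A powr p \<le> I\<close>.\<close>

lemma Jensen_powr:
  fixes f :: "'b \<Rightarrow> real"
  assumes M: "emeasure M (space M) = 1" and [measurable]: "f \<in> borel_measurable M" and p: "p \<ge> 1"
  shows "ennreal (\<bar>\<integral>x. f x \<partial>M\<bar> powr p) \<le> (\<integral>\<^sup>+x. ennreal (\<bar>f x\<bar> powr p) \<partial>M)"
proof (cases "(\<integral>\<^sup>+x. ennreal (\<bar>f x\<bar> powr p) \<partial>M) < \<infinity>")
  case True
  interpret finite_measure M by (rule finite_measureI) (simp add: M)
  have M1: "measure M (space M) = 1" using M by (simp add: measure_def)
  have ip: "integrable M (\<lambda>x. \<bar>f x\<bar> powr p)"
    using True by (intro integrableI_bounded) auto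
  have i: "integrable M f"
  proof (rule Bochner_Integration.integrable_bound[where f="\<lambda>x. 1 + \<bar>f x\<bar> powr p"])
    show "AE x in M. norm (f x) \<le> norm (1 + \<bar>f x\<bar> powr p)"
      using le_one_add_powr[OF p] by (auto intro!: AE_I2 simp: abs_of_nonneg)
  qed (use ip in auto)
  define A where "A = (\<integral>x. \<bar>f x\<bar> \<partial>M)"
  define I where "I = (\<integral>x. \<bar>f x\<bar> powr p \<partial>M)"
  have A0: "A \<ge> 0" and I0: "I \<ge> 0" unfolding A_def I_def by auto
  have "A powr p \<le> I"
  proof (cases "A = 0")
    case False
    with A0 have A: "A > 0" by simp
    have "1 = (\<integral>x. \<bar>f x\<bar> / A \<partial>M)" using A by (simp add: A_def)
    also have "\<dots> \<le> (\<integral>x. \<bar>f x\<bar> powr p / (A powr p * p) + (1 - 1 / p) \<partial>M)"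
    proof (rule integral_mono)
      fix x
      show "\<bar>f x\<bar> / A \<le> \<bar>f x\<bar> powr p / (A powr p * p) + (1 - 1 / p)"
        using powr_Bernoulli[OF p, of "\<bar>f x\<bar> / A"] A by (simp add: powr_divide)
    qed (use i ip in auto)
    also have "\<dots> = I / (A powr p * p) + (1 - 1 / p)"
      using ip by (simp add: I_def M1)
    finally have "1 / p \<le> I / (A powr p * p)" by simp
    then show ?thesis using A p by (simp add: field_simps)
  qed (use I0 p in simp)
  moreover have "\<bar>\<integral>x. f x \<partial>M\<bar> powr p \<le> A powr p"
    unfolding A_def using p by (intro powr_mono2) (auto intro: integral_abs_bound)
  moreover have "(\<integral>\<^sup>+x. ennreal (\<bar>f x\<bar> powr p) \<partial>M) = ennreal I"
    unfolding I_def by (intro nn_integral_eq_integral ip) auto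
  ultimately show ?thesis by (simp add: ennreal_leI)
qed (simp add: not_less top_unique)

text \<open>
  Integrability is not assumed: if \<open>f\<close> is not integrable, its Bochner integral is 0 by convention, while the
  right-hand side is infinite.
\<close>

lemma Jensen_powr_diff:
  fixes f :: "'b \<Rightarrow> real"
  assumes M: "emeasure M (space M) = 1" and [measurable]: "f \<in> borel_measurable M" and p: "p \<ge> 1"
  shows "ennreal (\<bar>(\<integral>x. f x \<partial>M) - c\<bar> powr p) \<le> (\<integral>\<^sup>+x. ennreal (\<bar>f x - c\<bar> powr p) \<partial>M)"
proof (cases "integrable M f")
  case True
  interpret finite_measure M by (rule finite_measureI) (simp add: M)
  have "(\<integral>x. f x \<partial>M) - c = (\<integral>x. f x - c \<partial>M)"
    using True M by (simp add: measure_def)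
  then show ?thesis using Jensen_powr[OF M, of "\<lambda>x. f x - c"] p by simp
next
  case False
  interpret finite_measure M by (rule finite_measureI) (simp add: M)
  have "\<not> (\<integral>\<^sup>+x. ennreal (\<bar>f x - c\<bar> powr p) \<partial>M) < \<infinity>"
  proof
    assume fin: "(\<integral>\<^sup>+x. ennreal (\<bar>f x - c\<bar> powr p) \<partial>M) < \<infinity>"
    have "integrable M (\<lambda>x. \<bar>f x - c\<bar> powr p)"
      using fin by (intro integrableI_bounded) auto
    then have "integrable M (\<lambda>x. 1 + \<bar>c\<bar> + \<bar>f x - c\<bar> powr p)" by simp
    then have "integrable M f"
    proof (rule Bochner_Integration.integrable_bound)
      show "AE x in M. norm (f x) \<le> norm (1 + \<bar>c\<bar> + \<bar>f x - c\<bar> powr p)"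
      proof (rule AE_I2)
        fix x
        have "\<bar>f x - c\<bar> \<le> 1 + \<bar>f x - c\<bar> powr p" using le_one_add_powr[OF p, of "\<bar>f x - c\<bar>"] by simp
        then show "norm (f x) \<le> norm (1 + \<bar>c\<bar> + \<bar>f x - c\<bar> powr p)" by simp
      qed
    qed simp
    with False show False by simp
  qed
  then show ?thesis by (simp add: not_less top_unique)
qed

text \<open>Jensen moves the power inside the average and Tonelli exchanges the integrals, so a
  bound uniform in the translation passes to the average. It serves mollifiers and segment averages
  alike: the weight \<open>w\<close> localises to a boundary layer, and \<open>c\<close> is either
  \<open>f\<close> itself or 0.\<close>

lemma average_weighted_le:
  fixes f c :: "'a::euclidean_space \<Rightarrow> real" and T :: "'b \<Rightarrow> 'a"
  assumes M: "emeasure M (space M) = 1" and p: "p \<ge> 1"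
    and [measurable]: "T \<in> borel_measurable M" "f \<in> borel_measurable borel" "c \<in> borel_measurable borel" "w \<in> borel_measurable borel"
    and le: "AE s in M. (\<integral>\<^sup>+x. ennreal (\<bar>f (x + T s) - c x\<bar> powr p) * w x \<partial>lborel) \<le> \<eta>"
  shows "(\<integral>\<^sup>+x. ennreal (\<bar>(\<integral>s. f (x + T s) \<partial>M) - c x\<bar> powr p) * w x \<partial>lborel) \<le> \<eta>"
proof -
  interpret M: finite_measure M by (rule finite_measureI) (simp add: M)
  interpret pair_sigma_finite lborel M ..
  have "(\<integral>\<^sup>+x. ennreal (\<bar>(\<integral>s. f (x + T s) \<partial>M) - c x\<bar> powr p) * w x \<partial>lborel)
     \<le> (\<integral>\<^sup>+x. (\<integral>\<^sup>+s. ennreal (\<bar>f (x + T s) - c x\<bar> powr p) \<partial>M) * w x \<partial>lborel)"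
    by (intro nn_integral_mono mult_right_mono Jensen_powr_diff M p) auto
  also have "\<dots> = (\<integral>\<^sup>+x. (\<integral>\<^sup>+s. ennreal (\<bar>f (x + T s) - c x\<bar> powr p) * w x \<partial>M) \<partial>lborel)"
    by (intro nn_integral_cong nn_integral_multc[symmetric]) measurable
  also have "\<dots> = (\<integral>\<^sup>+s. (\<integral>\<^sup>+x. ennreal (\<bar>f (x + T s) - c x\<bar> powr p) * w x \<partial>lborel) \<partial>M)"
    by (rule Fubini'[symmetric]) measurable
  also have "\<dots> \<le> (\<integral>\<^sup>+s. \<eta> \<partial>M)" by (intro nn_integral_mono_AE le)
  also have "\<dots> = \<eta>" by (simp add: M)
  finally show ?thesis .
qed

lemma Lp_pow_average_diff:
  fixes f :: "'a::euclidean_space \<Rightarrow> real" and T :: "'b \<Rightarrow> 'a"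
  assumes M: "emeasure M (space M) = 1" and p: "p \<ge> 1"
    and [measurable]: "T \<in> borel_measurable M" "f \<in> borel_measurable borel"
    and le: "AE s in M. Lp_pow p (\<lambda>x. f (x + T s) - f x) \<le> \<eta>"
  shows "Lp_pow p (\<lambda>x. (\<integral>s. f (x + T s) \<partial>M) - f x) \<le> \<eta>"
  using average_weighted_le[OF assms(1-4), of f "\<lambda>x. 1" \<eta>] le by (simp add: Lp_pow_def)

lemma Lp_pow_average:
  fixes f :: "'a::euclidean_space \<Rightarrow> real" and T :: "'b \<Rightarrow> 'a"
  assumes M: "emeasure M (space M) = 1" and p: "p \<ge> 1"
    and [measurable]: "T \<in> borel_measurable M" "f \<in> borel_measurable borel"
  shows "Lp_pow p (\<lambda>x. \<integral>s. f (x + T s) \<partial>M) \<le> Lp_pow p f"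
  using average_weighted_le[OF assms(1-4), of "\<lambda>x. 0" "\<lambda>x. 1" "Lp_pow p f"] Lp_pow_translate[of f p]
  by (simp add: Lp_pow_def)

lemma borel_measurable_average:
  fixes f :: "'a::euclidean_space \<Rightarrow> real" and T :: "'b \<Rightarrow> 'a"
  assumes M: "finite_measure M"
    and [measurable]: "T \<in> borel_measurable M" "f \<in> borel_measurable borel"
  shows "(\<lambda>x. \<integral>s. f (x + T s) \<partial>M) \<in> borel_measurable borel"
proof -
  interpret finite_measure M by fact
  show ?thesis by measurable
qed

text \<open>Squeeze \<open>A\<close> between a compact \<open>K\<close> and an open \<open>V\<close>
  with \<open>V - K\<close> small. For a shift shorter than the distance from \<open>K\<close> to
  the complement of \<open>V\<close>, the indicator can change only if \<open>x\<close> or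
  \<open>x + y\<close> lies in \<open>V - K\<close>.\<close>

lemma indicator_translation_continuous:
  fixes A :: "'a::euclidean_space set"
  assumes [measurable]: "A \<in> sets borel" and fin: "emeasure lborel A < \<infinity>" and e: "e > 0"
  shows "\<exists>\<delta>>0. \<forall>y. norm y < \<delta> \<longrightarrow> Lp_pow 1 (\<lambda>x. indicator A (x + y) - indicator A x) \<le> ennreal e"
proof -
  obtain V where V: "open V" "A \<subseteq> V" "emeasure lborel (V - A) < ennreal (e / 8)"
    using outer_regular_lborel[OF assms(1), of "e / 8"] e by auto
  obtain C where C: "closed C" "C \<subseteq> A" "emeasure lebesgue (A - C) < ennreal (e / 8)"
    by (rule sets_lebesgue_inner_closed[of A "e / 8"]) (use e in \<open>auto intro: that\<close>)
  have "(\<lambda>n. emeasure lborel (A - cball 0 (real n))) \<longlonglongrightarrow> emeasure lborel (\<Inter>n. A - cball 0 (real n))"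
  proof (rule Lim_emeasure_decseq)
    show "decseq (\<lambda>n. A - cball 0 (real n))" by (auto simp: decseq_def)
    show "emeasure lborel (A - cball 0 (real n)) \<noteq> \<infinity>" for n
      using emeasure_mono[of "A - cball 0 (real n)" A lborel] fin by (auto simp: top_unique)
  qed auto
  moreover have "(\<Inter>n. A - cball 0 (real n)) = {}"
    using real_arch_simple by fastforce
  ultimately have "(\<lambda>n. emeasure lborel (A - cball 0 (real n))) \<longlonglongrightarrow> 0" by (simp only: emeasure_empty)
  then have "\<forall>\<^sub>F n in sequentially. emeasure lborel (A - cball 0 (real n)) < ennreal (e / 8)"
    using e by (intro order_tendstoD(2)[where a="ennreal (e / 8)"]) auto
  then obtain n where n: "emeasure lborel (A - cball 0 (real n)) < ennreal (e / 8)"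
    by (auto simp: eventually_sequentially)
  define K where "K = C \<inter> cball 0 (real n)"
  have K: "compact K" "K \<subseteq> A" using C by (auto simp: K_def closed_Int_compact)
  have Kb[measurable]: "K \<in> sets borel" "V \<in> sets borel" "C \<in> sets borel"
    using K C V by (auto intro: borel_compact)
  have "emeasure lborel (V - K) \<le> emeasure lborel ((V - A) \<union> ((A - C) \<union> (A - cball 0 (real n))))"
    by (intro emeasure_mono) (auto simp: K_def)
  also have "\<dots> \<le> emeasure lborel (V - A) + (emeasure lborel (A - C) + emeasure lborel (A - cball 0 (real n)))"
    by (intro order_trans[OF emeasure_subadditive] add_left_mono emeasure_subadditive) auto
  also have "\<dots> \<le> ennreal (e / 8) + (ennreal (e / 8) + ennreal (e / 8))"
    using V C n by (intro add_mono) auto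
  also have "\<dots> \<le> ennreal (e / 2)"
    using e by (simp add: ennreal_plus[symmetric] ennreal_leI del: ennreal_plus)
  finally have VK: "emeasure lborel (V - K) \<le> ennreal (e / 2)" .
  obtain \<delta> where \<delta>: "\<delta> > 0" "\<And>x y. x \<in> K \<Longrightarrow> dist x y < \<delta> \<Longrightarrow> y \<in> V"
  proof -
    have "K \<inter> - V = {}" using K V by auto
    then obtain d where "d > 0" "\<And>x y. x \<in> K \<Longrightarrow> y \<in> - V \<Longrightarrow> d \<le> dist x y"
      using separate_compact_closed[OF K(1) closed_Compl[OF V(1)]] by blast
    then show ?thesis using that[of d] by fastforce
  qed
  have "Lp_pow 1 (\<lambda>x. indicator A (x + y) - indicator A x) \<le> ennreal e" if y: "norm y < \<delta>" for y
  proof -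
    have "Lp_pow 1 (\<lambda>x. indicator A (x + y) - indicator A x)
       \<le> (\<integral>\<^sup>+x. indicator (V - K) x + indicator (V - K) (x + y) \<partial>lborel)"
      unfolding Lp_pow_1
    proof (intro nn_integral_mono)
      fix x :: 'a
      have "x \<in> K \<Longrightarrow> x + y \<in> V" "x + y \<in> K \<Longrightarrow> x \<in> V"
        using \<delta>(2)[of x "x + y"] \<delta>(2)[of "x + y" x] y by (auto simp: dist_norm)
      then show "ennreal \<bar>indicator A (x + y) - indicator A x\<bar> \<le> indicator (V - K) x + indicator (V - K) (x + y)"
        using V(2) K(2) by (auto simp: indicator_def)
    qed
    also have "\<dots> = emeasure lborel (V - K) + emeasure lborel (V - K)"
      using nn_integral_translate[of "indicator (V - K)" y] by (subst nn_integral_add) auto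
    also have "\<dots> \<le> ennreal (e / 2) + ennreal (e / 2)" using VK by (intro add_mono)
    also have "\<dots> = ennreal e" using e by (subst ennreal_plus[symmetric]) auto
    finally show ?thesis .
  qed
  with \<delta>(1) show ?thesis by blast
qed

lemma L1_translation_continuous:
  fixes f :: "'a::euclidean_space \<Rightarrow> real"
  assumes "integrable lborel f" "e > 0"
  shows "\<exists>\<delta>>0. \<forall>y. norm y < \<delta> \<longrightarrow> Lp_pow 1 (\<lambda>x. f (x + y) - f x) \<le> ennreal e"
  using assms
proof (induction arbitrary: e rule: integrable_induct)
  case (base A c)
  have "\<exists>\<delta>>0. \<forall>y. norm y < \<delta> \<longrightarrow> Lp_pow 1 (\<lambda>x. indicator A (x + y) - indicator A x) \<le> ennreal (e / (\<bar>c\<bar> + 1))"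
    using base by (intro indicator_translation_continuous) auto
  then obtain \<delta> where \<delta>: "\<delta> > 0"
    "\<And>y. norm y < \<delta> \<Longrightarrow> Lp_pow 1 (\<lambda>x. indicator A (x + y) - indicator A x) \<le> ennreal (e / (\<bar>c\<bar> + 1))" by blast
  have [measurable]: "A \<in> sets borel" using base by simp
  have "Lp_pow 1 (\<lambda>x. indicator A (x + y) *\<^sub>R c - indicator A x *\<^sub>R c) \<le> ennreal e" if "norm y < \<delta>" for y
  proof -
    have "Lp_pow 1 (\<lambda>x. indicator A (x + y) *\<^sub>R c - indicator A x *\<^sub>R c)
       = ennreal \<bar>c\<bar> * Lp_pow 1 (\<lambda>x. indicator A (x + y) - indicator A x)"
      by (subst Lp_pow_cmult[of _ 1 c, simplified, symmetric]) (auto simp: algebra_simps)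
    also have "\<dots> \<le> ennreal \<bar>c\<bar> * ennreal (e / (\<bar>c\<bar> + 1))"
      by (intro mult_left_mono \<delta> that) auto
    also have "\<dots> \<le> ennreal e"
      using base by (subst ennreal_mult[symmetric]) (auto intro!: ennreal_leI simp: field_simps)
    finally show ?thesis .
  qed
  with \<delta>(1) show ?case by blast
next
  case (add f g)
  note [measurable] = borel_measurable_integrable[OF add.hyps(1), simplified] borel_measurable_integrable[OF add.hyps(2), simplified]
  obtain \<delta>1 where \<delta>1: "\<delta>1 > 0" "\<And>y. norm y < \<delta>1 \<Longrightarrow> Lp_pow 1 (\<lambda>x. f (x + y) - f x) \<le> ennreal (e / 4)"
    using add.IH(1)[of "e / 4"] add.prems by auto
  obtain \<delta>2 where \<delta>2: "\<delta>2 > 0" "\<And>y. norm y < \<delta>2 \<Longrightarrow> Lp_pow 1 (\<lambda>x. g (x + y) - g x) \<le> ennreal (e / 4)"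
    using add.IH(2)[of "e / 4"] add.prems by auto
  have "Lp_pow 1 (\<lambda>x. f (x + y) + g (x + y) - (f x + g x)) \<le> ennreal e" if "norm y < min \<delta>1 \<delta>2" for y
  proof -
    have "Lp_pow 1 (\<lambda>x. f (x + y) + g (x + y) - (f x + g x)) = Lp_pow 1 (\<lambda>x. (f (x + y) - f x) + (g (x + y) - g x))"
      by (simp add: algebra_simps)
    also have "\<dots> \<le> ennreal (2 powr 1) * (Lp_pow 1 (\<lambda>x. f (x + y) - f x) + Lp_pow 1 (\<lambda>x. g (x + y) - g x))"
      by (rule Lp_pow_add) auto
    also have "\<dots> \<le> ennreal (2 powr 1) * (ennreal (e / 4) + ennreal (e / 4))"
      using that by (intro mult_left_mono add_mono \<delta>1 \<delta>2) auto
    also have "\<dots> = ennreal e" using add.prems by (simp add: ennreal_mult[symmetric] ennreal_plus[symmetric] numeral_mult_ennreal del: ennreal_plus)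
    finally show ?thesis .
  qed
  with \<delta>1(1) \<delta>2(1) show ?case by (intro exI[of _ "min \<delta>1 \<delta>2"]) auto
next
  case (lim f s)
  note [measurable] = borel_measurable_integrable[OF lim.hyps(1), simplified] borel_measurable_integrable[OF lim.hyps(4), simplified]
  have "(\<lambda>i. \<integral>\<^sup>+x. norm (f x - s i x) \<partial>lborel) \<longlonglongrightarrow> 0"
  proof (rule nn_integral_dominated_convergence_norm[where w="\<lambda>x. 2 * norm (f x)"])
    show "(\<integral>\<^sup>+x. ennreal (2 * norm (f x)) \<partial>lborel) < \<infinity>"
      using lim.hyps(4) by (simp add: integrable_iff_bounded ennreal_mult nn_integral_cmult ennreal_mult_less_top)
  qed (use lim.hyps in auto)
  then have "\<forall>\<^sub>F i in sequentially. (\<integral>\<^sup>+x. norm (f x - s i x) \<partial>lborel) < ennreal (e / 16)"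
    using lim.prems by (intro order_tendstoD(2)) auto
  then obtain i where i: "Lp_pow 1 (\<lambda>x. f x - s i x) \<le> ennreal (e / 16)"
    by (auto simp: eventually_sequentially Lp_pow_1 intro: less_imp_le)
  obtain \<delta> where \<delta>: "\<delta> > 0" "\<And>y. norm y < \<delta> \<Longrightarrow> Lp_pow 1 (\<lambda>x. s i (x + y) - s i x) \<le> ennreal (e / 16)"
    using lim.IH[of "e / 16" i] lim.prems by auto
  have "Lp_pow 1 (\<lambda>x. f (x + y) - f x) \<le> ennreal e" if "norm y < \<delta>" for y
  proof -
    have "Lp_pow 1 (\<lambda>x. f (x + y) - f x)
       = Lp_pow 1 (\<lambda>x. (f (x + y) - s i (x + y)) + ((s i (x + y) - s i x) - (f x - s i x)))"
      by (simp add: algebra_simps)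
    also have "\<dots> \<le> ennreal (2 powr 1) * (Lp_pow 1 (\<lambda>x. f (x + y) - s i (x + y)) + Lp_pow 1 (\<lambda>x. (s i (x + y) - s i x) - (f x - s i x)))"
      by (rule Lp_pow_add) auto
    also have "\<dots> \<le> ennreal (2 powr 1) * (Lp_pow 1 (\<lambda>x. f (x + y) - s i (x + y)) +
        ennreal (2 powr 1) * (Lp_pow 1 (\<lambda>x. s i (x + y) - s i x) + Lp_pow 1 (\<lambda>x. f x - s i x)))"
      by (intro mult_left_mono add_left_mono Lp_pow_diff) auto
    also have "Lp_pow 1 (\<lambda>x. f (x + y) - s i (x + y)) = Lp_pow 1 (\<lambda>x. f x - s i x)"
      by (rule Lp_pow_translate[of "\<lambda>x. f x - s i x"]) auto
    also have "ennreal (2 powr 1) * (Lp_pow 1 (\<lambda>x. f x - s i x) +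
        ennreal (2 powr 1) * (Lp_pow 1 (\<lambda>x. s i (x + y) - s i x) + Lp_pow 1 (\<lambda>x. f x - s i x)))
      \<le> ennreal (2 powr 1) * (ennreal (e / 16) + ennreal (2 powr 1) * (ennreal (e / 16) + ennreal (e / 16)))"
      using that by (intro mult_left_mono add_mono i \<delta>) auto
    also have "\<dots> \<le> ennreal e" using lim.prems by (simp add: ennreal_mult[symmetric] ennreal_plus[symmetric] numeral_mult_ennreal del: ennreal_plus)
    finally show ?thesis .
  qed
  with \<delta>(1) show ?case by blast
qed

text \<open>Clipping at a high level is a small error in L^p. The clipped function has bounded
  increments, whose p-th powers are at most a constant times their absolute values, and this reduces
  the claim to \<open>L1_translation_continuous\<close>.\<close>

lemma Lp_translation_continuous:
  fixes f :: "'a::euclidean_space \<Rightarrow> real"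
  assumes f: "integrable lborel f" "Lp_pow p f < \<infinity>" and p: "p \<ge> 1" and e: "e > 0"
  shows "\<exists>\<delta>>0. \<forall>y. norm y < \<delta> \<longrightarrow> Lp_pow p (\<lambda>x. f (x + y) - f x) \<le> ennreal e"
proof -
  note [measurable] = borel_measurable_integrable[OF f(1), simplified]
  define c where "c M x = max (- M) (min M (f x))" for M x
  have [measurable]: "c M \<in> borel_measurable borel" for M unfolding c_def by measurable
  define k where "k = 2 powr p"
  have k: "k \<ge> 1" using p by (simp add: k_def ge_one_powr_ge_zero)
  \<comment> \<open>The nested quasi-triangle inequalities will produce
    \<open>k (e' + 2 k e')\<close>, at most \<open>3 k^2 e'\<close>.\<close>
  define e' where "e' = e / (8 * k * k)"
  have e': "e' > 0" using e k by (simp add: e'_def)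
  have "(\<lambda>n. \<integral>\<^sup>+x. ennreal (norm (0 - \<bar>f x - c (real n) x\<bar> powr p)) \<partial>lborel) \<longlonglongrightarrow> 0"
  proof (rule nn_integral_dominated_convergence_norm[where w="\<lambda>x. \<bar>f x\<bar> powr p"])
    show "AE x in lborel. norm (\<bar>f x - c (real n) x\<bar> powr p) \<le> \<bar>f x\<bar> powr p" for n
      using p by (auto intro!: AE_I2 powr_mono2 simp: c_def)
    show "AE x in lborel. (\<lambda>n. \<bar>f x - c (real n) x\<bar> powr p) \<longlonglongrightarrow> 0"
    proof (rule AE_I2)
      fix x
      obtain N where N: "\<bar>f x\<bar> \<le> real N" using real_arch_simple by blast
      have "\<forall>\<^sub>F n in sequentially. \<bar>f x - c (real n) x\<bar> powr p = 0"
        using eventually_ge_at_top[of N]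
      proof eventually_elim
        case (elim n)
        then have "\<bar>f x\<bar> \<le> real n" using N by linarith
        then have "f x - c (real n) x = 0" unfolding c_def by linarith
        then show ?case using p by simp
      qed
      then show "(\<lambda>n. \<bar>f x - c (real n) x\<bar> powr p) \<longlonglongrightarrow> 0" by (rule tendsto_eventually)
    qed
  qed (use f(2) in \<open>auto simp: Lp_pow_def\<close>)
  then have "\<forall>\<^sub>F n in sequentially. (\<integral>\<^sup>+x. ennreal (norm (0 - \<bar>f x - c (real n) x\<bar> powr p)) \<partial>lborel) < ennreal e'"
    using e' by (intro order_tendstoD(2)) auto
  then obtain n where n: "Lp_pow p (\<lambda>x. f x - c (real n) x) \<le> ennreal e'"
    by (auto simp: eventually_sequentially Lp_pow_def intro: less_imp_le)
  \<comment> \<open>Increments of the clipped function are at most \<open>2 n\<close>; the added 1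
    keeps \<open>m\<close> positive for \<open>n = 0\<close>.\<close>
  define m where "m = (2 * real n + 1) powr (p - 1)"
  have m: "m > 0" by (simp add: m_def)
  obtain \<delta> where \<delta>: "\<delta> > 0" "\<And>y. norm y < \<delta> \<Longrightarrow> Lp_pow 1 (\<lambda>x. f (x + y) - f x) \<le> ennreal (e' / m)"
    using L1_translation_continuous[OF f(1), of "e' / m"] e' m by auto
  have "Lp_pow p (\<lambda>x. f (x + y) - f x) \<le> ennreal e" if y: "norm y < \<delta>" for y
  proof -
    have "Lp_pow p (\<lambda>x. c n (x + y) - c n x) \<le> (\<integral>\<^sup>+x. ennreal m * ennreal \<bar>f (x + y) - f x\<bar> \<partial>lborel)"
      unfolding Lp_pow_def
    proof (intro nn_integral_mono)
      fix x
      define a where "a = \<bar>c n (x + y) - c n x\<bar>"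
      have a: "a \<le> \<bar>f (x + y) - f x\<bar>" "a \<le> 2 * real n + 1" "a \<ge> 0" unfolding a_def c_def by linarith+
      have "a powr p = a powr (p - 1) * a" using a(3) by (cases "a = 0") (auto simp: powr_diff)
      also have "\<dots> \<le> m * \<bar>f (x + y) - f x\<bar>"
        unfolding m_def using a p by (intro mult_mono powr_mono2) auto
      finally show "ennreal (\<bar>c n (x + y) - c n x\<bar> powr p) \<le> ennreal m * ennreal \<bar>f (x + y) - f x\<bar>"
        using m by (simp add: a_def ennreal_mult[symmetric] ennreal_leI)
    qed
    also have "\<dots> = ennreal m * Lp_pow 1 (\<lambda>x. f (x + y) - f x)"
      by (simp add: nn_integral_cmult Lp_pow_1)
    also have "\<dots> \<le> ennreal m * ennreal (e' / m)" by (intro mult_left_mono \<delta> y) auto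
    also have "\<dots> = ennreal e'" using m e' by (simp add: ennreal_mult[symmetric])
    finally have 1: "Lp_pow p (\<lambda>x. c n (x + y) - c n x) \<le> ennreal e'" .
    have "Lp_pow p (\<lambda>x. f (x + y) - f x)
       = Lp_pow p (\<lambda>x. (f (x + y) - c n (x + y)) + ((c n (x + y) - c n x) - (f x - c n x)))"
      by (simp add: algebra_simps)
    also have "\<dots> \<le> ennreal k * (Lp_pow p (\<lambda>x. f (x + y) - c n (x + y)) + Lp_pow p (\<lambda>x. (c n (x + y) - c n x) - (f x - c n x)))"
      unfolding k_def using p by (intro Lp_pow_add) auto
    also have "\<dots> \<le> ennreal k * (Lp_pow p (\<lambda>x. f (x + y) - c n (x + y)) +
        ennreal k * (Lp_pow p (\<lambda>x. c n (x + y) - c n x) + Lp_pow p (\<lambda>x. f x - c n x)))"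
      unfolding k_def using p by (intro mult_left_mono add_left_mono Lp_pow_diff) auto
    also have "Lp_pow p (\<lambda>x. f (x + y) - c n (x + y)) = Lp_pow p (\<lambda>x. f x - c n x)"
      by (rule Lp_pow_translate[of "\<lambda>x. f x - c n x"]) auto
    also have "ennreal k * (Lp_pow p (\<lambda>x. f x - c n x) +
        ennreal k * (Lp_pow p (\<lambda>x. c n (x + y) - c n x) + Lp_pow p (\<lambda>x. f x - c n x)))
      \<le> ennreal k * (ennreal e' + ennreal k * (ennreal e' + ennreal e'))"
      by (intro mult_left_mono add_mono n 1) auto
    also have "\<dots> = ennreal (k * (e' + k * (e' + e')))"
      using k e' by (simp add: ennreal_mult[symmetric] ennreal_plus[symmetric] numeral_mult_ennreal del: ennreal_plus)
    also have "\<dots> \<le> ennreal e"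
    proof (rule ennreal_leI)
      have "k * (e' + k * (e' + e')) \<le> k * (k * e' + k * (e' + e'))"
        using k e' by (intro mult_left_mono add_right_mono) auto
      also have "\<dots> = 3 / 8 * e" using k by (simp add: e'_def field_simps)
      finally show "k * (e' + k * (e' + e')) \<le> e" using e by simp
    qed
    finally show ?thesis .
  qed
  with \<delta>(1) show ?thesis by blast
qed


section \<open>Mollification and uniqueness of weak partial derivatives\<close>

text \<open>Evenness is included so that convolution with \<open>\<rho>\<close> is the average of
  the translates \<open>f (x + y)\<close> under the probability density \<open>\<rho>\<close>. All
  estimates for averages of translates then apply to \<open>mollify\<close>.\<close>

definition mollifier :: "real \<Rightarrow> ('a::euclidean_space \<Rightarrow> real) \<Rightarrow> bool" where
  "mollifier \<epsilon> \<rho> \<longleftrightarrow> (\<forall>k. Ck k \<rho>) \<and> (\<forall>x. \<rho> x \<ge> 0) \<and> (\<forall>x. norm x > \<epsilon> \<longrightarrow> \<rho> x = 0) \<and>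
     integrable lborel \<rho> \<and> integral\<^sup>L lborel \<rho> = 1 \<and> (\<forall>x. \<rho> (- x) = \<rho> x)"

definition mollify :: "('a::euclidean_space \<Rightarrow> real) \<Rightarrow> ('a \<Rightarrow> real) \<Rightarrow> 'a \<Rightarrow> real" where
  "mollify \<rho> f x = (\<integral>y. f y * \<rho> (x - y) \<partial>lborel)"

lemma ex_mollifier: "\<epsilon> > 0 \<Longrightarrow> \<exists>\<rho>::'a::euclidean_space \<Rightarrow> real. mollifier \<epsilon> \<rho>"
  unfolding mollifier_def by (rule mollifier_exists[of \<epsilon>]) auto

lemma mollifier_continuous: "mollifier \<epsilon> \<rho> \<Longrightarrow> continuous_on UNIV \<rho>"
  unfolding mollifier_def by (rule Ck_continuous[of 0]) blast

lemma mollifier_measurable: "mollifier \<epsilon> \<rho> \<Longrightarrow> \<rho> \<in> borel_measurable borel"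
  by (intro borel_measurable_continuous_onI mollifier_continuous)

lemma mollifier_density:
  assumes "mollifier \<epsilon> \<rho>"
  shows "emeasure (density lborel \<rho>) (space (density lborel \<rho>)) = 1"
    and "AE y in density lborel \<rho>. norm y \<le> \<epsilon>"
proof -
  note [measurable] = mollifier_measurable[OF assms]
  have "emeasure (density lborel \<rho>) (space (density lborel \<rho>)) = (\<integral>\<^sup>+x. ennreal (\<rho> x) \<partial>lborel)"
    by (simp add: emeasure_density)
  also have "\<dots> = 1"
    using assms by (subst nn_integral_eq_integral) (auto simp: mollifier_def)
  finally show "emeasure (density lborel \<rho>) (space (density lborel \<rho>)) = 1" .
  show "AE y in density lborel \<rho>. norm y \<le> \<epsilon>"
    using assms by (subst AE_density) (auto simp: mollifier_def not_less[symmetric] intro!: AE_I2)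
qed

lemma lborel_integral_translate:
  fixes f :: "'a::euclidean_space \<Rightarrow> real"
  assumes [measurable]: "f \<in> borel_measurable borel"
  shows "(\<integral>x. f (x + a) \<partial>lborel) = (\<integral>x. f x \<partial>lborel)"
proof -
  have "(\<integral>x. f x \<partial>(distr lborel borel ((+) a))) = (\<integral>x. f (a + x) \<partial>lborel)"
    by (subst integral_distr) auto
  then show ?thesis by (simp add: lborel_distr_plus add.commute)
qed

lemma integrable_translate:
  fixes f :: "'a::euclidean_space \<Rightarrow> real"
  assumes "integrable lborel f"
  shows "integrable lborel (\<lambda>x. f (x + a))"
  using assms Lp_pow_translate[of f 1 a] borel_measurable_integrable[OF assms]
  by (simp add: integrable_iff_Lp_pow_1)

lemma mollify_average:
  fixes f :: "'a::euclidean_space \<Rightarrow> real"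
  assumes "mollifier \<epsilon> \<rho>" and [measurable]: "f \<in> borel_measurable borel"
  shows "mollify \<rho> f x = (\<integral>y. f (x + y) \<partial>density lborel \<rho>)"
proof -
  note [measurable] = mollifier_measurable[OF assms(1)]
  have "(\<integral>y. f (x + y) \<partial>density lborel \<rho>) = (\<integral>y. \<rho> y * f (x + y) \<partial>lborel)"
    using assms(1) by (subst integral_density) (auto simp: mollifier_def)
  also have "\<dots> = (\<integral>y. \<rho> ((y + x) - x) * f (y + x) \<partial>lborel)" by (simp add: add.commute)
  also have "\<dots> = (\<integral>y. \<rho> (y - x) * f y \<partial>lborel)"
    by (rule lborel_integral_translate[where f="\<lambda>y. \<rho> (y - x) * f y"]) measurable
  also have "\<dots> = mollify \<rho> f x"
    unfolding mollify_def
  proof (intro Bochner_Integration.integral_cong refl)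
    fix y
    have "\<rho> (y - x) = \<rho> (x - y)" using assms(1) minus_diff_eq[of x y] unfolding mollifier_def by metis
    then show "\<rho> (y - x) * f y = f y * \<rho> (x - y)" by simp
  qed
  finally show ?thesis by simp
qed

lemma mollify_measurable:
  assumes "mollifier \<epsilon> \<rho>" and [measurable]: "f \<in> borel_measurable borel"
  shows "mollify \<rho> f \<in> borel_measurable borel"
proof -
  note [measurable] = mollifier_measurable[OF assms(1)]
  show ?thesis unfolding mollify_def[abs_def] by measurable
qed

lemma Lp_pow_mollify:
  assumes "mollifier \<epsilon> \<rho>" "f \<in> borel_measurable borel" "p \<ge> 1"
  shows "Lp_pow p (mollify \<rho> f) \<le> Lp_pow p f"
  using Lp_pow_average[OF mollifier_density(1)[OF assms(1)] assms(3) _ assms(2), of "\<lambda>y. y"]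
    mollify_average[OF assms(1,2)]
  by (simp add: mollify_average[OF assms(1,2), abs_def])

text \<open>The bound is uniform over all mollifiers of small radius, since it only uses continuity
  of translations; hence one mollifier can serve finitely many functions at once.\<close>

lemma Lp_pow_mollify_diff:
  assumes f: "integrable lborel f" "Lp_pow p f < \<infinity>" and p: "p \<ge> 1" and e: "e > 0"
  shows "\<exists>\<delta>>0. \<forall>\<epsilon> \<rho>. \<epsilon> < \<delta> \<longrightarrow> mollifier \<epsilon> \<rho> \<longrightarrow> Lp_pow p (\<lambda>x. mollify \<rho> f x - f x) \<le> ennreal e"
proof -
  have m: "f \<in> borel_measurable borel" using f(1) by simp
  obtain \<delta> where \<delta>: "\<delta> > 0" "\<And>y. norm y < \<delta> \<Longrightarrow> Lp_pow p (\<lambda>x. f (x + y) - f x) \<le> ennreal e"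
    using Lp_translation_continuous[OF assms] by blast
  have "Lp_pow p (\<lambda>x. mollify \<rho> f x - f x) \<le> ennreal e" if "\<epsilon> < \<delta>" "mollifier \<epsilon> \<rho>" for \<epsilon> \<rho>
    unfolding mollify_average[OF that(2) m]
  proof (rule Lp_pow_average_diff[OF mollifier_density(1)[OF that(2)] p _ m])
    show "AE s in density lborel \<rho>. Lp_pow p (\<lambda>x. f (x + s) - f x) \<le> ennreal e"
      using mollifier_density(2)[OF that(2)] by (rule eventually_mono) (use that \<delta> in auto)
  qed simp
  with \<delta>(1) show ?thesis by blast
qed

lemma test_functions_bounded_support:
  assumes "\<phi> \<in> test_functions \<Omega>"
  obtains R where "\<And>x. norm x > R \<Longrightarrow> \<phi> x = 0"
proof -
  have "bounded (closure {x. \<phi> x \<noteq> 0})" using assms by (simp add: test_functions_def compact_imp_bounded)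
  then obtain R where "\<And>x. x \<in> closure {x. \<phi> x \<noteq> 0} \<Longrightarrow> norm x \<le> R" unfolding bounded_iff by auto
  then have "norm x > R \<Longrightarrow> \<phi> x = 0" for x using closure_subset[of "{x. \<phi> x \<noteq> 0}"] by force
  then show ?thesis using that by blast
qed

lemma test_functionsI:
  fixes \<phi> :: "'a::euclidean_space \<Rightarrow> real"
  assumes "\<And>k. Ck k \<phi>" "compact K" "K \<subseteq> \<Omega>" "\<And>x. x \<notin> K \<Longrightarrow> \<phi> x = 0"
  shows "\<phi> \<in> test_functions \<Omega>"
proof -
  have "closure {x. \<phi> x \<noteq> 0} \<subseteq> K"
    using assms(2,4) by (intro closure_minimal) (auto intro: compact_imp_closed)
  then show ?thesis
    using assms compact_closure[of "{x. \<phi> x \<noteq> 0}"] bounded_subset[OF compact_imp_bounded[OF assms(2)]]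
      closure_subset[of "{x. \<phi> x \<noteq> 0}"]
    unfolding test_functions_def by blast
qed

text \<open>The counterpart of \<open>locally_integrable\<close> for Borel functions on the whole
  space with \<open>lborel\<close>, where translations and Fubini apply directly. The transfer is
  made through \<open>borel_version\<close>.\<close>

definition locally_integrable_borel :: "'a::euclidean_space set \<Rightarrow> ('a \<Rightarrow> real) \<Rightarrow> bool" where
  "locally_integrable_borel \<Omega> f \<longleftrightarrow> f \<in> borel_measurable borel \<and>
     (\<forall>K. compact K \<longrightarrow> K \<subseteq> \<Omega> \<longrightarrow> integrable lborel (\<lambda>x. indicator K x * f x))"

text \<open>On a compact piece \<open>C n\<close> of an exhaustion, a mollification of radius below
  the distance from \<open>C n\<close> to the outside of the next piece tests \<open>f\<close> with
  a translated kernel and is therefore 0. As the radius shrinks it converges in L^1 to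
  \<open>f\<close> on \<open>C n\<close>.\<close>

lemma fundamental_lemma:
  fixes f :: "'a::euclidean_space \<Rightarrow> real"
  assumes "open U" and f: "locally_integrable_borel U f"
    and zero: "\<And>\<phi>. \<phi> \<in> test_functions U \<Longrightarrow> (\<integral>x. f x * \<phi> x \<partial>lborel) = 0"
  shows "AE x in lborel. x \<in> U \<longrightarrow> f x = 0"
proof -
  have [measurable]: "f \<in> borel_measurable borel" using f by (simp add: locally_integrable_borel_def)
  obtain C where C: "\<And>n. compact (C n)" "\<And>n. C n \<subseteq> U" "\<And>n. C n \<subseteq> interior (C (Suc n))" "(\<Union>n. C n) = U"
    using open_Union_compact_subsets[OF assms(1)] by (metis (full_types))
  have "AE x in lborel. x \<in> C n \<longrightarrow> f x = 0" for n :: nat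
  proof -
    define L where "L = C (Suc n)"
    define g where "g x = indicator L x * f x" for x
    have [measurable]: "L \<in> sets borel" "C n \<in> sets borel"
      using C(1)[of "Suc n"] C(1)[of n] by (auto simp: L_def borel_compact)
    have g: "integrable lborel g"
      using f C(1)[of "Suc n"] C(2)[of "Suc n"] unfolding g_def[abs_def] L_def locally_integrable_borel_def by blast
    note [measurable] = borel_measurable_integrable[OF g, simplified]
    have "C n \<inter> - interior L = {}" using C(3)[of n] by (auto simp: L_def)
    then have "\<exists>d>0. \<forall>x\<in>C n. \<forall>y\<in>- interior L. d \<le> dist x y"
      by (intro separate_compact_closed C(1) closed_Compl open_interior)
    then obtain d where d: "d > 0" "\<And>x y. x \<in> C n \<Longrightarrow> y \<in> - interior L \<Longrightarrow> d \<le> dist x y"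
      by metis
    have small: "(\<integral>\<^sup>+x. ennreal \<bar>f x\<bar> * indicator (C n) x \<partial>lborel) \<le> ennreal e" if e: "e > 0" for e
    proof -
      have g1: "Lp_pow 1 g < \<infinity>" using g by (simp add: integrable_iff_Lp_pow_1)
      obtain \<delta> where \<delta>: "\<delta> > 0" "\<And>\<epsilon> \<rho>. \<epsilon> < \<delta> \<Longrightarrow> mollifier \<epsilon> \<rho> \<Longrightarrow> Lp_pow 1 (\<lambda>x. mollify \<rho> g x - g x) \<le> ennreal e"
        using Lp_pow_mollify_diff[OF g g1 order_refl e] by metis
      define \<epsilon> where "\<epsilon> = min \<delta> d / 2"
      have \<epsilon>: "\<epsilon> > 0" "\<epsilon> < \<delta>" "\<epsilon> < d" using \<delta>(1) d(1) by (auto simp: \<epsilon>_def)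
      obtain \<rho> :: "'a \<Rightarrow> real" where \<rho>: "mollifier \<epsilon> \<rho>" using ex_mollifier[OF \<epsilon>(1)] by blast
      have 0: "mollify \<rho> g x = 0" if x: "x \<in> C n" for x
      proof -
        have sub: "cball x \<epsilon> \<subseteq> L"
        proof
          fix y assume "y \<in> cball x \<epsilon>"
          then have "dist x y < d" using \<epsilon> by auto
          then have "y \<in> interior L" using d(2)[OF x, of y] by force
          then show "y \<in> L" using interior_subset by blast
        qed
        have "Ck k (\<lambda>y. \<rho> (x - y))" for k
        proof -
          \<comment> \<open>A translate of the kernel is its convolution with a point mass, so its
            smoothness is an instance of \<open>Ck_convolution\<close>.\<close>
          have "Ck k (\<lambda>y. \<integral>s. 1 * \<rho> (y - x) \<partial>count_space {()})"
            using \<rho> by (intro Ck_convolution[where R=\<epsilon>]) (auto simp: mollifier_def integrable_count_space)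
          moreover have "\<rho> (y - x) = \<rho> (x - y)" for y
            using \<rho> minus_diff_eq[of x y] unfolding mollifier_def by metis
          ultimately show ?thesis by (simp add: lebesgue_integral_count_space_finite)
        qed
        moreover have z: "\<rho> (x - y) = 0" if "y \<notin> cball x \<epsilon>" for y
          using that \<rho> by (auto simp: mollifier_def dist_norm)
        ultimately have "(\<lambda>y. \<rho> (x - y)) \<in> test_functions U"
          using sub C(2)[of "Suc n"] by (intro test_functionsI[of _ "cball x \<epsilon>"]) (auto simp: L_def)
        from zero[OF this] have "(\<integral>y. f y * \<rho> (x - y) \<partial>lborel) = 0" .
        also have "(\<lambda>y. f y * \<rho> (x - y)) = (\<lambda>y. g y * \<rho> (x - y))"
          using z sub by (force simp: g_def indicator_def)
        finally show ?thesis by (simp add: mollify_def)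
      qed
      have "(\<integral>\<^sup>+x. ennreal \<bar>f x\<bar> * indicator (C n) x \<partial>lborel) \<le> Lp_pow 1 (\<lambda>x. mollify \<rho> g x - g x)"
        unfolding Lp_pow_1
      proof (intro nn_integral_mono)
        fix x
        have "x \<in> C n \<Longrightarrow> x \<in> L" using C(3)[of n] interior_subset L_def by blast
        then show "ennreal \<bar>f x\<bar> * indicator (C n) x \<le> ennreal \<bar>mollify \<rho> g x - g x\<bar>"
          using 0[of x] by (cases "x \<in> C n") (auto simp: g_def)
      qed
      also have "\<dots> \<le> ennreal e" using \<delta>(2)[OF \<epsilon>(2) \<rho>] .
      finally show ?thesis .
    qed
    have "(\<integral>\<^sup>+x. ennreal \<bar>f x\<bar> * indicator (C n) x \<partial>lborel) = 0"
      using small by (metis (no_types) ennreal_0 ennreal_le_epsilon le_zero_eq add_0)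
    then have "AE x in lborel. ennreal \<bar>f x\<bar> * indicator (C n) x = 0"
      by (subst (asm) nn_integral_0_iff_AE) auto
    then show ?thesis by (rule eventually_mono) (auto simp: indicator_def split: if_splits)
  qed
  then have "AE x in lborel. \<forall>n. x \<in> C n \<longrightarrow> f x = 0" by (subst AE_all_countable) simp
  then show ?thesis by (rule eventually_mono) (use C(4) in blast)
qed

lemma mollify_test_function:
  assumes \<rho>: "mollifier \<epsilon> \<rho>" and f: "integrable lborel f" and "compact K" "K \<subseteq> \<Omega>"
    and "\<And>x y. f y \<noteq> 0 \<Longrightarrow> norm (x - y) \<le> \<epsilon> \<Longrightarrow> x \<in> K"
  shows "mollify \<rho> f \<in> test_functions \<Omega>"
proof (rule test_functionsI[OF _ assms(3,4)])
  show "Ck k (mollify \<rho> f)" for k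
    unfolding mollify_def[abs_def] using \<rho> f by (intro Ck_convolution[where R=\<epsilon>]) (auto simp: mollifier_def)
  show "mollify \<rho> f x = 0" if "x \<notin> K" for x
  proof -
    have "f y * \<rho> (x - y) = 0" for y
      using assms(5)[of y x] that \<rho> unfolding mollifier_def by (cases "f y = 0") (auto simp: not_less[symmetric])
    then have "(\<lambda>y. f y * \<rho> (x - y)) = (\<lambda>y. 0)" by (rule ext)
    then show ?thesis by (simp add: mollify_def)
  qed
qed

definition weak_partial_borel :: "'a::euclidean_space set \<Rightarrow> 'a \<Rightarrow> ('a \<Rightarrow> real) \<Rightarrow> ('a \<Rightarrow> real) \<Rightarrow> bool" where
  "weak_partial_borel \<Omega> b U G \<longleftrightarrow> locally_integrable_borel \<Omega> U \<and> locally_integrable_borel \<Omega> G \<and>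
    (\<forall>\<phi>\<in>test_functions \<Omega>. (\<integral>x. U x * frechet_derivative \<phi> (at x) b \<partial>lborel) = - (\<integral>x. G x * \<phi> x \<partial>lborel))"

lemma integrable_times_test_function:
  fixes F :: "'a::euclidean_space \<Rightarrow> real"
  assumes F: "locally_integrable_borel \<Omega> F" and \<phi>: "\<phi> \<in> test_functions \<Omega>"
  shows "integrable lborel (\<lambda>x. F x * \<phi> x)"
proof -
  define K where "K = closure {x. \<phi> x \<noteq> 0}"
  have K: "compact K" "K \<subseteq> \<Omega>" using \<phi> by (auto simp: K_def test_functions_def)
  have Ck: "Ck 0 \<phi>" using \<phi> by (auto simp: test_functions_def)
  obtain R where R: "\<And>x. norm x > R \<Longrightarrow> \<phi> x = 0" using test_functions_bounded_support[OF \<phi>] by blast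
  obtain B where B: "B \<ge> 0" "\<And>x. \<bar>\<phi> x\<bar> \<le> B"
    using bounded_continuous_bounded_support[OF Ck_continuous[OF Ck] R] by blast
  have [measurable]: "\<phi> \<in> borel_measurable borel" "F \<in> borel_measurable borel"
    using Ck F by (auto simp: borel_measurable_continuous_onI locally_integrable_borel_def)
  have "integrable lborel (\<lambda>x. B * (indicator K x * F x))"
    using F K by (auto simp: locally_integrable_borel_def)
  then show ?thesis
  proof (rule Bochner_Integration.integrable_bound)
    have "norm (F x * \<phi> x) \<le> norm (B * (indicator K x * F x))" for x
    proof (cases "x \<in> K")
      case True
      then show ?thesis using B(1) B(2)[of x] mult_left_mono[of "\<bar>\<phi> x\<bar>" B "\<bar>F x\<bar>"] by (simp add: abs_mult mult.commute)
    next
      case False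
      then have "\<phi> x = 0" using closure_subset[of "{x. \<phi> x \<noteq> 0}"] by (auto simp: K_def)
      then show ?thesis by simp
    qed
    then show "AE x in lborel. norm (F x * \<phi> x) \<le> norm (B * (indicator K x * F x))" by simp
  qed measurable
qed

lemma weak_partial_borel_unique:
  assumes "open \<Omega>" "weak_partial_borel \<Omega> b U G" "weak_partial_borel \<Omega> b U H"
  shows "AE x in lborel. x \<in> \<Omega> \<longrightarrow> G x = H x"
proof -
  have G: "locally_integrable_borel \<Omega> G" and H: "locally_integrable_borel \<Omega> H"
    using assms by (auto simp: weak_partial_borel_def)
  have "AE x in lborel. x \<in> \<Omega> \<longrightarrow> G x - H x = 0"
  proof (rule fundamental_lemma[OF assms(1)])
    show "locally_integrable_borel \<Omega> (\<lambda>x. G x - H x)"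
      using G H unfolding locally_integrable_borel_def by (auto simp: right_diff_distrib)
    fix \<phi> assume \<phi>: "\<phi> \<in> test_functions \<Omega>"
    have "(\<integral>x. (G x - H x) * \<phi> x \<partial>lborel) = (\<integral>x. G x * \<phi> x \<partial>lborel) - (\<integral>x. H x * \<phi> x \<partial>lborel)"
      using integrable_times_test_function[OF G \<phi>] integrable_times_test_function[OF H \<phi>] by (simp add: left_diff_distrib)
    also have "\<dots> = 0" using assms(2,3) \<phi> by (auto simp: weak_partial_borel_def)
    finally show "(\<integral>x. (G x - H x) * \<phi> x \<partial>lborel) = 0" .
  qed
  then show ?thesis by (rule eventually_mono) simp
qed


section \<open>Increments of weakly differentiable functions along segments\<close>

text \<open>Normalised to mass 1 so that Jensen's inequality applies to segment averages; the length
  \<open>h\<close> then appears as a separate factor in the increment formulas.\<close>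

definition seg_measure :: "real \<Rightarrow> real measure" where
  "seg_measure h = density lborel (\<lambda>s. ennreal (indicator {0..h} s / h))"

definition seg_avg :: "real \<Rightarrow> 'a::euclidean_space \<Rightarrow> ('a \<Rightarrow> real) \<Rightarrow> 'a \<Rightarrow> real" where
  "seg_avg h b G x = (\<integral>s. G (x + s *\<^sub>R b) \<partial>seg_measure h)"

lemma sets_seg [measurable_cong]: "sets (seg_measure h) = sets borel"
  by (simp add: seg_measure_def)

lemma emeasure_seg: assumes "h > 0" shows "emeasure (seg_measure h) (space (seg_measure h)) = 1"
proof -
  have "emeasure (seg_measure h) (space (seg_measure h)) = (\<integral>\<^sup>+s. ennreal (1 / h) * indicator {0..h} s \<partial>lborel)"
    unfolding seg_measure_def by (simp add: emeasure_density) (intro nn_integral_cong, auto simp: indicator_def)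
  also have "\<dots> = 1" using assms
    by (subst nn_integral_cmult_indicator) (auto simp: ennreal_mult[symmetric])
  finally show ?thesis .
qed

lemma finite_measure_seg: "h > 0 \<Longrightarrow> finite_measure (seg_measure h)"
  by (rule finite_measureI) (simp add: emeasure_seg)

lemma AE_seg: assumes "h > 0" shows "AE s in seg_measure h. 0 \<le> s \<and> s \<le> h"
  unfolding seg_measure_def by (subst AE_density) (auto intro!: AE_I2 simp: indicator_def split: if_splits)

lemma integral_seg:
  fixes f :: "real \<Rightarrow> real"
  assumes [measurable]: "f \<in> borel_measurable borel" and "h > 0"
  shows "(\<integral>s. f s \<partial>seg_measure h) = (\<integral>s. f s * indicator {0..h} s \<partial>lborel) / h"
proof -
  have "(\<integral>s. f s \<partial>seg_measure h) = (\<integral>s. (f s * indicator {0..h} s) / h \<partial>lborel)"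
    unfolding seg_measure_def using assms(2)
    by (subst integral_density) (auto intro!: Bochner_Integration.integral_cong simp: mult.commute)
  then show ?thesis by simp
qed

lemma seg_avg_measurable:
  assumes "h > 0" and [measurable]: "G \<in> borel_measurable borel"
  shows "seg_avg h b G \<in> borel_measurable borel"
  unfolding seg_avg_def[abs_def]
  by (rule borel_measurable_average[OF finite_measure_seg[OF assms(1)]]) measurable

lemma Lp_pow_seg_avg:
  assumes "h > 0" "p \<ge> 1" and [measurable]: "G \<in> borel_measurable borel"
  shows "Lp_pow p (seg_avg h b G) \<le> Lp_pow p G"
  unfolding seg_avg_def[abs_def]
  by (rule Lp_pow_average[OF emeasure_seg[OF assms(1)] assms(2)]) measurable

lemma FTC_seg:
  fixes \<phi> :: "'a::euclidean_space \<Rightarrow> real"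
  assumes "Ck 1 \<phi>" "b \<in> Basis" "h > 0"
  shows "\<phi> y - \<phi> (y - h *\<^sub>R b) = h * (\<integral>s. frechet_derivative \<phi> (at (y - s *\<^sub>R b)) b \<partial>seg_measure h)"
proof -
  define D where "D = (\<lambda>x. frechet_derivative \<phi> (at x) b)"
  have c: "continuous_on UNIV D" using assms by (simp add: D_def)
  have c': "continuous_on UNIV (\<lambda>s. D (y - s *\<^sub>R b))"
    by (rule continuous_on_compose2[OF c]) (auto intro!: continuous_intros)
  have "(\<integral>s. D (y - s *\<^sub>R b) * indicator {0..h} s \<partial>lborel) = - \<phi> (y - h *\<^sub>R b) - (- \<phi> (y - 0 *\<^sub>R b))"
  proof (rule integral_FTC_Icc_real)
    fix s :: real
    have 1: "((\<lambda>s. y - s *\<^sub>R b) has_derivative (\<lambda>t. - (t *\<^sub>R b))) (at s)"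
      by (auto intro!: derivative_eq_intros)
    have 2: "(\<phi> has_derivative frechet_derivative \<phi> (at (y - s *\<^sub>R b))) (at (y - s *\<^sub>R b))"
      using assms(1) by (intro Ck_has_derivative[of 0]) simp
    interpret bounded_linear "frechet_derivative \<phi> (at (y - s *\<^sub>R b))"
      using 2 by (rule has_derivative_bounded_linear)
    have "((\<lambda>s. - \<phi> (y - s *\<^sub>R b)) has_derivative (\<lambda>t. - frechet_derivative \<phi> (at (y - s *\<^sub>R b)) (- (t *\<^sub>R b)))) (at s)"
      by (intro has_derivative_minus has_derivative_compose[OF 1 2])
    moreover have "(\<lambda>t. - frechet_derivative \<phi> (at (y - s *\<^sub>R b)) (- (t *\<^sub>R b))) = (*) (D (y - s *\<^sub>R b))"
      by (simp add: D_def neg scale fun_eq_iff)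
    ultimately show "((\<lambda>s. - \<phi> (y - s *\<^sub>R b)) has_real_derivative D (y - s *\<^sub>R b)) (at s)"
      by (simp add: has_field_derivative_def)
    show "isCont (\<lambda>s. D (y - s *\<^sub>R b)) s" using c' by (simp add: continuous_on_eq_continuous_at)
  qed (use assms in simp)
  moreover have "(\<lambda>s. D (y - s *\<^sub>R b)) \<in> borel_measurable borel" using c' by (rule borel_measurable_continuous_onI)
  ultimately show ?thesis using assms(3) by (simp add: integral_seg D_def)
qed

text \<open>
  Test the weak derivative with \<open>y \<mapsto> \<integral> \<phi> (y - s b) ds\<close>, whose derivative along \<open>b\<close> is an increment of \<open>\<phi>\<close>.
\<close>

lemma translation_formula_local:
  fixes U G :: "'a::euclidean_space \<Rightarrow> real"
  assumes "open \<Omega>" and b: "b \<in> Basis" and h: "h > 0" and w: "weak_partial_borel \<Omega> b U G"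
  shows "AE x in lborel. (\<forall>s\<in>{0..h}. x + s *\<^sub>R b \<in> \<Omega>) \<longrightarrow> U (x + h *\<^sub>R b) - U x = h * seg_avg h b G x"
proof -
  \<comment> \<open>The starting points whose whole segment stays in \<open>\<Omega>\<close>. The
    defect \<open>F\<close> is tested against functions supported in this open set.\<close>
  define W where "W = {x. \<forall>s\<in>{0..h}. x + s *\<^sub>R b \<in> \<Omega>}"
  define F where "F x = U (x + h *\<^sub>R b) - U x - h * seg_avg h b G x" for x
  have [measurable]: "U \<in> borel_measurable borel" "G \<in> borel_measurable borel"
    using w by (auto simp: weak_partial_borel_def locally_integrable_borel_def)
  note [measurable] = seg_avg_measurable[OF h]
  have [measurable]: "F \<in> borel_measurable borel" unfolding F_def[abs_def] by measurable
  interpret seg_measure: finite_measure "seg_measure h" by (rule finite_measure_seg[OF h])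
  interpret pair_sigma_finite "lborel :: 'a measure" "seg_measure h" ..
  have oW: "open W"
  proof -
    \<comment> \<open>The complement of \<open>W\<close> is the sum of a compact segment and the
      closed complement of \<open>\<Omega>\<close>, hence closed.\<close>
    have "- W = (\<Union>x\<in>(\<lambda>s. - (s *\<^sub>R b)) ` {0..h}. \<Union>y\<in>- \<Omega>. {x + y})"
    proof (intro equalityI subsetI)
      fix x assume "x \<in> - W"
      then obtain s where s: "s \<in> {0..h}" "x + s *\<^sub>R b \<notin> \<Omega>" by (auto simp: W_def)
      then have "x = - (s *\<^sub>R b) + (x + s *\<^sub>R b)" "x + s *\<^sub>R b \<in> - \<Omega>" by auto
      with s(1) show "x \<in> (\<Union>x\<in>(\<lambda>s. - (s *\<^sub>R b)) ` {0..h}. \<Union>y\<in>- \<Omega>. {x + y})" by blast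
    next
      fix x assume "x \<in> (\<Union>x\<in>(\<lambda>s. - (s *\<^sub>R b)) ` {0..h}. \<Union>y\<in>- \<Omega>. {x + y})"
      then show "x \<in> - W" by (force simp: W_def)
    qed
    also have "closed \<dots>"
      using assms(1) by (intro compact_closed_sums compact_continuous_image continuous_intros compact_Icc) auto
    finally show ?thesis by (simp add: closed_def)
  qed
  \<comment> \<open>Sweeping a compact set along its segments gives a compact set in
    \<open>\<Omega>\<close>. Cutting \<open>U\<close> and \<open>G\<close> off outside it makes them
    integrable without changing the increments over \<open>K\<close>.\<close>
  have ext: "\<exists>K'. compact K' \<and> K' \<subseteq> \<Omega> \<and> (\<forall>x\<in>K. \<forall>s\<in>{0..h}. x + s *\<^sub>R b \<in> K')" if K: "compact K" "K \<subseteq> W" for K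
  proof (intro exI[of _ "\<Union>x\<in>K. \<Union>y\<in>(\<lambda>s. s *\<^sub>R b) ` {0..h}. {x + y}"] conjI)
    show "compact (\<Union>x\<in>K. \<Union>y\<in>(\<lambda>s. s *\<^sub>R b) ` {0..h}. {x + y})"
      by (intro compact_sums' K compact_continuous_image continuous_intros compact_Icc)
    show "(\<Union>x\<in>K. \<Union>y\<in>(\<lambda>s. s *\<^sub>R b) ` {0..h}. {x + y}) \<subseteq> \<Omega>" using K(2) by (auto simp: W_def)
  qed blast
  have cut: "integrable lborel (\<lambda>x. indicator K' x * U x)" "integrable lborel (\<lambda>x. indicator K' x * G x)"
    if "compact K'" "K' \<subseteq> \<Omega>" for K'
    using w that by (auto simp: weak_partial_borel_def locally_integrable_borel_def)
  have avg_eq: "seg_avg h b G x = seg_avg h b (\<lambda>x. indicator K' x * G x) x"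
    if "\<forall>s\<in>{0..h}. x + s *\<^sub>R b \<in> K'" "K' \<in> sets borel" for K' x
  proof -
    note [measurable] = that(2)
    show ?thesis unfolding seg_avg_def
    proof (rule integral_cong_AE)
      show "AE s in seg_measure h. G (x + s *\<^sub>R b) = indicator K' (x + s *\<^sub>R b) * G (x + s *\<^sub>R b)"
        using AE_seg[OF h] by (rule eventually_mono) (use that in auto)
    qed measurable
  qed
  have avg_int: "integrable lborel (seg_avg h b g)" if "integrable lborel g" for g
    using that Lp_pow_seg_avg[OF h, of 1 g b] borel_measurable_integrable[OF that]
    by (auto simp: integrable_iff_Lp_pow_1 seg_avg_measurable[OF h] intro: le_less_trans)
  have "AE x in lborel. x \<in> W \<longrightarrow> F x = 0"
  proof (rule fundamental_lemma[OF oW])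
    show "locally_integrable_borel W F"
      unfolding locally_integrable_borel_def
    proof (intro conjI allI impI)
      fix K assume K: "compact K" "K \<subseteq> W"
      obtain K' where K': "compact K'" "K' \<subseteq> \<Omega>" "\<forall>x\<in>K. \<forall>s\<in>{0..h}. x + s *\<^sub>R b \<in> K'"
        using ext[OF K] by blast
      have [measurable]: "K \<in> sets borel" "K' \<in> sets borel" using K K' by (auto intro: borel_compact)
      define U' G' where "U' x = indicator K' x * U x" and "G' x = indicator K' x * G x" for x
      have i: "integrable lborel U'" "integrable lborel G'"
        using cut[OF K'(1,2)] by (auto simp: U'_def[abs_def] G'_def[abs_def])
      have "integrable lborel (\<lambda>x. indicator K x * (U' (x + h *\<^sub>R b) - U' x - h * seg_avg h b G' x))"
        unfolding real_scaleR_def[symmetric, of "indicator K _"]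
        by (intro integrable_mult_indicator Bochner_Integration.integrable_diff
            integrable_translate integrable_mult_right i avg_int) auto
      also have "(\<lambda>x. indicator K x * (U' (x + h *\<^sub>R b) - U' x - h * seg_avg h b G' x)) = (\<lambda>x. indicator K x * F x)"
      proof
        fix x
        show "indicator K x * (U' (x + h *\<^sub>R b) - U' x - h * seg_avg h b G' x) = indicator K x * F x"
        proof (cases "x \<in> K")
          case True
          with K'(3) have k: "\<forall>s\<in>{0..h}. x + s *\<^sub>R b \<in> K'" by blast
          then have "x + h *\<^sub>R b \<in> K'" "x + 0 *\<^sub>R b \<in> K'" using h by (auto simp del: scaleR_zero_left)
          then show ?thesis using avg_eq[OF k] by (simp add: F_def U'_def G'_def[abs_def])
        qed simp
      qed
      finally show "integrable lborel (\<lambda>x. indicator K x * F x)" .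
    qed measurable
  next
    fix \<phi> assume \<phi>: "\<phi> \<in> test_functions W"
    define K where "K = closure {x. \<phi> x \<noteq> 0}"
    have K: "compact K" "K \<subseteq> W" using \<phi> by (auto simp: K_def test_functions_def)
    have \<phi>K: "\<phi> x = 0" if "x \<notin> K" for x using that closure_subset[of "{x. \<phi> x \<noteq> 0}"] by (auto simp: K_def)
    obtain K' where K': "compact K'" "K' \<subseteq> \<Omega>" "\<forall>x\<in>K. \<forall>s\<in>{0..h}. x + s *\<^sub>R b \<in> K'"
      using ext[OF K] by blast
    have [measurable]: "K \<in> sets borel" "K' \<in> sets borel" using K K' by (auto intro: borel_compact)
    define U' G' where "U' x = indicator K' x * U x" and "G' x = indicator K' x * G x" for x
    have i: "integrable lborel U'" "integrable lborel G'"
      using cut[OF K'(1,2)] by (auto simp: U'_def[abs_def] G'_def[abs_def])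
    note [measurable] = borel_measurable_integrable[OF i(1), simplified] borel_measurable_integrable[OF i(2), simplified]
    have Ck: "Ck k \<phi>" for k using \<phi> by (auto simp: test_functions_def)
    obtain R where R: "\<And>x. norm x > R \<Longrightarrow> \<phi> x = 0" using test_functions_bounded_support[OF \<phi>] by blast
    obtain B where B: "B \<ge> 0" "\<And>x. \<bar>\<phi> x\<bar> \<le> B"
      using bounded_continuous_bounded_support[OF Ck_continuous[OF Ck[of 0]] R] by blast
    have [measurable]: "\<phi> \<in> borel_measurable borel"
      using Ck[of 0] by (auto simp: borel_measurable_continuous_onI)
    have Bm: "\<bar>a * \<phi> x\<bar> \<le> B * \<bar>a\<bar>" for a x
      using mult_left_mono[OF B(2)[of x] abs_ge_zero[of a]] by (simp add: abs_mult mult.commute)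
    have mult_\<phi>: "integrable lborel (\<lambda>x. g x * \<phi> (x - a))" if "integrable lborel g" for g a
    proof (rule Bochner_Integration.integrable_bound[where f="\<lambda>x. B * g x"])
      show "AE x in lborel. norm (g x * \<phi> (x - a)) \<le> norm (B * g x)"
        using Bm B(1) by (auto intro!: AE_I2 simp: abs_mult[of B])
    qed (use that borel_measurable_integrable[OF that] in auto)
    have mult_\<phi>0: "integrable lborel (\<lambda>x. g x * \<phi> x)" if "integrable lborel g" for g
      using mult_\<phi>[OF that, of 0] by simp
    define \<Phi> where "\<Phi> y = (\<integral>s. 1 * \<phi> (y - s *\<^sub>R b) \<partial>seg_measure h)" for y
    have seg1: "integrable (seg_measure h) (\<lambda>s. 1 :: real)" by simp
    have Ck\<Phi>: "Ck k \<Phi>" for k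
      unfolding \<Phi>_def[abs_def] by (intro Ck_convolution[where R=R] Ck R seg1) measurable
    have d\<Phi>: "frechet_derivative \<Phi> (at y) b = (\<phi> y - \<phi> (y - h *\<^sub>R b)) / h" for y
    proof -
      have "frechet_derivative \<Phi> (at y) b = (\<integral>s. 1 * frechet_derivative \<phi> (at (y - s *\<^sub>R b)) b \<partial>seg_measure h)"
        unfolding \<Phi>_def[abs_def] by (intro frechet_derivative_convolution[where R=R] Ck R seg1 b) measurable
      then show ?thesis using FTC_seg[OF Ck b h, of y] h by simp
    qed
    have K'_\<phi>: "\<phi> (y - s *\<^sub>R b) = 0" if "y \<notin> K'" "s \<in> {0..h}" for y s
    proof (rule \<phi>K, rule notI)
      assume "y - s *\<^sub>R b \<in> K"
      then have "(y - s *\<^sub>R b) + s *\<^sub>R b \<in> K'" using K'(3) that(2) by blast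
      with that show False by simp
    qed
    have \<Phi>K': "\<Phi> y = 0" if "y \<notin> K'" for y
    proof -
      have "\<Phi> y = (\<integral>s. 0 \<partial>seg_measure h)" unfolding \<Phi>_def
      proof (rule integral_cong_AE)
        show "AE s in seg_measure h. 1 * \<phi> (y - s *\<^sub>R b) = 0"
          using AE_seg[OF h] by (rule eventually_mono) (use K'_\<phi> that in auto)
      qed measurable
      then show ?thesis by simp
    qed
    have "\<Phi> \<in> test_functions \<Omega>" by (intro test_functionsI[OF Ck\<Phi> K'(1,2)] \<Phi>K')
    then have "(\<integral>x. U x * frechet_derivative \<Phi> (at x) b \<partial>lborel) = - (\<integral>x. G x * \<Phi> x \<partial>lborel)"
      using w by (simp add: weak_partial_borel_def)
    moreover have "(\<lambda>x. U x * frechet_derivative \<Phi> (at x) b) = (\<lambda>x. (U' x * \<phi> x - U' x * \<phi> (x - h *\<^sub>R b)) / h)"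
    proof
      fix x
      show "U x * frechet_derivative \<Phi> (at x) b = (U' x * \<phi> x - U' x * \<phi> (x - h *\<^sub>R b)) / h"
        using K'_\<phi>[of x 0] K'_\<phi>[of x h] h by (cases "x \<in> K'") (auto simp: d\<Phi> U'_def algebra_simps)
    qed
    moreover have "(\<lambda>x. G x * \<Phi> x) = (\<lambda>x. G' x * \<Phi> x)"
      using \<Phi>K' by (auto simp: G'_def indicator_def fun_eq_iff)
    ultimately have main: "(\<integral>x. U' x * \<phi> x \<partial>lborel) - (\<integral>x. U' x * \<phi> (x - h *\<^sub>R b) \<partial>lborel) = - h * (\<integral>x. G' x * \<Phi> x \<partial>lborel)"
      using mult_\<phi>[OF i(1)] mult_\<phi>0[OF i(1)] h by (simp add: field_simps)
    have shift: "(\<integral>x. g (x + a) * \<phi> x \<partial>lborel) = (\<integral>x. g x * \<phi> (x - a) \<partial>lborel)"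
      if [measurable]: "g \<in> borel_measurable borel" for g a
      using lborel_integral_translate[of "\<lambda>x. g x * \<phi> (x - a)" a] by simp
    \<comment> \<open>Duality of averages: Fubini and translation move the average over backward
      segments from \<open>\<phi>\<close> to an average of \<open>G'\<close> over forward
      segments.\<close>
    have fub: "(\<integral>x. seg_avg h b G' x * \<phi> x \<partial>lborel) = (\<integral>x. G' x * \<Phi> x \<partial>lborel)"
    proof -
      have int1: "integrable (lborel \<Otimes>\<^sub>M seg_measure h) (\<lambda>(x, s). G' (x + s *\<^sub>R b) * \<phi> x)"
      proof (rule integrableI_bounded)
        have "(\<integral>\<^sup>+z. ennreal (norm (case z of (x, s) \<Rightarrow> G' (x + s *\<^sub>R b) * \<phi> x)) \<partial>(lborel \<Otimes>\<^sub>M seg_measure h))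
            = (\<integral>\<^sup>+s. (\<integral>\<^sup>+x. ennreal (norm (G' (x + s *\<^sub>R b) * \<phi> x)) \<partial>lborel) \<partial>seg_measure h)"
          by (subst nn_integral_snd[symmetric]) auto
        also have "\<dots> \<le> (\<integral>\<^sup>+s. (\<integral>\<^sup>+x. ennreal B * ennreal \<bar>G' (x + s *\<^sub>R b)\<bar> \<partial>lborel) \<partial>seg_measure h)"
          using Bm B(1)
          by (intro nn_integral_mono) (auto simp: ennreal_mult[symmetric] intro!: ennreal_leI)
        also have "\<dots> = (\<integral>\<^sup>+s. ennreal B * Lp_pow 1 G' \<partial>seg_measure h)"
          by (intro nn_integral_cong) (simp add: nn_integral_cmult Lp_pow_1[symmetric] Lp_pow_translate)
        also have "\<dots> < \<infinity>"
          using i(2) by (simp add: emeasure_seg[OF h] integrable_iff_Lp_pow_1 ennreal_mult_less_top)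
        finally show "(\<integral>\<^sup>+z. ennreal (norm (case z of (x, s) \<Rightarrow> G' (x + s *\<^sub>R b) * \<phi> x)) \<partial>(lborel \<Otimes>\<^sub>M seg_measure h)) < \<infinity>" .
      qed measurable
      have "(\<integral>x. seg_avg h b G' x * \<phi> x \<partial>lborel) = (\<integral>x. (\<integral>s. G' (x + s *\<^sub>R b) * \<phi> x \<partial>seg_measure h) \<partial>lborel)"
        by (simp add: seg_avg_def)
      also have "\<dots> = (\<integral>s. (\<integral>x. G' (x + s *\<^sub>R b) * \<phi> x \<partial>lborel) \<partial>seg_measure h)"
        by (rule Fubini_integral[OF int1, symmetric])
      also have "\<dots> = (\<integral>s. (\<integral>x. G' x * \<phi> (x - s *\<^sub>R b) \<partial>lborel) \<partial>seg_measure h)"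
        by (simp add: shift)
      also have "\<dots> = (\<integral>x. (\<integral>s. G' x * \<phi> (x - s *\<^sub>R b) \<partial>seg_measure h) \<partial>lborel)"
      proof (rule Fubini_integral)
        show "integrable (lborel \<Otimes>\<^sub>M seg_measure h) (\<lambda>(x, s). G' x * \<phi> (x - s *\<^sub>R b))"
        proof (rule Bochner_Integration.integrable_bound[where f="\<lambda>z. B * G' (fst z)"])
          have "integrable (lborel \<Otimes>\<^sub>M seg_measure h) (\<lambda>z. B * G' (fst z))"
            using i(2) by (intro integrableI_bounded)
              (auto simp: nn_integral_fst[symmetric] nn_integral_snd[symmetric] emeasure_seg[OF h] abs_mult ennreal_mult nn_integral_cmult
                integrable_iff_Lp_pow_1 Lp_pow_1[symmetric] ennreal_mult_less_top)
          then show "integrable (lborel \<Otimes>\<^sub>M seg_measure h) (\<lambda>z. B * G' (fst z))" .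
          show "AE z in lborel \<Otimes>\<^sub>M seg_measure h. norm (case z of (x, s) \<Rightarrow> G' x * \<phi> (x - s *\<^sub>R b)) \<le> norm (B * G' (fst z))"
            using Bm B(1) by (auto intro!: AE_I2 simp: abs_mult[of B])
        qed measurable
      qed
      also have "\<dots> = (\<integral>x. G' x * \<Phi> x \<partial>lborel)" by (simp add: \<Phi>_def)
      finally show ?thesis .
    qed
    have "(\<integral>x. F x * \<phi> x \<partial>lborel) = (\<integral>x. (U' (x + h *\<^sub>R b) * \<phi> x - U' x * \<phi> x) - h * (seg_avg h b G' x * \<phi> x) \<partial>lborel)"
    proof (intro Bochner_Integration.integral_cong refl)
      fix x
      show "F x * \<phi> x = (U' (x + h *\<^sub>R b) * \<phi> x - U' x * \<phi> x) - h * (seg_avg h b G' x * \<phi> x)"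
      proof (cases "x \<in> K")
        case True
        with K'(3) have k: "\<forall>s\<in>{0..h}. x + s *\<^sub>R b \<in> K'" by blast
        then have "x + h *\<^sub>R b \<in> K'" "x + 0 *\<^sub>R b \<in> K'" using h by (auto simp del: scaleR_zero_left)
        then show ?thesis using avg_eq[OF k] by (simp add: F_def U'_def G'_def[abs_def] algebra_simps)
      qed (simp add: \<phi>K)
    qed
    also have "\<dots> = (\<integral>x. U' (x + h *\<^sub>R b) * \<phi> x \<partial>lborel) - (\<integral>x. U' x * \<phi> x \<partial>lborel) - h * (\<integral>x. seg_avg h b G' x * \<phi> x \<partial>lborel)"
      using mult_\<phi>0[OF i(1)] mult_\<phi>0[OF integrable_translate[OF i(1)], of "h *\<^sub>R b"] mult_\<phi>0[OF avg_int[OF i(2)]] by simp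
    also have "\<dots> = 0" using main by (simp add: shift fub)
    finally show "(\<integral>x. F x * \<phi> x \<partial>lborel) = 0" .
  qed
  then show ?thesis by (rule eventually_mono) (simp add: W_def F_def)
qed


section \<open>Truncation by multiples of the distance to the complement\<close>

lemma nn_integral_vanishing:
  fixes f :: "'a \<Rightarrow> ennreal"
  assumes [measurable]: "f \<in> borel_measurable M" and fin: "(\<integral>\<^sup>+x. f x \<partial>M) < \<infinity>"
    and [measurable]: "\<And>n. A n \<in> sets M" and ev: "AE x in M. f x = 0 \<or> (\<forall>\<^sub>F n in sequentially. x \<notin> A n)"
  shows "(\<lambda>n. \<integral>\<^sup>+x. f x * indicator (A n) x \<partial>M) \<longlonglongrightarrow> 0"
proof -
  have "(\<lambda>n. \<integral>\<^sup>+x. f x * indicator (A n) x \<partial>M) \<longlonglongrightarrow> (\<integral>\<^sup>+x. 0 \<partial>M)"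
  proof (rule nn_integral_dominated_convergence[where w=f])
    show "AE x in M. (\<lambda>n. f x * indicator (A n) x) \<longlonglongrightarrow> 0"
      using ev
    proof (rule eventually_mono)
      fix x assume "f x = 0 \<or> (\<forall>\<^sub>F n in sequentially. x \<notin> A n)"
      then have "\<forall>\<^sub>F n in sequentially. f x * indicator (A n) x = 0"
        by (cases "f x = 0") (auto simp: indicator_def)
      then show "(\<lambda>n. f x * indicator (A n) x) \<longlonglongrightarrow> 0" by (rule tendsto_eventually)
    qed
  qed (use fin in \<open>auto simp: indicator_def\<close>)
  then show ?thesis by simp
qed

text \<open>Boundedness makes the complement nonempty; \<open>infdist\<close> to the empty set is 0
  by convention.\<close>

lemma infdist_Compl_pos:
  fixes \<Omega> :: "'a::euclidean_space set"
  assumes "open \<Omega>" "bounded \<Omega>" "x \<in> \<Omega>"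
  shows "infdist x (- \<Omega>) > 0"
proof -
  have "- \<Omega> \<noteq> {}" using assms(2) not_bounded_UNIV by (metis Compl_empty_eq double_complement)
  then show ?thesis
    using assms in_closed_iff_infdist_zero[of "- \<Omega>" x] infdist_nonneg[of x "- \<Omega>"] by (auto simp: less_le)
qed

lemma infdist_Compl_zero: "x \<notin> \<Omega> \<Longrightarrow> infdist x (- \<Omega>) = 0"
  by simp

lemma infdist_lipschitz: "infdist x A \<le> infdist y A + dist x y"
  by (metis add.commute infdist_triangle)

lemma infdist_measurable [measurable (raw)]:
  assumes "f \<in> borel_measurable M"
  shows "(\<lambda>x. infdist (f x :: 'a::euclidean_space) A) \<in> borel_measurable M"
proof (rule measurable_compose[OF assms])
  show "(\<lambda>x. infdist x A) \<in> borel_measurable borel"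
    by (intro borel_measurable_continuous_onI continuous_intros)
qed

definition clip :: "real \<Rightarrow> real \<Rightarrow> real" where
  "clip c a = max (- c) (min a c)"

lemma abs_clip_le: "c \<ge> 0 \<Longrightarrow> \<bar>clip c a\<bar> \<le> c"
  by (auto simp: clip_def)

lemma clip_eq: "\<bar>a\<bar> \<le> c \<Longrightarrow> clip c a = a"
  by (auto simp: clip_def)

text \<open>Clipping is 1-Lipschitz in argument and level jointly for the maximum norm. The level
  matters because it is a multiple of the distance and varies from point to point.\<close>

lemma clip_diff_le: "\<bar>clip c a - clip d e\<bar> \<le> max \<bar>a - e\<bar> \<bar>c - d\<bar>"
  unfolding clip_def by linarith

lemma seg_avg_integral:
  fixes G :: "'a::euclidean_space \<Rightarrow> real"
  assumes [measurable]: "G \<in> borel_measurable borel" and "h > 0"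
  shows "h * seg_avg h b G x = (\<integral>s. G (x + s *\<^sub>R b) * indicator {0..h} s \<partial>lborel)"
  unfolding seg_avg_def using assms(2) by (subst integral_seg) auto

text \<open>Additivity of the line integral needs integrability along the line, which Fubini
  provides only for almost every starting point; elsewhere a Bochner integral may take its default
  value 0.\<close>

lemma seg_avg_add:
  fixes G :: "'a::euclidean_space \<Rightarrow> real"
  assumes G: "integrable lborel G" and h: "h1 > 0" "h2 > 0"
  shows "AE x in lborel. (h1 + h2) * seg_avg (h1 + h2) b G x
    = h1 * seg_avg h1 b G x + h2 * seg_avg h2 b G (x + h1 *\<^sub>R b)"
proof -
  have [measurable]: "G \<in> borel_measurable borel" using G by simp
  let ?g = "\<lambda>x s. G (x + s *\<^sub>R b) * indicator {0..h1 + h2} s"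
  have "(\<integral>\<^sup>+x. (\<integral>\<^sup>+s. ennreal (norm (?g x s)) \<partial>lborel) \<partial>lborel) = (\<integral>\<^sup>+s. (\<integral>\<^sup>+x. ennreal (norm (?g x s)) \<partial>lborel) \<partial>lborel)"
    by (rule lborel_pair.Fubini'[symmetric]) measurable
  also have "\<dots> = (\<integral>\<^sup>+s. Lp_pow 1 G * indicator {0..h1 + h2} s \<partial>lborel)"
  proof (intro nn_integral_cong)
    fix s
    have "(\<integral>\<^sup>+x. ennreal (norm (?g x s)) \<partial>lborel) = Lp_pow 1 (\<lambda>x. G (x + s *\<^sub>R b)) * indicator {0..h1 + h2} s"
      unfolding Lp_pow_1 by (auto simp: indicator_def)
    then show "(\<integral>\<^sup>+x. ennreal (norm (?g x s)) \<partial>lborel) = Lp_pow 1 G * indicator {0..h1 + h2} s"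
      by (simp add: Lp_pow_translate)
  qed
  also have "\<dots> < \<infinity>"
    using G h by (subst nn_integral_cmult_indicator) (auto simp: integrable_iff_Lp_pow_1 ennreal_mult_less_top)
  finally have "AE x in lborel. (\<integral>\<^sup>+s. ennreal (norm (?g x s)) \<partial>lborel) \<noteq> \<infinity>"
    by (intro nn_integral_PInf_AE) auto
  then show ?thesis
  proof (rule eventually_mono)
    fix x assume fin: "(\<integral>\<^sup>+s. ennreal (norm (?g x s)) \<partial>lborel) \<noteq> \<infinity>"
    have i: "integrable lborel (?g x)"
      using fin by (intro integrableI_bounded) (auto simp: less_top)
    have i1: "integrable lborel (\<lambda>s. G (x + s *\<^sub>R b) * indicator {0..h1} s)"
      by (rule Bochner_Integration.integrable_bound[OF i]) (use h in \<open>auto intro!: AE_I2 simp: indicator_def\<close>)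
    have i2: "integrable lborel (\<lambda>s. G (x + s *\<^sub>R b) * indicator {h1..h1 + h2} s)"
      by (rule Bochner_Integration.integrable_bound[OF i]) (use h in \<open>auto intro!: AE_I2 simp: indicator_def\<close>)
    have "(\<integral>s. G (x + h1 *\<^sub>R b + s *\<^sub>R b) * indicator {0..h2} s \<partial>lborel)
       = (\<integral>s. G (x + (s + h1) *\<^sub>R b) * indicator {h1..h1 + h2} (s + h1) \<partial>lborel)"
      by (intro Bochner_Integration.integral_cong refl) (auto simp: indicator_def algebra_simps)
    also have "\<dots> = (\<integral>s. G (x + s *\<^sub>R b) * indicator {h1..h1 + h2} s \<partial>lborel)"
      by (rule lborel_integral_translate[where f="\<lambda>s. G (x + s *\<^sub>R b) * indicator {h1..h1 + h2} s"]) measurable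
    finally have 2: "h2 * seg_avg h2 b G (x + h1 *\<^sub>R b) = (\<integral>s. G (x + s *\<^sub>R b) * indicator {h1..h1 + h2} s \<partial>lborel)"
      using h by (simp add: seg_avg_integral)
    \<comment> \<open>The two closed intervals share the point \<open>h1\<close>, which is
      null.\<close>
    have "AE s in lborel. s \<noteq> h1" by (rule AE_lborel_singleton)
    then have "(\<integral>s. ?g x s \<partial>lborel)
      = (\<integral>s. G (x + s *\<^sub>R b) * indicator {0..h1} s + G (x + s *\<^sub>R b) * indicator {h1..h1 + h2} s \<partial>lborel)"
      using h by (intro integral_cong_AE) (auto simp: indicator_def elim!: eventually_mono)
    then show "(h1 + h2) * seg_avg (h1 + h2) b G x = h1 * seg_avg h1 b G x + h2 * seg_avg h2 b G (x + h1 *\<^sub>R b)"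
      using h i1 i2 by (simp add: 2 seg_avg_integral)
  qed
qed

lemma nn_integral_seg_swap:
  fixes f w :: "'a::euclidean_space \<Rightarrow> ennreal"
  assumes h: "h > 0" and [measurable]: "f \<in> borel_measurable borel" "w \<in> borel_measurable borel"
    and le: "\<And>s. 0 \<le> s \<Longrightarrow> s \<le> h \<Longrightarrow> (\<integral>\<^sup>+x. f (x + s *\<^sub>R b) * w x \<partial>lborel) \<le> c"
  shows "(\<integral>\<^sup>+x. (\<integral>\<^sup>+s. f (x + s *\<^sub>R b) \<partial>seg_measure h) * w x \<partial>lborel) \<le> c"
proof -
  interpret seg_measure: finite_measure "seg_measure h" by (rule finite_measure_seg[OF h])
  interpret pair_sigma_finite "lborel :: 'a measure" "seg_measure h" ..
  have "(\<integral>\<^sup>+x. (\<integral>\<^sup>+s. f (x + s *\<^sub>R b) \<partial>seg_measure h) * w x \<partial>lborel) = (\<integral>\<^sup>+x. (\<integral>\<^sup>+s. f (x + s *\<^sub>R b) * w x \<partial>seg_measure h) \<partial>lborel)"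
    by (intro nn_integral_cong nn_integral_multc[symmetric]) measurable
  also have "\<dots> = (\<integral>\<^sup>+s. (\<integral>\<^sup>+x. f (x + s *\<^sub>R b) * w x \<partial>lborel) \<partial>seg_measure h)"
    by (rule Fubini'[symmetric]) measurable
  also have "\<dots> \<le> (\<integral>\<^sup>+s. c \<partial>seg_measure h)"
    by (intro nn_integral_mono_AE eventually_mono[OF AE_seg[OF h]]) (use le in auto)
  also have "\<dots> = c" by (simp add: emeasure_seg[OF h])
  finally show ?thesis .
qed

definition trunc :: "'a::euclidean_space set \<Rightarrow> ('a \<Rightarrow> real) \<Rightarrow> real \<Rightarrow> 'a \<Rightarrow> real" where
  "trunc \<Omega> U k x = clip (k * infdist x (- \<Omega>)) (U x)"

text \<open>The superlevel set of \<open>\<bar>U\<bar> / d\<close> in \<open>\<Omega>\<close>,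
  written without division. On the rest of \<open>\<Omega>\<close> truncation at level
  \<open>k\<close> changes nothing.\<close>

definition steep :: "'a::euclidean_space set \<Rightarrow> ('a \<Rightarrow> real) \<Rightarrow> real \<Rightarrow> 'a set" where
  "steep \<Omega> U k = {x \<in> \<Omega>. \<bar>U x\<bar> > k * infdist x (- \<Omega>)}"

definition collar :: "'a::euclidean_space set \<Rightarrow> real \<Rightarrow> 'a set" where
  "collar \<Omega> r = {x \<in> \<Omega>. infdist x (- \<Omega>) \<le> r}"

lemma trunc_measurable: "U \<in> borel_measurable borel \<Longrightarrow> trunc \<Omega> U k \<in> borel_measurable borel"
  unfolding trunc_def[abs_def] clip_def
  by (intro borel_measurable_max borel_measurable_min borel_measurable_uminus borel_measurable_times infdist_measurable) auto

lemma steep_sets: "open \<Omega> \<Longrightarrow> U \<in> borel_measurable borel \<Longrightarrow> steep \<Omega> U k \<in> sets borel"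
  using borel_open[of \<Omega>] unfolding steep_def by measurable

lemma collar_sets: "open \<Omega> \<Longrightarrow> collar \<Omega> r \<in> sets borel"
  using borel_open[of \<Omega>] unfolding collar_def by measurable

lemma collar_eventually_empty:
  assumes "open \<Omega>" "bounded \<Omega>" "(r \<longlongrightarrow> 0) F"
  shows "\<forall>\<^sub>F n in F. x \<notin> collar \<Omega> (r n)"
proof (cases "x \<in> \<Omega>")
  case True
  have "\<forall>\<^sub>F n in F. r n < infdist x (- \<Omega>)"
    using assms(3) infdist_Compl_pos[OF assms(1,2) True] by (rule order_tendstoD(2))
  then show ?thesis by eventually_elim (auto simp: collar_def)
qed (simp add: collar_def)

lemma trunc_eventually:
  fixes \<Omega> :: "'a::euclidean_space set"
  assumes "open \<Omega>" "bounded \<Omega>" "U x = 0 \<or> x \<in> \<Omega>"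
  shows "\<forall>\<^sub>F k in sequentially. \<bar>U x\<bar> \<le> real k * infdist x (- \<Omega>)"
proof (cases "x \<in> \<Omega>")
  case True
  then have pos: "infdist x (- \<Omega>) > 0" using infdist_Compl_pos[OF assms(1,2) True] by simp
  obtain n where "\<bar>U x\<bar> / infdist x (- \<Omega>) \<le> real n" using real_arch_simple by blast
  then have n: "\<bar>U x\<bar> \<le> real n * infdist x (- \<Omega>)" using pos by (simp add: field_simps)
  have "real n * infdist x (- \<Omega>) \<le> real k * infdist x (- \<Omega>)" if "k \<ge> n" for k
    using that pos by (intro mult_right_mono) auto
  with n have "\<forall>k\<ge>n. \<bar>U x\<bar> \<le> real k * infdist x (- \<Omega>)" by fastforce
  then show ?thesis unfolding eventually_sequentially by blast
qed (use assms in simp)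

text \<open>Three cases locate the error. If the segment stays in \<open>\<Omega>\<close> and
  neither end is steep, truncation is inactive and the local formula gives error 0. If an end is
  steep, the Lipschitz bound for clipping gives at most \<open>2 * \<bar>H\<bar> + h * k\<close>. If
  the segment leaves \<open>\<Omega>\<close>, it lies within \<open>h\<close> of the complement, so
  the truncated values are at most \<open>h * k\<close> and only \<open>G\<close> on the collar
  contributes. The modulus \<open>\<omega>\<close> compares \<open>G\<close> along a segment with
  \<open>G\<close> at its steep end; the factor 4 is 2 for each of the two ends.\<close>

lemma trunc_step:
  fixes U G :: "'a::euclidean_space \<Rightarrow> real"
  assumes \<Omega>: "open \<Omega>" "bounded \<Omega>" and b: "b \<in> Basis" and h: "h > 0" and k: "k \<ge> 0"
    and w: "weak_partial_borel \<Omega> b U G"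
    and zero: "\<And>x. x \<notin> \<Omega> \<Longrightarrow> U x = 0" "\<And>x. x \<notin> \<Omega> \<Longrightarrow> G x = 0"
    and \<omega>: "\<And>s. \<bar>s\<bar> \<le> h \<Longrightarrow> Lp_pow 1 (\<lambda>x. G (x + s *\<^sub>R b) - G x) \<le> \<omega>"
  shows "Lp_pow 1 (\<lambda>x. trunc \<Omega> U k (x + h *\<^sub>R b) - trunc \<Omega> U k x - h * seg_avg h b G x)
    \<le> ennreal h * (4 * ((\<integral>\<^sup>+x. ennreal \<bar>G x\<bar> * indicator (steep \<Omega> U k) x \<partial>lborel) + \<omega>)
        + 2 * (ennreal k * emeasure lborel (steep \<Omega> U k))
        + (\<integral>\<^sup>+x. ennreal \<bar>G x\<bar> * indicator (collar \<Omega> h) x \<partial>lborel)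
        + 2 * (ennreal k * emeasure lborel (collar \<Omega> h)))"
proof -
  let ?v = "trunc \<Omega> U k" and ?d = "\<lambda>x. infdist x (- \<Omega>)"
  let ?B = "steep \<Omega> U k" and ?N = "collar \<Omega> h"
  have [measurable]: "U \<in> borel_measurable borel" "G \<in> borel_measurable borel"
    using w by (auto simp: weak_partial_borel_def locally_integrable_borel_def)
  have [measurable]: "?B \<in> sets borel" "?N \<in> sets borel"
    by (auto intro: steep_sets collar_sets \<Omega>)
  note [measurable] = trunc_measurable
  interpret seg_measure: finite_measure "seg_measure h" by (rule finite_measure_seg[OF h])
  define A where "A x = (\<integral>\<^sup>+s. ennreal \<bar>G (x + s *\<^sub>R b)\<bar> \<partial>seg_measure h)" for x
  define D where "D x = (\<integral>\<^sup>+s. ennreal \<bar>G (x + s *\<^sub>R b)\<bar> * indicator ?N (x + s *\<^sub>R b) \<partial>seg_measure h)" for x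
  have [measurable]: "A \<in> borel_measurable borel" "D \<in> borel_measurable borel"
    unfolding A_def[abs_def] D_def[abs_def] by measurable
  have nb: "norm b = 1" using b by simp
  have avg_le: "ennreal \<bar>h * seg_avg h b G x\<bar> \<le> ennreal h * A x" for x
  proof -
    have "ennreal \<bar>seg_avg h b G x\<bar> \<le> A x"
      using Jensen_powr[OF emeasure_seg[OF h], of "\<lambda>s. G (x + s *\<^sub>R b)" 1] by (simp add: A_def seg_avg_def)
    then show ?thesis using h by (simp add: abs_mult ennreal_mult mult_left_mono)
  qed
  have v_le: "\<bar>?v x\<bar> \<le> k * ?d x" for x
    unfolding trunc_def using k infdist_nonneg[of x "- \<Omega>"] by (intro abs_clip_le) auto
  have "AE x in lborel. ennreal \<bar>?v (x + h *\<^sub>R b) - ?v x - h * seg_avg h b G x\<bar> \<le>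
    ennreal h * ((2 * A x + ennreal k) * (indicator ?B x + indicator ?B (x + h *\<^sub>R b))
      + D x + ennreal k * (indicator ?N x + indicator ?N (x + h *\<^sub>R b)))"
    using translation_formula_local[OF \<Omega>(1) b h w]
  proof (rule eventually_mono)
    fix x
    assume tf: "(\<forall>s\<in>{0..h}. x + s *\<^sub>R b \<in> \<Omega>) \<longrightarrow> U (x + h *\<^sub>R b) - U x = h * seg_avg h b G x"
    define H where "H = h * seg_avg h b G x"
    define y where "y = x + h *\<^sub>R b"
    have HA: "ennreal \<bar>H\<bar> \<le> ennreal h * A x" unfolding H_def by (rule avg_le)
    show "ennreal \<bar>?v (x + h *\<^sub>R b) - ?v x - h * seg_avg h b G x\<bar> \<le>
      ennreal h * ((2 * A x + ennreal k) * (indicator ?B x + indicator ?B (x + h *\<^sub>R b))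
        + D x + ennreal k * (indicator ?N x + indicator ?N (x + h *\<^sub>R b)))"
      unfolding H_def[symmetric] y_def[symmetric]
    proof (cases "\<forall>s\<in>{0..h}. x + s *\<^sub>R b \<in> \<Omega>")
      case True
      with tf have Ueq: "U y - U x = H" by (simp add: H_def y_def)
      have "x + h *\<^sub>R b \<in> \<Omega>" "x + 0 *\<^sub>R b \<in> \<Omega>" using True h by (auto simp del: scaleR_zero_left)
      then have xy: "x \<in> \<Omega>" "y \<in> \<Omega>" by (auto simp: y_def)
      show "ennreal \<bar>?v y - ?v x - H\<bar> \<le> ennreal h * ((2 * A x + ennreal k) * (indicator ?B x + indicator ?B y)
        + D x + ennreal k * (indicator ?N x + indicator ?N y))"
      proof (cases "x \<in> ?B \<or> y \<in> ?B")
        case False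
        then have "?v x = U x" "?v y = U y"
          using xy by (auto simp: steep_def trunc_def not_less intro!: clip_eq)
        with Ueq show ?thesis by simp
      next
        case True
        have "\<bar>?v y - ?v x\<bar> \<le> max \<bar>U y - U x\<bar> \<bar>k * ?d y - k * ?d x\<bar>"
          unfolding trunc_def by (rule clip_diff_le)
        moreover have "\<bar>k * ?d y - k * ?d x\<bar> \<le> h * k"
        proof -
          have "\<bar>?d y - ?d x\<bar> \<le> h"
            using infdist_lipschitz[of y "- \<Omega>" x] infdist_lipschitz[of x "- \<Omega>" y] h nb by (simp add: dist_norm y_def)
          then show ?thesis using k mult_left_mono[of "\<bar>?d y - ?d x\<bar>" h k]
            by (simp add: right_diff_distrib[symmetric] abs_mult mult.commute)
        qed
        ultimately have "\<bar>?v y - ?v x - H\<bar> \<le> 2 * \<bar>H\<bar> + h * k"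
          using k h Ueq by (auto simp: max_def split: if_splits)
        then have "ennreal \<bar>?v y - ?v x - H\<bar> \<le> ennreal (2 * \<bar>H\<bar> + h * k)" by (rule ennreal_leI)
        also have "\<dots> = 2 * ennreal \<bar>H\<bar> + ennreal h * ennreal k"
          using k h by (simp add: ennreal_mult[symmetric] ennreal_plus[symmetric] numeral_mult_ennreal del: ennreal_plus)
        also have "\<dots> \<le> 2 * (ennreal h * A x) + ennreal h * ennreal k"
          by (intro add_right_mono mult_left_mono HA) auto
        also have "\<dots> = ennreal h * ((2 * A x + ennreal k) * 1)" by (simp add: algebra_simps)
        also have "\<dots> \<le> ennreal h * ((2 * A x + ennreal k) * (indicator ?B x + indicator ?B y))"
          using True by (intro mult_left_mono) (auto simp: indicator_def)
        also have "\<dots> \<le> ennreal h * ((2 * A x + ennreal k) * (indicator ?B x + indicator ?B y)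
          + D x + ennreal k * (indicator ?N x + indicator ?N y))"
          by (intro mult_left_mono) (auto simp: add.assoc)
        finally show ?thesis .
      qed
    next
      case False
      then obtain s where s: "0 \<le> s" "s \<le> h" "x + s *\<^sub>R b \<notin> \<Omega>" by auto
      have dt: "?d (x + t *\<^sub>R b) \<le> h" if "0 \<le> t" "t \<le> h" for t
      proof -
        have "?d (x + t *\<^sub>R b) \<le> ?d (x + s *\<^sub>R b) + dist (x + t *\<^sub>R b) (x + s *\<^sub>R b)"
          by (rule infdist_lipschitz)
        also have "\<dots> = \<bar>t - s\<bar>"
          using s(3) nb by (simp add: dist_norm scaleR_diff_left[symmetric])
        finally show ?thesis using that s by linarith
      qed
      have "\<bar>?v z\<bar> \<le> h * k * indicator ?N z" if "z \<in> {x, y}" for z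
      proof (cases "z \<in> \<Omega>")
        case True
        have "?d z \<le> h" using dt[of 0] dt[of h] h that by (auto simp: y_def)
        moreover from this have "k * ?d z \<le> h * k" using k mult_left_mono[of "?d z" h k] by (simp add: mult.commute)
        ultimately show ?thesis using True v_le[of z] by (simp add: collar_def)
      next
        case False
        then show ?thesis using v_le[of z] k h by simp
      qed
      from this[of x] this[of y]
      have "\<bar>?v y - ?v x - H\<bar> \<le> \<bar>H\<bar> + h * k * (indicator ?N x + indicator ?N y)"
        by (simp add: algebra_simps)
      then have "ennreal \<bar>?v y - ?v x - H\<bar> \<le> ennreal (\<bar>H\<bar> + h * (k * (indicator ?N x + indicator ?N y)))"
        by (intro ennreal_leI) (simp add: mult.assoc)
      also have "\<dots> = ennreal \<bar>H\<bar> + ennreal h * (ennreal k * (indicator ?N x + indicator ?N y))"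
        using h k by (auto simp: ennreal_mult indicator_def numeral_mult_ennreal)
      also have "ennreal \<bar>H\<bar> \<le> ennreal h * D x"
      proof -
        have "A x \<le> D x" unfolding A_def D_def
        proof (intro nn_integral_mono_AE eventually_mono[OF AE_seg[OF h]])
          fix t assume "0 \<le> t \<and> t \<le> h"
          then show "ennreal \<bar>G (x + t *\<^sub>R b)\<bar> \<le> ennreal \<bar>G (x + t *\<^sub>R b)\<bar> * indicator ?N (x + t *\<^sub>R b)"
            using dt[of t] zero(2)[of "x + t *\<^sub>R b"] by (cases "x + t *\<^sub>R b \<in> \<Omega>") (auto simp: collar_def)
        qed
        with HA show ?thesis by (meson mult_left_mono order_trans zero_le)
      qed
      also have "ennreal h * D x + ennreal h * (ennreal k * (indicator ?N x + indicator ?N y))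
        = ennreal h * (D x + ennreal k * (indicator ?N x + indicator ?N y))"
        by (simp add: distrib_left)
      also have "\<dots> \<le> ennreal h * ((2 * A x + ennreal k) * (indicator ?B x + indicator ?B y)
          + D x + ennreal k * (indicator ?N x + indicator ?N y))"
        by (intro mult_left_mono) (auto simp: add.assoc)
      finally show "ennreal \<bar>?v y - ?v x - H\<bar> \<le> ennreal h * ((2 * A x + ennreal k) * (indicator ?B x + indicator ?B y)
        + D x + ennreal k * (indicator ?N x + indicator ?N y))" by (simp add: add_mono)
    qed
  qed
  then have "Lp_pow 1 (\<lambda>x. ?v (x + h *\<^sub>R b) - ?v x - h * seg_avg h b G x) \<le>
    (\<integral>\<^sup>+x. ennreal h * ((2 * A x + ennreal k) * (indicator ?B x + indicator ?B (x + h *\<^sub>R b))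
      + D x + ennreal k * (indicator ?N x + indicator ?N (x + h *\<^sub>R b))) \<partial>lborel)"
    unfolding Lp_pow_1 by (rule nn_integral_mono_AE)
  also have "\<dots> = ennreal h * (2 * ((\<integral>\<^sup>+x. A x * indicator ?B x \<partial>lborel) + (\<integral>\<^sup>+x. A x * indicator ?B (x + h *\<^sub>R b) \<partial>lborel))
      + ennreal k * ((\<integral>\<^sup>+x. indicator ?B x \<partial>lborel) + (\<integral>\<^sup>+x. indicator ?B (x + h *\<^sub>R b) \<partial>lborel))
      + (\<integral>\<^sup>+x. D x \<partial>lborel) + ennreal k * ((\<integral>\<^sup>+x. indicator ?N x \<partial>lborel) + (\<integral>\<^sup>+x. indicator ?N (x + h *\<^sub>R b) \<partial>lborel)))"
    by (simp add: nn_integral_cmult nn_integral_add distrib_left distrib_right mult.assoc add_ac)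
  also have "\<dots> \<le> ennreal h * (2 * ((I + \<omega>) + (I + \<omega>))
      + ennreal k * (emeasure lborel ?B + emeasure lborel ?B)
      + J + ennreal k * (emeasure lborel ?N + emeasure lborel ?N))"
    if I: "I = (\<integral>\<^sup>+x. ennreal \<bar>G x\<bar> * indicator ?B x \<partial>lborel)"
      and J: "J = (\<integral>\<^sup>+x. ennreal \<bar>G x\<bar> * indicator ?N x \<partial>lborel)" for I J
  proof (intro mult_left_mono add_mono)
    have le: "(\<integral>\<^sup>+x. ennreal \<bar>G (x + s *\<^sub>R b)\<bar> * indicator ?B x \<partial>lborel) \<le> I + \<omega>" if "\<bar>s\<bar> \<le> h" for s
    proof -
      have "(\<integral>\<^sup>+x. ennreal \<bar>G (x + s *\<^sub>R b)\<bar> * indicator ?B x \<partial>lborel)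
         \<le> (\<integral>\<^sup>+x. ennreal \<bar>G x\<bar> * indicator ?B x + ennreal \<bar>G (x + s *\<^sub>R b) - G x\<bar> \<partial>lborel)"
        by (intro nn_integral_mono) (auto simp: indicator_def ennreal_plus[symmetric] simp del: ennreal_plus intro!: ennreal_leI)
      also have "\<dots> = I + Lp_pow 1 (\<lambda>x. G (x + s *\<^sub>R b) - G x)"
        by (subst nn_integral_add) (auto simp: I Lp_pow_1)
      also have "\<dots> \<le> I + \<omega>" by (intro add_left_mono \<omega> that)
      finally show ?thesis .
    qed
    show "(\<integral>\<^sup>+x. A x * indicator ?B x \<partial>lborel) \<le> I + \<omega>"
      unfolding A_def by (rule nn_integral_seg_swap[OF h, where f="\<lambda>x. ennreal \<bar>G x\<bar>"]) (use le in auto)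
    \<comment> \<open>Here the steep point is the far end of the segment. Seen from there the shifts
      are \<open>s - h\<close>, so the bound by \<open>\<omega>\<close> is needed for negative
      shifts too.\<close>
    show "(\<integral>\<^sup>+x. A x * indicator ?B (x + h *\<^sub>R b) \<partial>lborel) \<le> I + \<omega>"
      unfolding A_def
    proof (rule nn_integral_seg_swap[OF h, where f="\<lambda>x. ennreal \<bar>G x\<bar>"])
      fix s assume s: "0 \<le> s" "s \<le> h"
      have "(\<integral>\<^sup>+x. ennreal \<bar>G (x + s *\<^sub>R b)\<bar> * indicator ?B (x + h *\<^sub>R b) \<partial>lborel)
        = (\<integral>\<^sup>+x. ennreal \<bar>G ((x + h *\<^sub>R b) + (s - h) *\<^sub>R b)\<bar> * indicator ?B (x + h *\<^sub>R b) \<partial>lborel)"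
        by (simp add: algebra_simps)
      also have "\<dots> = (\<integral>\<^sup>+x. ennreal \<bar>G (x + (s - h) *\<^sub>R b)\<bar> * indicator ?B x \<partial>lborel)"
        by (rule nn_integral_translate[where f="\<lambda>x. ennreal \<bar>G (x + (s - h) *\<^sub>R b)\<bar> * indicator ?B x"]) measurable
      also have "\<dots> \<le> I + \<omega>" using s by (intro le) auto
      finally show "(\<integral>\<^sup>+x. ennreal \<bar>G (x + s *\<^sub>R b)\<bar> * indicator ?B (x + h *\<^sub>R b) \<partial>lborel) \<le> I + \<omega>" .
    qed measurable
    show "(\<integral>\<^sup>+x. indicator ?B (x + h *\<^sub>R b) \<partial>lborel) \<le> emeasure lborel ?B"
      by (subst nn_integral_translate) auto
    show "(\<integral>\<^sup>+x. indicator ?N (x + h *\<^sub>R b) \<partial>lborel) \<le> emeasure lborel ?N"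
      by (subst nn_integral_translate) auto
    have "(\<integral>\<^sup>+x. D x * 1 \<partial>lborel) \<le> J"
      unfolding D_def
    proof (rule nn_integral_seg_swap[OF h, where f="\<lambda>x. ennreal \<bar>G x\<bar> * indicator ?N x" and w="\<lambda>x. 1"])
      fix s
      show "(\<integral>\<^sup>+x. ennreal \<bar>G (x + s *\<^sub>R b)\<bar> * indicator ?N (x + s *\<^sub>R b) * 1 \<partial>lborel) \<le> J"
        using nn_integral_translate[of "\<lambda>x. ennreal \<bar>G x\<bar> * indicator ?N x" "s *\<^sub>R b"] by (simp add: J)
    qed measurable
    then show "(\<integral>\<^sup>+x. D x \<partial>lborel) \<le> J" by simp
  qed auto
  finally have *: "Lp_pow 1 (\<lambda>x. ?v (x + h *\<^sub>R b) - ?v x - h * seg_avg h b G x) \<le> ennreal h * (2 * ((I + \<omega>) + (I + \<omega>))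
      + ennreal k * (emeasure lborel ?B + emeasure lborel ?B)
      + J + ennreal k * (emeasure lborel ?N + emeasure lborel ?N))"
    if "I = (\<integral>\<^sup>+x. ennreal \<bar>G x\<bar> * indicator ?B x \<partial>lborel)"
      and "J = (\<integral>\<^sup>+x. ennreal \<bar>G x\<bar> * indicator ?N x \<partial>lborel)" for I J
    using that by simp
  have 1: "2 * (2 * a) = 4 * a" for a :: ennreal
    by (simp add: mult.assoc[symmetric])
  have 2: "c * (a + a) = 2 * (c * a)" for c a :: ennreal
    by (simp add: mult_2 distrib_left)
  show ?thesis using *[OF refl refl] unfolding 2 1 .
qed

text \<open>
  A step of length \<open>h\<close> carries an error from the collar of width \<open>h\<close>, where segments may leave \<open>\<Omega>\<close>. Splitting
  a step into many short ones makes this error disappear.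
\<close>

lemma trunc_iterate:
  fixes v G :: "'a::euclidean_space \<Rightarrow> real" and b :: 'a
  assumes [measurable]: "v \<in> borel_measurable borel" and G: "integrable lborel G" and h: "h > 0"
  defines "E \<equiv> \<lambda>h. Lp_pow 1 (\<lambda>x. v (x + h *\<^sub>R b) - v x - h * seg_avg h b G x)"
  shows "E (real (Suc n) * h) \<le> of_nat (Suc n) * E h"
proof (induction n)
  case (Suc n)
  let ?m = "real (Suc n) * h"
  have m: "?m > 0" using h by simp
  have [measurable]: "G \<in> borel_measurable borel" using G by simp
  note [measurable] = seg_avg_measurable[OF h, of G b] seg_avg_measurable[OF m, of G b]
  let ?e = "\<lambda>h x. v (x + h *\<^sub>R b) - v x - h * seg_avg h b G x"
  have "E (?m + h) \<le> (\<integral>\<^sup>+x. ennreal \<bar>?e ?m x\<bar> + ennreal \<bar>?e h (x + ?m *\<^sub>R b)\<bar> \<partial>lborel)"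
    unfolding E_def Lp_pow_1
  proof (rule nn_integral_mono_AE, rule eventually_mono[OF seg_avg_add[OF G m h, of b]])
    fix x assume *: "(?m + h) * seg_avg (?m + h) b G x = ?m * seg_avg ?m b G x + h * seg_avg h b G (x + ?m *\<^sub>R b)"
    \<comment> \<open>Errors of consecutive steps add up; the second is taken at a translated point,
      which does not change its L^1 size.\<close>
    have "?e (?m + h) x = ?e ?m x + ?e h (x + ?m *\<^sub>R b)"
      unfolding * by (simp add: scaleR_add_left add.assoc)
    then have "\<bar>?e (?m + h) x\<bar> \<le> \<bar>?e ?m x\<bar> + \<bar>?e h (x + ?m *\<^sub>R b)\<bar>" by simp
    then show "ennreal \<bar>?e (?m + h) x\<bar> \<le> ennreal \<bar>?e ?m x\<bar> + ennreal \<bar>?e h (x + ?m *\<^sub>R b)\<bar>"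
      by (simp only: ennreal_plus[symmetric] abs_ge_zero ennreal_leI)
  qed
  also have "\<dots> = E ?m + E h"
  proof -
    have 1: "?e h \<in> borel_measurable borel" "?e ?m \<in> borel_measurable borel"
      using seg_avg_measurable[OF h, of G b] seg_avg_measurable[OF m, of G b] by measurable
    have "(\<integral>\<^sup>+x. ennreal \<bar>?e h (x + ?m *\<^sub>R b)\<bar> \<partial>lborel) = E h"
      unfolding E_def Lp_pow_1 by (intro nn_integral_translate[where f="\<lambda>x. ennreal \<bar>?e h x\<bar>"]) measurable
    then show ?thesis
      unfolding E_def Lp_pow_1 using 1(2) measurable_compose[where f="\<lambda>x. x + ?m *\<^sub>R b" and g="?e h", OF _ 1(1)]
      by (subst nn_integral_add) auto
  qed
  also have "\<dots> \<le> of_nat (Suc n) * E h + E h" by (intro add_right_mono Suc)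
  finally show ?case by (simp add: distrib_right add.commute add.left_commute)
qed simp

lemma trunc_bound:
  fixes U G :: "'a::euclidean_space \<Rightarrow> real"
  assumes \<Omega>: "open \<Omega>" "bounded \<Omega>" and b: "b \<in> Basis" and h: "h > 0" and k: "k \<ge> 0"
    and w: "weak_partial_borel \<Omega> b U G" and G: "integrable lborel G"
    and zero: "\<And>x. x \<notin> \<Omega> \<Longrightarrow> U x = 0" "\<And>x. x \<notin> \<Omega> \<Longrightarrow> G x = 0"
  shows "Lp_pow 1 (\<lambda>x. trunc \<Omega> U k (x + h *\<^sub>R b) - trunc \<Omega> U k x - h * seg_avg h b G x)
    \<le> ennreal h * (4 * (\<integral>\<^sup>+x. ennreal \<bar>G x\<bar> * indicator (steep \<Omega> U k) x \<partial>lborel)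
        + 2 * (ennreal k * emeasure lborel (steep \<Omega> U k)))" (is "?E h \<le> ennreal h * ?C")
proof -
  have [measurable]: "U \<in> borel_measurable borel" "G \<in> borel_measurable borel"
    using w by (auto simp: weak_partial_borel_def locally_integrable_borel_def)
  have \<Omega>b [measurable]: "\<Omega> \<in> sets borel" using \<Omega> by simp
  define r where "r n = h / real (Suc n)" for n
  have r0: "r \<longlonglongrightarrow> 0" unfolding r_def[abs_def] by (rule LIMSEQ_Suc[OF lim_const_over_n])
  have r: "r n > 0" for n using h by (simp add: r_def)
  have coll [measurable]: "collar \<Omega> (r n) \<in> sets borel" for n using \<Omega>(1) by (rule collar_sets)
  let ?J = "\<lambda>n. \<integral>\<^sup>+x. ennreal \<bar>G x\<bar> * indicator (collar \<Omega> (r n)) x \<partial>lborel"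
  let ?N = "\<lambda>n. ennreal k * emeasure lborel (collar \<Omega> (r n))"
  have J: "?J \<longlonglongrightarrow> 0"
    using collar_eventually_empty[OF \<Omega> r0] G
    by (intro nn_integral_vanishing) (auto simp: integrable_iff_Lp_pow_1 Lp_pow_1)
  have "(\<lambda>n. \<integral>\<^sup>+x. (ennreal k * indicator \<Omega> x) * indicator (collar \<Omega> (r n)) x \<partial>lborel) \<longlonglongrightarrow> 0"
    using collar_eventually_empty[OF \<Omega> r0] emeasure_bounded_finite[OF \<Omega>(2)]
    by (intro nn_integral_vanishing) (auto simp: nn_integral_cmult_indicator ennreal_mult_less_top)
  moreover have "(\<integral>\<^sup>+x. (ennreal k * indicator \<Omega> x) * indicator (collar \<Omega> (r n)) x \<partial>lborel) = ?N n" for n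
  proof -
    have "(\<integral>\<^sup>+x. (ennreal k * indicator \<Omega> x) * indicator (collar \<Omega> (r n)) x \<partial>lborel)
      = (\<integral>\<^sup>+x. ennreal k * indicator (collar \<Omega> (r n)) x \<partial>lborel)"
      by (intro nn_integral_cong) (auto simp: indicator_def collar_def)
    then show ?thesis by (simp add: nn_integral_cmult_indicator)
  qed
  ultimately have N: "?N \<longlonglongrightarrow> 0" by simp
  have "?E h \<le> ennreal h * ?C + ennreal e" if e: "e > 0" for e
  proof -
    \<comment> \<open>The vanishing terms of one short step, \<open>4 * \<omega>\<close>, the
      gradient on the collar and twice the collar volume term, add up to \<open>7 * e'\<close>, and
      the short steps have total length \<open>h\<close>.\<close>
    define e' where "e' = e / (7 * h)"
    have e': "e' > 0" using e h by (simp add: e'_def)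
    obtain \<delta> where \<delta>: "\<delta> > 0" "\<And>y. norm y < \<delta> \<Longrightarrow> Lp_pow 1 (\<lambda>x. G (x + y) - G x) \<le> ennreal e'"
      using L1_translation_continuous[OF G e'] by metis
    have "\<forall>\<^sub>F n in sequentially. r n < \<delta> \<and> ?J n < ennreal e' \<and> ?N n < ennreal e'"
      using e' \<delta>(1) by (intro eventually_conj order_tendstoD(2)[OF r0] order_tendstoD(2)[OF J] order_tendstoD(2)[OF N]) auto
    then obtain n where n: "r n < \<delta>" "?J n < ennreal e'" "?N n < ennreal e'"
      by (auto simp: eventually_sequentially)
    have "?E (r n) \<le> ennreal (r n) * (4 * ((\<integral>\<^sup>+x. ennreal \<bar>G x\<bar> * indicator (steep \<Omega> U k) x \<partial>lborel) + ennreal e')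
        + 2 * (ennreal k * emeasure lborel (steep \<Omega> U k)) + ?J n + 2 * ?N n)"
    proof (rule trunc_step[OF \<Omega> b r k w zero])
      fix s assume "\<bar>s\<bar> \<le> r n"
      then show "Lp_pow 1 (\<lambda>x. G (x + s *\<^sub>R b) - G x) \<le> ennreal e'"
        using n(1) b by (intro \<delta>(2)) simp
    qed
    also have "\<dots> \<le> ennreal (r n) * (4 * ((\<integral>\<^sup>+x. ennreal \<bar>G x\<bar> * indicator (steep \<Omega> U k) x \<partial>lborel) + ennreal e')
        + 2 * (ennreal k * emeasure lborel (steep \<Omega> U k)) + ennreal e' + 2 * ennreal e')"
      using n by (intro mult_left_mono add_mono order_refl) auto
    also have "\<dots> = ennreal (r n) * (?C + 7 * ennreal e')"
    proof -
      have "7 * ennreal e' = (4 + 1 + 2) * ennreal e'" by simp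
      also have "\<dots> = 4 * ennreal e' + ennreal e' + 2 * ennreal e'" by (simp only: distrib_right mult_1)
      finally show ?thesis by (simp only: distrib_left add_ac)
    qed
    finally have 1: "?E (r n) \<le> ennreal (r n) * (?C + 7 * ennreal e')" .
    have "real (Suc n) * r n = h" by (simp add: r_def)
    then have "?E h \<le> of_nat (Suc n) * ?E (r n)"
      using trunc_iterate[OF trunc_measurable[of U \<Omega> k] G r[of n], where n=n and b=b] by simp
    also have "\<dots> \<le> of_nat (Suc n) * (ennreal (r n) * (?C + 7 * ennreal e'))"
      by (intro mult_left_mono 1) auto
    also have "\<dots> = ennreal h * (?C + 7 * ennreal e')"
    proof -
      have "of_nat (Suc n) * ennreal (r n) = ennreal (real (Suc n) * r n)"
        using r[of n] by (subst ennreal_mult) (auto simp: ennreal_of_nat_eq_real_of_nat)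
      then show ?thesis using \<open>real (Suc n) * r n = h\<close> by (simp add: mult.assoc[symmetric])
    qed
    also have "\<dots> = ennreal h * ?C + ennreal e"
    proof -
      have "ennreal h * (7 * ennreal e') = ennreal e"
        using h e' by (simp add: numeral_mult_ennreal ennreal_mult[symmetric] e'_def)
      then show ?thesis by (simp add: distrib_left[of "ennreal h" ?C])
    qed
    finally show ?thesis .
  qed
  then show ?thesis by (rule ennreal_le_epsilon)
qed

text \<open>Both terms of \<open>trunc_bound\<close> tend to 0 as the level grows: the steep sets
  eventually leave every point, so the integral of \<open>G\<close> over them vanishes, and the
  other term vanishes by hypothesis. At each point the truncation is eventually \<open>U\<close>
  itself, so Fatou's lemma gives defect 0.\<close>

lemma translation_formula:
  fixes U G :: "'a::euclidean_space \<Rightarrow> real"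
  assumes \<Omega>: "open \<Omega>" "bounded \<Omega>" and b: "b \<in> Basis" and h: "h > 0"
    and w: "weak_partial_borel \<Omega> b U G" and G: "integrable lborel G"
    and zero: "\<And>x. x \<notin> \<Omega> \<Longrightarrow> U x = 0" "\<And>x. x \<notin> \<Omega> \<Longrightarrow> G x = 0"
    and weak: "(\<lambda>k. of_nat k * emeasure lborel (steep \<Omega> U (real k))) \<longlonglongrightarrow> 0"
  shows "AE x in lborel. U (x + h *\<^sub>R b) - U x = h * seg_avg h b G x"
proof -
  have [measurable]: "U \<in> borel_measurable borel" "G \<in> borel_measurable borel"
    using w by (auto simp: weak_partial_borel_def locally_integrable_borel_def)
  have st [measurable]: "steep \<Omega> U k \<in> sets borel" for k using \<Omega>(1) by (intro steep_sets) auto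
  note [measurable] = seg_avg_measurable[OF h] trunc_measurable
  let ?e = "\<lambda>k x. trunc \<Omega> U (real k) (x + h *\<^sub>R b) - trunc \<Omega> U (real k) x - h * seg_avg h b G x"
  let ?f = "\<lambda>x. U (x + h *\<^sub>R b) - U x - h * seg_avg h b G x"
  let ?C = "\<lambda>k. 4 * (\<integral>\<^sup>+x. ennreal \<bar>G x\<bar> * indicator (steep \<Omega> U (real k)) x \<partial>lborel)
        + 2 * (of_nat k * emeasure lborel (steep \<Omega> U (real k)))"
  have I: "(\<lambda>k. \<integral>\<^sup>+x. ennreal \<bar>G x\<bar> * indicator (steep \<Omega> U (real k)) x \<partial>lborel) \<longlonglongrightarrow> 0"
  proof (rule nn_integral_vanishing)
    have "\<forall>\<^sub>F k in sequentially. x \<notin> steep \<Omega> U (real k)" for x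
    proof (cases "x \<in> \<Omega>")
      case True
      then show ?thesis using trunc_eventually[OF \<Omega>, of U x] by (auto simp: steep_def elim: eventually_mono)
    qed (simp add: steep_def)
    then show "AE x in lborel. ennreal \<bar>G x\<bar> = 0 \<or> (\<forall>\<^sub>F k in sequentially. x \<notin> steep \<Omega> U (real k))" by simp
  qed (use G in \<open>auto simp: integrable_iff_Lp_pow_1 Lp_pow_1\<close>)
  have "(\<lambda>k. ennreal h * ?C k) \<longlonglongrightarrow> ennreal h * (4 * 0 + 2 * 0)"
    by (intro ennreal_tendsto_cmult tendsto_add I weak) auto
  then have C0: "(\<lambda>k. ennreal h * ?C k) \<longlonglongrightarrow> 0" by simp
  have conv: "(\<lambda>k. trunc \<Omega> U (real k) x) \<longlonglongrightarrow> U x" for x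
  proof (rule tendsto_eventually)
    have "U x = 0 \<or> x \<in> \<Omega>" using zero by blast
    then have "\<forall>\<^sub>F k in sequentially. \<bar>U x\<bar> \<le> real k * infdist x (- \<Omega>)" by (rule trunc_eventually[OF \<Omega>])
    then show "\<forall>\<^sub>F k in sequentially. trunc \<Omega> U (real k) x = U x"
      by (rule eventually_mono) (simp add: trunc_def clip_eq)
  qed
  have "Lp_pow 1 ?f = (\<integral>\<^sup>+x. liminf (\<lambda>k. ennreal \<bar>?e k x\<bar>) \<partial>lborel)"
    unfolding Lp_pow_1
  proof (intro nn_integral_cong)
    fix x
    have "(\<lambda>k. ennreal \<bar>?e k x\<bar>) \<longlonglongrightarrow> ennreal \<bar>?f x\<bar>"
      by (intro tendsto_ennrealI tendsto_intros conv)
    then show "ennreal \<bar>?f x\<bar> = liminf (\<lambda>k. ennreal \<bar>?e k x\<bar>)"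
      by (intro lim_imp_Liminf[symmetric]) auto
  qed
  also have "\<dots> \<le> liminf (\<lambda>k. Lp_pow 1 (?e k))"
    unfolding Lp_pow_1 by (intro nn_integral_liminf) measurable
  also have "\<dots> \<le> liminf (\<lambda>k. ennreal h * ?C k)"
    using trunc_bound[OF \<Omega> b h _ w G zero, of "real k" for k]
    by (intro Liminf_mono always_eventually) (auto simp: ennreal_of_nat_eq_real_of_nat)
  also have "\<dots> = 0" using C0 by (intro lim_imp_Liminf) auto
  finally have "Lp_pow 1 ?f = 0" by simp
  then have "AE x in lborel. ennreal \<bar>?f x\<bar> = 0"
    unfolding Lp_pow_1 by (subst (asm) nn_integral_0_iff_AE) auto
  then show ?thesis by (rule eventually_mono) simp
qed


section \<open>Decay near the boundary\<close>

text \<open>Unlike \<open>collar\<close> it contains the complement, so that a translate of the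
  layer lies in a wider layer even when points leave \<open>\<Omega>\<close>.\<close>

definition near_Compl :: "'a::euclidean_space set \<Rightarrow> real \<Rightarrow> 'a set" where
  "near_Compl \<Omega> r = {x. infdist x (- \<Omega>) < r}"

lemma near_Compl_sets [measurable]: "near_Compl \<Omega> r \<in> sets borel"
  unfolding near_Compl_def by measurable

lemma near_Compl_shift:
  assumes "x \<in> near_Compl \<Omega> r" "norm y \<le> t" shows "x + y \<in> near_Compl \<Omega> (r + t)"
  using assms infdist_lipschitz[of "x + y" "- \<Omega>" x] by (simp add: near_Compl_def dist_norm)

lemma near_Compl_mono: "r \<le> s \<Longrightarrow> near_Compl \<Omega> r \<subseteq> near_Compl \<Omega> s"
  by (auto simp: near_Compl_def)

text \<open>The segment to a nearest point of the complement crosses the frontier. This supplies the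
  centre at which the outer ball portion property is applied.\<close>

lemma frontier_point_near:
  fixes \<Omega> :: "'a::euclidean_space set"
  assumes "open \<Omega>" "bounded \<Omega>" "x \<in> \<Omega>" "infdist x (- \<Omega>) < r"
  obtains z where "z \<in> frontier \<Omega>" "dist x z < r"
proof -
  have ne: "- \<Omega> \<noteq> {}" using infdist_Compl_pos[OF assms(1-3)] by (auto simp: infdist_def)
  obtain y where "y \<in> - \<Omega>" "infdist x (- \<Omega>) = dist x y"
    by (rule infdist_attains_inf[OF closed_Compl[OF assms(1)] ne])
  then have y: "y \<in> - \<Omega>" "dist x y < r" using assms(4) by auto
  have "closed_segment x y \<inter> frontier \<Omega> \<noteq> {}"
    using assms(3) y(1) by (intro connected_Int_frontier) auto
  then obtain z where z: "z \<in> closed_segment x y" "z \<in> frontier \<Omega>" by blast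
  have "dist x z \<le> dist x y" using segment_bound(1)[OF z(1)] by (simp add: dist_norm norm_minus_commute)
  with z y(2) show ?thesis by (intro that[of z]) auto
qed

text \<open>Connects the distance in the theorem with the distance to the complement, which is used
  throughout because it vanishes outside \<open>\<Omega>\<close> and is 1-Lipschitz on the whole
  space.\<close>

lemma infdist_frontier_eq:
  fixes \<Omega> :: "'a::euclidean_space set"
  assumes "open \<Omega>" "bounded \<Omega>" "x \<in> \<Omega>"
  shows "infdist x (frontier \<Omega>) = infdist x (- \<Omega>)"
proof (rule antisym)
  obtain z0 where z0: "z0 \<in> frontier \<Omega>"
    using frontier_point_near[OF assms, of "infdist x (- \<Omega>) + 1"] by auto
  have "frontier \<Omega> \<subseteq> - \<Omega>" using assms(1) by (simp add: frontier_def interior_open) blast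
  then show "infdist x (- \<Omega>) \<le> infdist x (frontier \<Omega>)"
    using z0 by (intro infdist_mono) auto
  show "infdist x (frontier \<Omega>) \<le> infdist x (- \<Omega>)"
  proof (rule field_le_epsilon)
    fix e :: real assume "e > 0"
    then obtain z where "z \<in> frontier \<Omega>" "dist x z < infdist x (- \<Omega>) + e"
      using frontier_point_near[OF assms, of "infdist x (- \<Omega>) + e"] by auto
    then show "infdist x (frontier \<Omega>) \<le> infdist x (- \<Omega>) + e"
      using infdist_le[of z "frontier \<Omega>" x] by simp
  qed
qed

lemma mollify_scaled_diff:
  fixes f g :: "'a::euclidean_space \<Rightarrow> real"
  assumes \<rho>: "mollifier \<epsilon> \<rho>" and "integrable lborel f" "integrable lborel g"
  shows "mollify \<rho> (\<lambda>x. c * f x - g x) x = c * mollify \<rho> f x - mollify \<rho> g x"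
proof -
  obtain B where B: "B \<ge> 0" "\<And>x. \<bar>\<rho> x\<bar> \<le> B"
    using bounded_continuous_bounded_support[OF mollifier_continuous[OF \<rho>], of \<epsilon>] \<rho>
    unfolding mollifier_def by metis
  note [measurable] = mollifier_measurable[OF \<rho>]
  have "integrable lborel (\<lambda>y. h y * \<rho> (x - y))" if "integrable lborel h" for h
  proof (rule Bochner_Integration.integrable_bound[where f="\<lambda>y. B * h y"])
    show "AE y in lborel. norm (h y * \<rho> (x - y)) \<le> norm (B * h y)"
    proof (rule AE_I2)
      fix y
      show "norm (h y * \<rho> (x - y)) \<le> norm (B * h y)"
        using mult_left_mono[OF B(2)[of "x - y"] abs_ge_zero[of "h y"]] B(1) by (simp add: abs_mult mult.commute)
    qed
  qed (use that in auto)
  from this[OF assms(2)] this[OF assms(3)] show ?thesis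
    by (simp add: mollify_def left_diff_distrib mult.assoc)
qed

text \<open>The interface between the two halves of the first implication. Differentiability and
  zero boundary values enter only through \<open>translation\<close>, which puts no condition on the
  segment.\<close>

locale zero_extension =
  fixes \<Omega> :: "'a::euclidean_space set" and U :: "'a \<Rightarrow> real" and G :: "'a \<Rightarrow> 'a \<Rightarrow> real" and p :: real
  assumes open_\<Omega>: "open \<Omega>" and bounded_\<Omega>: "bounded \<Omega>" and p: "p \<ge> 1"
    and U_measurable [measurable]: "U \<in> borel_measurable borel"
    and G_borel: "\<And>b. b \<in> Basis \<Longrightarrow> G b \<in> borel_measurable borel"
    and U_zero: "\<And>x. x \<notin> \<Omega> \<Longrightarrow> U x = 0"
    and G_zero: "\<And>b x. b \<in> Basis \<Longrightarrow> x \<notin> \<Omega> \<Longrightarrow> G b x = 0"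
    and G_Lp: "\<And>b. b \<in> Basis \<Longrightarrow> Lp_pow p (G b) < \<infinity>"
    and translation: "\<And>b h. b \<in> Basis \<Longrightarrow> h > 0 \<Longrightarrow> AE x in lborel. U (x + h *\<^sub>R b) - U x = h * seg_avg h b (G b) x"
begin

abbreviation "N \<equiv> near_Compl \<Omega>"

definition G_mass :: "real \<Rightarrow> ennreal" where
  "G_mass r = (\<Sum>b\<in>Basis. \<integral>\<^sup>+x. ennreal (\<bar>G b x\<bar> powr p) * indicator (N r) x \<partial>lborel)"

lemma G_integrable: "b \<in> Basis \<Longrightarrow> integrable lborel (G b)"
  by (rule integrable_if_Lp_pow_bounded_support[OF G_borel G_Lp p bounded_\<Omega>]) (use G_zero in auto)

lemma G_mass_mono: "r \<le> s \<Longrightarrow> G_mass r \<le> G_mass s"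
  unfolding G_mass_def using near_Compl_mono[of r s \<Omega>]
  by (intro sum_mono nn_integral_mono mult_left_mono) (auto simp: indicator_def)

lemma G_mass_ge: "b \<in> Basis \<Longrightarrow> (\<integral>\<^sup>+x. ennreal (\<bar>G b x\<bar> powr p) * indicator (N r) x \<partial>lborel) \<le> G_mass r"
  unfolding G_mass_def by (rule member_le_sum) auto

lemma G_mass_tendsto: "(\<lambda>n. G_mass (c / real (Suc n))) \<longlonglongrightarrow> 0"
proof -
  have "(\<lambda>n. \<integral>\<^sup>+x. ennreal (\<bar>G b x\<bar> powr p) * indicator (N (c / real (Suc n))) x \<partial>lborel) \<longlonglongrightarrow> 0" if b: "b \<in> Basis" for b
  proof (rule nn_integral_vanishing)
    show "(\<lambda>x. ennreal (\<bar>G b x\<bar> powr p)) \<in> borel_measurable lborel" using G_borel[OF b] by measurable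
    have r0: "(\<lambda>n. c / real (Suc n)) \<longlonglongrightarrow> 0" by (rule LIMSEQ_Suc[OF lim_const_over_n])
    show "AE x in lborel. ennreal (\<bar>G b x\<bar> powr p) = 0 \<or> (\<forall>\<^sub>F n in sequentially. x \<notin> N (c / real (Suc n)))"
    proof (rule AE_I2)
      fix x
      show "ennreal (\<bar>G b x\<bar> powr p) = 0 \<or> (\<forall>\<^sub>F n in sequentially. x \<notin> N (c / real (Suc n)))"
      proof (cases "x \<in> \<Omega>")
        case True
        have "\<forall>\<^sub>F n in sequentially. c / real (Suc n) < infdist x (- \<Omega>)"
          using r0 infdist_Compl_pos[OF open_\<Omega> bounded_\<Omega> True] by (rule order_tendstoD(2))
        then have "\<forall>\<^sub>F n in sequentially. x \<notin> N (c / real (Suc n))"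
          by (rule eventually_mono) (simp add: near_Compl_def)
        then show ?thesis by simp
      qed (use G_zero[OF b] p in simp)
    qed
  qed (use G_Lp[OF b] in \<open>auto simp: Lp_pow_def\<close>)
  then have "(\<lambda>n. G_mass (c / real (Suc n))) \<longlonglongrightarrow> (\<Sum>b\<in>(Basis::'a set). 0)"
    unfolding G_mass_def by (intro tendsto_sum)
  then show ?thesis by simp
qed

lemma single_translation_pos:
  assumes b: "b \<in> Basis" and h: "h > 0"
  shows "(\<integral>\<^sup>+x. ennreal (\<bar>U (x + h *\<^sub>R b) - U x\<bar> powr p) * indicator (N s) x \<partial>lborel) \<le> ennreal (h powr p) * G_mass (s + h)"
proof -
  note [measurable] = G_borel[OF b] seg_avg_measurable[OF h]
  have "(\<integral>\<^sup>+x. ennreal (\<bar>U (x + h *\<^sub>R b) - U x\<bar> powr p) * indicator (N s) x \<partial>lborel)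
    = (\<integral>\<^sup>+x. ennreal (h powr p) * (ennreal (\<bar>seg_avg h b (G b) x\<bar> powr p) * indicator (N s) x) \<partial>lborel)"
    using translation[OF b h] h
    by (intro nn_integral_cong_AE) (auto elim!: eventually_mono simp: abs_mult powr_mult ennreal_mult mult.assoc)
  also have "\<dots> = ennreal (h powr p) * (\<integral>\<^sup>+x. ennreal (\<bar>seg_avg h b (G b) x\<bar> powr p) * indicator (N s) x \<partial>lborel)"
    by (rule nn_integral_cmult) measurable
  also have "(\<integral>\<^sup>+x. ennreal (\<bar>seg_avg h b (G b) x\<bar> powr p) * indicator (N s) x \<partial>lborel)
    = (\<integral>\<^sup>+x. ennreal (\<bar>(\<integral>t. G b (x + t *\<^sub>R b) \<partial>seg_measure h) - 0\<bar> powr p) * indicator (N s) x \<partial>lborel)"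
    by (simp add: seg_avg_def)
  also have "\<dots> \<le> G_mass (s + h)"
  proof (rule average_weighted_le[OF emeasure_seg[OF h] p])
    show "AE t in seg_measure h. (\<integral>\<^sup>+x. ennreal (\<bar>G b (x + t *\<^sub>R b) - 0\<bar> powr p) * indicator (N s) x \<partial>lborel) \<le> G_mass (s + h)"
    proof (rule eventually_mono[OF AE_seg[OF h]])
      fix t assume t: "0 \<le> t \<and> t \<le> h"
      have "(\<integral>\<^sup>+x. ennreal (\<bar>G b (x + t *\<^sub>R b)\<bar> powr p) * indicator (N s) x \<partial>lborel)
        \<le> (\<integral>\<^sup>+x. ennreal (\<bar>G b x\<bar> powr p) * indicator (N (s + h)) x \<partial>lborel)"
        using t b by (intro nn_integral_translate_indicator[where f="\<lambda>x. ennreal (\<bar>G b x\<bar> powr p)"] near_Compl_shift) auto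
      also have "\<dots> \<le> G_mass (s + h)" by (rule G_mass_ge[OF b])
      finally show "(\<integral>\<^sup>+x. ennreal (\<bar>G b (x + t *\<^sub>R b) - 0\<bar> powr p) * indicator (N s) x \<partial>lborel) \<le> G_mass (s + h)" by simp
    qed
  qed measurable
  finally show ?thesis by (simp add: mult_left_mono)
qed

text \<open>A negative shift is a positive one read from its far end. Moving the layer there widens
  it by \<open>\<bar>t\<bar>\<close>, the segment by \<open>\<bar>t\<bar>\<close> again, whence
  \<open>s + 2 * r\<close>.\<close>

lemma single_translation:
  assumes b: "b \<in> Basis" and t: "\<bar>t\<bar> \<le> r"
  shows "(\<integral>\<^sup>+x. ennreal (\<bar>U (x + t *\<^sub>R b) - U x\<bar> powr p) * indicator (N s) x \<partial>lborel) \<le> ennreal (r powr p) * G_mass (s + 2 * r)"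
proof -
  have le: "ennreal (\<bar>t\<bar> powr p) * G_mass s' \<le> ennreal (r powr p) * G_mass (s + 2 * r)" if "s' \<le> s + 2 * \<bar>t\<bar>" for s'
    using t that p by (intro mult_mono ennreal_leI powr_mono2 G_mass_mono) auto
  consider "t = 0" | "t > 0" | "t < 0" by linarith
  then show ?thesis
  proof cases
    case 2
    then show ?thesis using single_translation_pos[OF b 2, of s] le[of "s + t"] by (auto intro: order_trans)
  next
    case 3
    define h where "h = - t"
    have h: "h > 0" using 3 by (simp add: h_def)
    have "(\<integral>\<^sup>+x. ennreal (\<bar>U (x + t *\<^sub>R b) - U x\<bar> powr p) * indicator (N s) x \<partial>lborel)
      = (\<integral>\<^sup>+x. ennreal (\<bar>U (x + t *\<^sub>R b) - U ((x + t *\<^sub>R b) + h *\<^sub>R b)\<bar> powr p) * indicator (N s) x \<partial>lborel)"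
      by (simp add: h_def)
    also have "\<dots> \<le> (\<integral>\<^sup>+x. ennreal (\<bar>U x - U (x + h *\<^sub>R b)\<bar> powr p) * indicator (N (s + h)) x \<partial>lborel)"
      using h b by (intro nn_integral_translate_indicator[where f="\<lambda>x. ennreal (\<bar>U x - U (x + h *\<^sub>R b)\<bar> powr p)"] near_Compl_shift)
        (auto simp: h_def)
    also have "\<dots> \<le> ennreal (\<bar>t\<bar> powr p) * G_mass (s + h + h)"
      using single_translation_pos[OF b h, of "s + h"] h by (simp add: h_def abs_minus_commute)
    also have "\<dots> \<le> ennreal (r powr p) * G_mass (s + 2 * r)" by (rule le) (use 3 in \<open>simp add: h_def\<close>)
    finally show ?thesis .
  qed simp
qed

text \<open>One coordinate is moved at a time. Each move costs a factor \<open>2 powr p\<close> from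
  the quasi-triangle inequality and 2 for its two terms. An allowance of \<open>3 * r\<close> per
  coordinate covers the shift of the layer by \<open>r\<close> and the \<open>2 * r\<close> of
  \<open>single_translation\<close>; the induction needs arbitrary \<open>s\<close> since the layer
  grows.\<close>

lemma multi_translation:
  assumes "finite J" "J \<subseteq> Basis" "\<And>b. b \<in> J \<Longrightarrow> \<bar>c b\<bar> \<le> r" "r \<ge> 0"
  shows "(\<integral>\<^sup>+x. ennreal (\<bar>U (x + (\<Sum>b\<in>J. c b *\<^sub>R b)) - U x\<bar> powr p) * indicator (N s) x \<partial>lborel)
    \<le> ennreal ((2 * 2 powr p) ^ card J * r powr p) * G_mass (s + 3 * real (card J) * r)"
  using assms(1-3)
proof (induction arbitrary: s rule: finite_induct)
  case (insert a J)
  let ?y = "\<Sum>b\<in>J. c b *\<^sub>R b" and ?C = "(2 * 2 powr p) ^ card J :: real" and ?n = "real (card J)"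
  let ?M = "G_mass (s + 3 * real (card (insert a J)) * r)"
  have a: "a \<in> Basis" "\<bar>c a\<bar> \<le> r" using insert.prems by auto
  have C: "?C \<ge> 1" using p ge_one_powr_ge_zero[of 2 p] by (intro one_le_power) simp
  have "(\<integral>\<^sup>+x. ennreal (\<bar>U (x + (\<Sum>b\<in>insert a J. c b *\<^sub>R b)) - U x\<bar> powr p) * indicator (N s) x \<partial>lborel)
    \<le> (\<integral>\<^sup>+x. ennreal (2 powr p) * (ennreal (\<bar>U ((x + c a *\<^sub>R a) + ?y) - U (x + c a *\<^sub>R a)\<bar> powr p) * indicator (N s) x
        + ennreal (\<bar>U (x + c a *\<^sub>R a) - U x\<bar> powr p) * indicator (N s) x) \<partial>lborel)"
  proof (intro nn_integral_mono)
    fix x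
    have "ennreal (\<bar>U (x + (\<Sum>b\<in>insert a J. c b *\<^sub>R b)) - U x\<bar> powr p)
      = ennreal (\<bar>(U ((x + c a *\<^sub>R a) + ?y) - U (x + c a *\<^sub>R a)) + (U (x + c a *\<^sub>R a) - U x)\<bar> powr p)"
      using insert.hyps by (simp add: add.assoc)
    also have "\<dots> \<le> ennreal (2 powr p) * (ennreal (\<bar>U ((x + c a *\<^sub>R a) + ?y) - U (x + c a *\<^sub>R a)\<bar> powr p)
        + ennreal (\<bar>U (x + c a *\<^sub>R a) - U x\<bar> powr p))"
      using p by (intro ennreal_powr_abs_add_le) auto
    finally show "ennreal (\<bar>U (x + (\<Sum>b\<in>insert a J. c b *\<^sub>R b)) - U x\<bar> powr p) * indicator (N s) x
      \<le> ennreal (2 powr p) * (ennreal (\<bar>U ((x + c a *\<^sub>R a) + ?y) - U (x + c a *\<^sub>R a)\<bar> powr p) * indicator (N s) x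
        + ennreal (\<bar>U (x + c a *\<^sub>R a) - U x\<bar> powr p) * indicator (N s) x)"
      by (auto simp: indicator_def)
  qed
  also have "\<dots> = ennreal (2 powr p) * ((\<integral>\<^sup>+x. ennreal (\<bar>U ((x + c a *\<^sub>R a) + ?y) - U (x + c a *\<^sub>R a)\<bar> powr p) * indicator (N s) x \<partial>lborel)
        + (\<integral>\<^sup>+x. ennreal (\<bar>U (x + c a *\<^sub>R a) - U x\<bar> powr p) * indicator (N s) x \<partial>lborel))"
    by (subst nn_integral_cmult, measurable, subst nn_integral_add) auto
  also have "\<dots> \<le> ennreal (2 powr p) * (ennreal (?C * r powr p) * ?M + ennreal (r powr p) * ?M)"
  proof (intro mult_left_mono add_mono)
    have "(\<integral>\<^sup>+x. ennreal (\<bar>U ((x + c a *\<^sub>R a) + ?y) - U (x + c a *\<^sub>R a)\<bar> powr p) * indicator (N s) x \<partial>lborel)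
      \<le> (\<integral>\<^sup>+x. ennreal (\<bar>U (x + ?y) - U x\<bar> powr p) * indicator (N (s + r)) x \<partial>lborel)"
      using a by (intro nn_integral_translate_indicator[where f="\<lambda>x. ennreal (\<bar>U (x + ?y) - U x\<bar> powr p)"] near_Compl_shift) auto
    also have "\<dots> \<le> ennreal (?C * r powr p) * G_mass (s + r + 3 * ?n * r)"
      using insert.prems by (intro insert.IH) auto
    also have "\<dots> \<le> ennreal (?C * r powr p) * ?M"
      using insert.hyps assms(4) by (intro mult_left_mono G_mass_mono) (auto simp: algebra_simps)
    finally show "(\<integral>\<^sup>+x. ennreal (\<bar>U ((x + c a *\<^sub>R a) + ?y) - U (x + c a *\<^sub>R a)\<bar> powr p) * indicator (N s) x \<partial>lborel)
      \<le> ennreal (?C * r powr p) * ?M" .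
    have "(\<integral>\<^sup>+x. ennreal (\<bar>U (x + c a *\<^sub>R a) - U x\<bar> powr p) * indicator (N s) x \<partial>lborel) \<le> ennreal (r powr p) * G_mass (s + 2 * r)"
      by (rule single_translation[OF a])
    also have "\<dots> \<le> ennreal (r powr p) * ?M"
      using insert.hyps assms(4) by (intro mult_left_mono G_mass_mono) (auto simp: algebra_simps)
    finally show "(\<integral>\<^sup>+x. ennreal (\<bar>U (x + c a *\<^sub>R a) - U x\<bar> powr p) * indicator (N s) x \<partial>lborel) \<le> ennreal (r powr p) * ?M" .
  qed auto
  also have "\<dots> = ennreal (2 powr p * (?C * r powr p + r powr p)) * ?M"
  proof -
    have "ennreal k * (ennreal (c * q) * M + ennreal q * M) = ennreal (k * (c * q + q)) * M"
      if "k \<ge> 0" "c \<ge> 0" "q \<ge> 0" for k c q M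
      using that by (simp only: ennreal_mult ennreal_plus distrib_right distrib_left mult_nonneg_nonneg add_nonneg_nonneg mult.assoc)
    from this[of "2 powr p" ?C "r powr p"] C show ?thesis by simp
  qed
  also have "\<dots> \<le> ennreal ((2 * 2 powr p) ^ card (insert a J) * r powr p) * ?M"
  proof (intro mult_right_mono ennreal_leI)
    have "?C * r powr p + r powr p \<le> 2 * (?C * r powr p)"
      using mult_right_mono[OF C powr_ge_zero[of r p]] by linarith
    then have "2 powr p * (?C * r powr p + r powr p) \<le> 2 powr p * (2 * (?C * r powr p))"
      by (intro mult_left_mono) auto
    then show "2 powr p * (?C * r powr p + r powr p) \<le> (2 * 2 powr p) ^ card (insert a J) * r powr p"
      using insert.hyps by (simp add: mult_ac)
  qed auto
  finally show ?case .
qed simp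

text \<open>\<open>2 ^ DIM('a) / \<beta>\<close> compares the volume of a ball of radius
  \<open>2 * r\<close> with the guaranteed outer portion of one of radius \<open>r\<close>; the rest
  is the constant of \<open>multi_translation\<close> for shifts up to \<open>2 * r\<close>.\<close>

definition layer_const :: "real \<Rightarrow> real" where
  "layer_const \<beta> = 2 ^ DIM('a) / \<beta> * ((2 * 2 powr p) ^ DIM('a) * 2 powr p)"

text \<open>
  Average \<open>\<bar>U (x + y) - U x\<bar>\<^sup>p\<close> over those \<open>y\<close> in the ball of radius \<open>2 r\<close> for which \<open>x + y\<close> lies outside \<open>\<Omega>\<close>, so that
  \<open>U (x + y) = 0\<close>.
\<close>

lemma layer_estimate:
  fixes \<beta> r :: real
  assumes \<beta>: "\<beta> > 0" and r: "r > 0"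
    and ball: "\<And>z. z \<in> frontier \<Omega> \<Longrightarrow> measure lebesgue (ball z r \<inter> - \<Omega>) \<ge> \<beta> * measure lebesgue (ball z r)"
  shows "(\<integral>\<^sup>+x. ennreal (\<bar>U x\<bar> powr p) * indicator (N r) x \<partial>lborel)
    \<le> ennreal (layer_const \<beta> * r powr p) * G_mass ((1 + 6 * real DIM('a)) * r)"
proof -
  have \<Omega>b: "\<Omega> \<in> sets borel" using open_\<Omega> by simp
  have bC [measurable]: "ball z t \<inter> - \<Omega> \<in> sets borel" for z t
    using \<Omega>b by (intro sets.Int borel_comp) auto
  have [measurable]: "ball (0::'a) (2 * r) \<in> sets borel" by simp
  define v where "v = measure lborel (ball (0::'a) r)"
  have v: "v > 0" using r by (simp add: v_def content_ball_pos)
  have ball_v: "measure lborel (ball z r) = v" for z :: 'a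
    using r by (simp add: v_def content_ball)
  define m where "m = \<beta> * v"
  have m: "m > 0" using \<beta> v by (simp add: m_def)
  let ?X = "\<integral>\<^sup>+x. ennreal (\<bar>U x\<bar> powr p) * indicator (N r) x \<partial>lborel"
  let ?g = "\<lambda>x y. ennreal (\<bar>U (x + y) - U x\<bar> powr p) * indicator (N r) x * indicator (ball (0::'a) (2 * r)) y"
  have pt: "ennreal m * (ennreal (\<bar>U x\<bar> powr p) * indicator (N r) x) \<le> (\<integral>\<^sup>+y. ?g x y \<partial>lborel)" for x
  proof (cases "x \<in> \<Omega> \<and> x \<in> N r")
    case True
    then obtain z where z: "z \<in> frontier \<Omega>" "dist x z < r"
      using frontier_point_near[OF open_\<Omega> bounded_\<Omega>, of x r] by (auto simp: near_Compl_def)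
    have "ennreal m \<le> emeasure lborel (ball z r \<inter> - \<Omega>)"
    proof -
      have fin: "emeasure lborel (ball z r \<inter> - \<Omega>) < \<infinity>" by (intro emeasure_bounded_finite) auto
      have "m \<le> measure lborel (ball z r \<inter> - \<Omega>)"
        using ball[OF z(1)] ball_v[of z] by (simp add: m_def measure_completion)
      then show ?thesis using fin by (subst emeasure_eq_ennreal_measure) (auto intro: ennreal_leI)
    qed
    \<comment> \<open>The radius doubles because the outer portion is known around the frontier
      point \<open>z\<close>, which is closer than \<open>r\<close> to \<open>x\<close>.\<close>
    also have "\<dots> \<le> emeasure lborel (ball x (2 * r) \<inter> - \<Omega>)"
    proof (intro emeasure_mono)
      show "ball z r \<inter> - \<Omega> \<subseteq> ball x (2 * r) \<inter> - \<Omega>"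
      proof
        fix y assume "y \<in> ball z r \<inter> - \<Omega>"
        then show "y \<in> ball x (2 * r) \<inter> - \<Omega>" using z(2) dist_triangle[of x y z] by auto
      qed
    qed (simp add: bC)
    also have "\<dots> = (\<integral>\<^sup>+y. indicator (ball x (2 * r) \<inter> - \<Omega>) y \<partial>lborel)" by simp
    also have "\<dots> = (\<integral>\<^sup>+y. indicator (ball x (2 * r) \<inter> - \<Omega>) (y + x) \<partial>lborel)"
      by (rule nn_integral_translate[symmetric]) (use bC in auto)
    finally have "ennreal m * ennreal (\<bar>U x\<bar> powr p)
      \<le> (\<integral>\<^sup>+y. indicator (ball x (2 * r) \<inter> - \<Omega>) (y + x) \<partial>lborel) * ennreal (\<bar>U x\<bar> powr p)"
      by (rule mult_right_mono) simp
    also have "\<dots> = (\<integral>\<^sup>+y. indicator (ball x (2 * r) \<inter> - \<Omega>) (y + x) * ennreal (\<bar>U x\<bar> powr p) \<partial>lborel)"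
      by (rule nn_integral_multc[symmetric]) (use bC[of x "2 * r"] in measurable)
    also have "\<dots> \<le> (\<integral>\<^sup>+y. ?g x y \<partial>lborel)"
      using True U_zero by (intro nn_integral_mono) (auto simp: indicator_def dist_norm add.commute)
    finally show ?thesis using True by simp
  qed (use U_zero p in \<open>auto simp: indicator_def\<close>)
  have "ennreal m * ?X = (\<integral>\<^sup>+x. ennreal m * (ennreal (\<bar>U x\<bar> powr p) * indicator (N r) x) \<partial>lborel)"
    by (rule nn_integral_cmult[symmetric]) measurable
  also have "\<dots> \<le> (\<integral>\<^sup>+x. (\<integral>\<^sup>+y. ?g x y \<partial>lborel) \<partial>lborel)" by (intro nn_integral_mono pt)
  also have "\<dots> = (\<integral>\<^sup>+y. (\<integral>\<^sup>+x. ?g x y \<partial>lborel) \<partial>lborel)"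
    by (rule lborel_pair.Fubini'[symmetric]) measurable
  also have "\<dots> \<le> (\<integral>\<^sup>+y. ennreal ((2 * 2 powr p) ^ DIM('a) * (2 * r) powr p) * G_mass ((1 + 6 * real DIM('a)) * r)
      * indicator (ball (0::'a) (2 * r)) y \<partial>lborel)"
  proof (intro nn_integral_mono)
    fix y :: 'a
    have "(\<integral>\<^sup>+x. ?g x y \<partial>lborel) = (\<integral>\<^sup>+x. ennreal (\<bar>U (x + y) - U x\<bar> powr p) * indicator (N r) x \<partial>lborel) * indicator (ball (0::'a) (2 * r)) y"
      by (rule nn_integral_multc) measurable
    also have "\<dots> \<le> ennreal ((2 * 2 powr p) ^ DIM('a) * (2 * r) powr p) * G_mass ((1 + 6 * real DIM('a)) * r) * indicator (ball (0::'a) (2 * r)) y"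
    proof (cases "y \<in> ball 0 (2 * r)")
      case True
      \<comment> \<open>Each coordinate of \<open>y\<close> is at most \<open>2 * r\<close>, so the
        layer widens from \<open>r\<close> to \<open>r + 3 * DIM('a) * (2 * r)\<close>, the width in
        the claim.\<close>
      have "(\<integral>\<^sup>+x. ennreal (\<bar>U (x + (\<Sum>b\<in>Basis. (y \<bullet> b) *\<^sub>R b)) - U x\<bar> powr p) * indicator (N r) x \<partial>lborel)
        \<le> ennreal ((2 * 2 powr p) ^ card (Basis::'a set) * (2 * r) powr p) * G_mass (r + 3 * real (card (Basis::'a set)) * (2 * r))"
      proof (rule multi_translation)
        fix b :: 'a assume "b \<in> Basis"
        then show "\<bar>y \<bullet> b\<bar> \<le> 2 * r" using Basis_le_norm[of b y] True by simp
      qed (use r in auto)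
      then show ?thesis using True by (simp add: euclidean_representation algebra_simps)
    qed simp
    finally show "(\<integral>\<^sup>+x. ?g x y \<partial>lborel) \<le>
      ennreal ((2 * 2 powr p) ^ DIM('a) * (2 * r) powr p) * G_mass ((1 + 6 * real DIM('a)) * r) * indicator (ball (0::'a) (2 * r)) y" .
  qed
  also have "\<dots> = ennreal ((2 * 2 powr p) ^ DIM('a) * (2 * r) powr p) * G_mass ((1 + 6 * real DIM('a)) * r) * emeasure lborel (ball (0::'a) (2 * r))"
    by (rule nn_integral_cmult_indicator) simp
  also have "emeasure lborel (ball (0::'a) (2 * r)) = ennreal (2 ^ DIM('a) * v)"
    using r unit_ball_vol_nonneg[of "real DIM('a)"] by (simp add: v_def emeasure_ball content_ball power_mult_distrib mult_ac)
  also have "ennreal ((2 * 2 powr p) ^ DIM('a) * (2 * r) powr p) * G_mass ((1 + 6 * real DIM('a)) * r) * ennreal (2 ^ DIM('a) * v)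
    = ennreal m * (ennreal (layer_const \<beta> * r powr p) * G_mass ((1 + 6 * real DIM('a)) * r))"
  proof -
    have "((2 * 2 powr p) ^ DIM('a) * (2 * r) powr p) * (2 ^ DIM('a) * v) = m * (layer_const \<beta> * r powr p)"
      using \<beta> r by (simp add: layer_const_def m_def powr_mult field_simps)
    then have "ennreal ((2 * 2 powr p) ^ DIM('a) * (2 * r) powr p) * ennreal (2 ^ DIM('a) * v)
       = ennreal m * ennreal (layer_const \<beta> * r powr p)"
      using m v \<beta> by (simp add: ennreal_mult[symmetric] layer_const_def)
    moreover have "a * g * c = m' * (l * g)" if "a * c = m' * l" for a c g m' l :: ennreal
      using that by (metis mult.assoc mult.commute)
    ultimately show ?thesis by blast
  qed
  finally have "ennreal m * ?X \<le> ennreal m * (ennreal (layer_const \<beta> * r powr p) * G_mass ((1 + 6 * real DIM('a)) * r))" .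
  then show ?thesis using m by (subst (asm) ennreal_mult_le_mult_iff) auto
qed

lemma Friedrichs: "Lp_pow p U < \<infinity>"
proof -
  obtain R where R: "R > 0" "\<And>x. x \<in> \<Omega> \<Longrightarrow> norm x \<le> R"
    using bounded_pos[of \<Omega>] bounded_\<Omega> by auto
  \<comment> \<open>A shift longer than \<open>2 * R\<close> moves \<open>\<Omega>\<close> off
    itself, so that on \<open>\<Omega>\<close> the increment of \<open>U\<close> is
    \<open>- U\<close>.\<close>
  define L where "L = 3 * R"
  have L: "L > 0" using R by (simp add: L_def)
  obtain b :: 'a where b: "b \<in> Basis" using nonempty_Basis by blast
  note [measurable] = G_borel[OF b] seg_avg_measurable[OF L]
  have "Lp_pow p U \<le> Lp_pow p (\<lambda>x. L * seg_avg L b (G b) x)"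
  proof (rule Lp_pow_mono_AE)
    show "AE x in lborel. \<bar>U x\<bar> \<le> \<bar>L * seg_avg L b (G b) x\<bar>"
      using translation[OF b L]
    proof (rule eventually_mono)
      fix x assume *: "U (x + L *\<^sub>R b) - U x = L * seg_avg L b (G b) x"
      show "\<bar>U x\<bar> \<le> \<bar>L * seg_avg L b (G b) x\<bar>"
      proof (cases "x \<in> \<Omega>")
        case True
        have "norm (L *\<^sub>R b) \<le> norm (x + L *\<^sub>R b) + norm x"
          using norm_triangle_ineq4[of "x + L *\<^sub>R b" x] by simp
        then have "x + L *\<^sub>R b \<notin> \<Omega>" using R(2)[OF True] R(2)[of "x + L *\<^sub>R b"] R(1) b by (auto simp: L_def)
        then show ?thesis using * U_zero by force
      qed (simp add: U_zero)
    qed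
  qed (use p in simp)
  also have "\<dots> = ennreal (L powr p) * Lp_pow p (seg_avg L b (G b))"
    using L by (subst Lp_pow_cmult) auto
  also have "\<dots> \<le> ennreal (L powr p) * Lp_pow p (G b)"
    by (intro mult_left_mono Lp_pow_seg_avg L p) auto
  also have "\<dots> < \<infinity>" using G_Lp[OF b] by (simp add: ennreal_mult_less_top)
  finally show ?thesis .
qed

lemma U_integrable: "integrable lborel U"
  by (rule integrable_if_Lp_pow_bounded_support[OF U_measurable Friedrichs p bounded_\<Omega>]) (use U_zero in auto)

end


section \<open>Approximation by test functions\<close>

lemma directional_difference_quotient:
  fixes F :: "'a::euclidean_space \<Rightarrow> real"
  assumes "(F has_derivative D) (at x)"
  shows "((\<lambda>t. (F (x + t *\<^sub>R b) - F x) / t) \<longlongrightarrow> D b) (at 0)"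
proof -
  interpret bounded_linear D using assms by (rule has_derivative_bounded_linear)
  have 1: "((\<lambda>t. x + t *\<^sub>R b) has_derivative (\<lambda>t. t *\<^sub>R b)) (at 0)"
    by (auto intro!: derivative_eq_intros)
  have "((\<lambda>t. F (x + t *\<^sub>R b)) has_derivative (\<lambda>t. D (t *\<^sub>R b))) (at 0)"
    using has_derivative_compose[OF 1, of F D] assms by simp
  moreover have "(\<lambda>t. D (t *\<^sub>R b)) = (*) (D b)" by (simp add: scale fun_eq_iff)
  ultimately have "((\<lambda>t. F (x + t *\<^sub>R b)) has_real_derivative D b) (at 0)"
    by (simp add: has_field_derivative_def)
  then show ?thesis by (simp add: has_field_derivative_iff)
qed

text \<open>
  Difference quotients commute with mollification, so \<open>w\<close> need not have a weak derivative.
\<close>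

lemma Lp_pow_mollify_partial_diff:
  fixes w g :: "'a::euclidean_space \<Rightarrow> real"
  assumes \<rho>: "mollifier \<epsilon> \<rho>" and w: "integrable lborel w" and g: "integrable lborel g"
    and b: "b \<in> Basis" and p: "p \<ge> 1" and h0: "h0 > 0"
    and le: "\<And>h. 0 < h \<Longrightarrow> h \<le> h0 \<Longrightarrow> Lp_pow p (\<lambda>x. (w (x + h *\<^sub>R b) - w x) / h - g x) \<le> c"
  shows "Lp_pow p (\<lambda>x. frechet_derivative (mollify \<rho> w) (at x) b - mollify \<rho> g x) \<le> c"
proof -
  have [measurable]: "w \<in> borel_measurable borel" "g \<in> borel_measurable borel" using w g by auto
  have wm [measurable]: "mollify \<rho> w \<in> borel_measurable borel" "mollify \<rho> g \<in> borel_measurable borel"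
    using mollify_measurable[OF \<rho>] by auto
  define h where "h n = h0 / real (Suc n)" for n
  have h: "h n > 0" "h n \<le> h0" for n using h0 by (auto simp: h_def field_simps)
  have hlim: "filterlim h (at 0) sequentially"
    unfolding filterlim_at using LIMSEQ_Suc[OF lim_const_over_n, of h0] h(1)
    by (auto simp: h_def[abs_def] intro!: always_eventually)
  let ?q = "\<lambda>n x. (w (x + h n *\<^sub>R b) - w x) / h n - g x"
  let ?m = "\<lambda>n x. (mollify \<rho> w (x + h n *\<^sub>R b) - mollify \<rho> w x) / h n - mollify \<rho> g x"
  have m: "?m n x = mollify \<rho> (?q n) x" for n x
  proof -
    have shift: "mollify \<rho> (\<lambda>x. w (x + h n *\<^sub>R b)) x = mollify \<rho> w (x + h n *\<^sub>R b)"
      using mollify_average[OF \<rho>, of "\<lambda>x. w (x + h n *\<^sub>R b)" x] mollify_average[OF \<rho>, of w "x + h n *\<^sub>R b"]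
      by (simp add: add_ac)
    have "mollify \<rho> (\<lambda>x. (1 / h n) * (1 * w (x + h n *\<^sub>R b) - w x) - g x) x
      = (1 / h n) * (mollify \<rho> (\<lambda>x. 1 * w (x + h n *\<^sub>R b) - w x) x) - mollify \<rho> g x"
      using w g by (intro mollify_scaled_diff[OF \<rho>]) (auto intro: integrable_translate)
    also have "mollify \<rho> (\<lambda>x. 1 * w (x + h n *\<^sub>R b) - w x) x = 1 * mollify \<rho> (\<lambda>x. w (x + h n *\<^sub>R b)) x - mollify \<rho> w x"
      using w g by (intro mollify_scaled_diff[OF \<rho>]) (auto intro: integrable_translate)
    finally show ?thesis by (simp add: shift)
  qed
  \<comment> \<open>Fatou along \<open>h n\<close>: the mollified function is differentiable, so its
    quotients converge pointwise, and mollification does not increase the L^p size of the quotients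
    of \<open>w\<close>.\<close>
  have "Lp_pow p (\<lambda>x. frechet_derivative (mollify \<rho> w) (at x) b - mollify \<rho> g x)
    = (\<integral>\<^sup>+x. liminf (\<lambda>n. ennreal (\<bar>?m n x\<bar> powr p)) \<partial>lborel)"
    unfolding Lp_pow_def
  proof (intro nn_integral_cong)
    fix x
    have "Ck (Suc 0) (mollify \<rho> w)"
      unfolding mollify_def[abs_def] using \<rho> w by (intro Ck_convolution[where R=\<epsilon>]) (auto simp: mollifier_def)
    then have "(mollify \<rho> w has_derivative frechet_derivative (mollify \<rho> w) (at x)) (at x)"
      by (rule Ck_has_derivative)
    then have "((\<lambda>t. (mollify \<rho> w (x + t *\<^sub>R b) - mollify \<rho> w x) / t) \<longlongrightarrow> frechet_derivative (mollify \<rho> w) (at x) b) (at 0)"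
      by (rule directional_difference_quotient)
    then have "(\<lambda>n. (mollify \<rho> w (x + h n *\<^sub>R b) - mollify \<rho> w x) / h n) \<longlonglongrightarrow> frechet_derivative (mollify \<rho> w) (at x) b"
      using hlim by (rule filterlim_compose)
    then have "(\<lambda>n. ennreal (\<bar>?m n x\<bar> powr p)) \<longlonglongrightarrow>
      ennreal (\<bar>frechet_derivative (mollify \<rho> w) (at x) b - mollify \<rho> g x\<bar> powr p)"
      using p by (intro tendsto_ennrealI tendsto_powr2 tendsto_intros) auto
    then show "ennreal (\<bar>frechet_derivative (mollify \<rho> w) (at x) b - mollify \<rho> g x\<bar> powr p)
      = liminf (\<lambda>n. ennreal (\<bar>?m n x\<bar> powr p))"
      by (intro lim_imp_Liminf[symmetric]) auto
  qed
  also have "\<dots> \<le> liminf (\<lambda>n. Lp_pow p (?m n))"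
    unfolding Lp_pow_def by (intro nn_integral_liminf) measurable
  also have "\<dots> \<le> liminf (\<lambda>n::nat. c)"
  proof (intro Liminf_mono always_eventually allI)
    fix n
    have "Lp_pow p (?m n) = Lp_pow p (mollify \<rho> (?q n))"
      unfolding m by simp
    also have "\<dots> \<le> Lp_pow p (?q n)" by (rule Lp_pow_mollify[OF \<rho> _ p]) measurable
    also have "\<dots> \<le> c" by (rule le[OF h])
    finally show "Lp_pow p (?m n) \<le> c" .
  qed
  also have "\<dots> = c" by (rule Liminf_const) simp
  finally show ?thesis .
qed

context zero_extension
begin

text \<open>Vanishing up to distance \<open>3 * r\<close> leaves room for mollification inside
  \<open>\<Omega>\<close>. The slope \<open>1 / r\<close> is the largest that
  \<open>layer_estimate\<close> can compensate at this scale.\<close>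

definition cutoff :: "real \<Rightarrow> 'a \<Rightarrow> real" where
  "cutoff r x = max 0 (min 1 ((infdist x (- \<Omega>) - 3 * r) / r))"

lemma cutoff_measurable [measurable]: "cutoff r \<in> borel_measurable borel"
  unfolding cutoff_def[abs_def]
  by (intro borel_measurable_max borel_measurable_min borel_measurable_divide borel_measurable_diff infdist_measurable) auto

lemma cutoff_bounds: "0 \<le> cutoff r x" "cutoff r x \<le> 1"
  by (auto simp: cutoff_def)

lemma cutoff_eq_1: "r > 0 \<Longrightarrow> x \<notin> near_Compl \<Omega> (4 * r) \<Longrightarrow> cutoff r x = 1"
  by (auto simp: cutoff_def near_Compl_def field_simps)

lemma cutoff_nonzero:
  assumes "r > 0" "cutoff r x \<noteq> 0" shows "infdist x (- \<Omega>) > 3 * r"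
proof (rule ccontr)
  assume "\<not> infdist x (- \<Omega>) > 3 * r"
  then have "(infdist x (- \<Omega>) - 3 * r) / r \<le> 0" using assms(1) by (intro divide_nonpos_pos) auto
  then have "cutoff r x = 0" by (simp add: cutoff_def)
  with assms(2) show False by simp
qed

lemma cutoff_lipschitz:
  assumes "r > 0" shows "\<bar>cutoff r x - cutoff r y\<bar> \<le> dist x y / r"
proof -
  have "\<bar>infdist x (- \<Omega>) - infdist y (- \<Omega>)\<bar> \<le> dist x y"
    using infdist_lipschitz[of x "- \<Omega>" y] infdist_lipschitz[of y "- \<Omega>" x] by (simp add: dist_commute)
  then have "\<bar>infdist x (- \<Omega>) - infdist y (- \<Omega>)\<bar> / r \<le> dist x y / r"
    using assms by (simp add: divide_right_mono)
  moreover have "\<bar>infdist x (- \<Omega>) - infdist y (- \<Omega>)\<bar> / r = \<bar>(infdist x (- \<Omega>) - 3 * r) / r - (infdist y (- \<Omega>) - 3 * r) / r\<bar>"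
    using assms by (simp add: diff_divide_distrib[symmetric] abs_divide)
  ultimately show ?thesis unfolding cutoff_def by linarith
qed

text \<open>The discrete product rule splits the quotient into the segment average of
  \<open>G b\<close>, damped by the cutoff, and the increment of the cutoff times \<open>U\<close>.
  The last two of the three error terms live in the layer of width \<open>5 * r\<close>.\<close>

lemma Lp_pow_cutoff_quotient:
  assumes b: "b \<in> Basis" and r: "r > 0" and h: "0 < h" "h \<le> r"
  shows "Lp_pow p (\<lambda>x. (cutoff r (x + h *\<^sub>R b) * U (x + h *\<^sub>R b) - cutoff r x * U x) / h - G b x)
    \<le> ennreal (2 powr p) * (Lp_pow p (\<lambda>x. seg_avg h b (G b) x - G b x)
      + ennreal (2 powr p) * (G_mass (5 * r) + ennreal ((1 / r) powr p) * (\<integral>\<^sup>+x. ennreal (\<bar>U x\<bar> powr p) * indicator (N (5 * r)) x \<partial>lborel)))"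
proof -
  note [measurable] = G_borel[OF b] seg_avg_measurable[OF h(1)]
  let ?\<eta> = "cutoff r" and ?y = "\<lambda>x. x + h *\<^sub>R b"
  let ?f1 = "\<lambda>x. ?\<eta> (?y x) * (seg_avg h b (G b) x - G b x)"
  let ?f2 = "\<lambda>x. (?\<eta> (?y x) - 1) * G b x"
  let ?f3 = "\<lambda>x. (?\<eta> (?y x) - ?\<eta> x) / h * U x"
  have p0: "p \<ge> 0" using p by simp
  have nb: "norm b = 1" using b by simp
  \<comment> \<open>The cutoff is 1 from distance \<open>4 * r\<close> on and the step is at most
    \<open>r\<close>.\<close>
  have one: "?\<eta> (?y x) = 1" "?\<eta> x = 1" if "x \<notin> N (5 * r)" for x
  proof -
    show "?\<eta> x = 1" using that r by (intro cutoff_eq_1) (auto simp: near_Compl_def)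
    have "infdist x (- \<Omega>) \<le> infdist (?y x) (- \<Omega>) + h"
      using infdist_lipschitz[of x "- \<Omega>" "?y x"] h nb by (simp add: dist_norm)
    then show "?\<eta> (?y x) = 1" using that r h by (intro cutoff_eq_1) (auto simp: near_Compl_def)
  qed
  have "AE x in lborel. (?\<eta> (?y x) * U (?y x) - ?\<eta> x * U x) / h - G b x = ?f1 x + (?f2 x + ?f3 x)"
    using translation[OF b h(1)]
  proof (rule eventually_mono)
    fix x assume *: "U (?y x) - U x = h * seg_avg h b (G b) x"
    then have U: "U (?y x) = U x + h * seg_avg h b (G b) x" by simp
    show "(?\<eta> (?y x) * U (?y x) - ?\<eta> x * U x) / h - G b x = ?f1 x + (?f2 x + ?f3 x)"
      unfolding U using h(1) by (simp add: field_simps)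
  qed
  then have "Lp_pow p (\<lambda>x. (?\<eta> (?y x) * U (?y x) - ?\<eta> x * U x) / h - G b x) \<le> Lp_pow p (\<lambda>x. ?f1 x + (?f2 x + ?f3 x))"
    by (intro Lp_pow_mono_AE[OF p0]) (auto elim: eventually_mono)
  also have "\<dots> \<le> ennreal (2 powr p) * (Lp_pow p ?f1 + Lp_pow p (\<lambda>x. ?f2 x + ?f3 x))"
    using p0 by (intro Lp_pow_add) measurable
  also have "\<dots> \<le> ennreal (2 powr p) * (Lp_pow p ?f1 + ennreal (2 powr p) * (Lp_pow p ?f2 + Lp_pow p ?f3))"
    using p0 by (intro mult_left_mono add_left_mono Lp_pow_add) (auto, measurable)
  also have "\<dots> \<le> ennreal (2 powr p) * (Lp_pow p (\<lambda>x. seg_avg h b (G b) x - G b x)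
      + ennreal (2 powr p) * (G_mass (5 * r) + ennreal ((1 / r) powr p) * (\<integral>\<^sup>+x. ennreal (\<bar>U x\<bar> powr p) * indicator (N (5 * r)) x \<partial>lborel)))"
  proof (intro mult_left_mono add_mono)
    show "Lp_pow p ?f1 \<le> Lp_pow p (\<lambda>x. seg_avg h b (G b) x - G b x)"
      using cutoff_bounds by (intro Lp_pow_mono_AE[OF p0] AE_I2) (auto simp: abs_mult intro!: mult_left_le_one_le)
    have "Lp_pow p ?f2 \<le> (\<integral>\<^sup>+x. ennreal (\<bar>G b x\<bar> powr p) * indicator (N (5 * r)) x \<partial>lborel)"
      unfolding Lp_pow_def
    proof (intro nn_integral_mono)
      fix x
      show "ennreal (\<bar>?f2 x\<bar> powr p) \<le> ennreal (\<bar>G b x\<bar> powr p) * indicator (N (5 * r)) x"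
      proof (cases "x \<in> N (5 * r)")
        case True
        have "\<bar>?f2 x\<bar> \<le> \<bar>G b x\<bar>"
          using cutoff_bounds[of r "?y x"] by (auto simp: abs_mult intro!: mult_left_le_one_le)
        with True show ?thesis using p0 by (auto intro!: ennreal_leI powr_mono2)
      qed (use one p in simp)
    qed
    also have "\<dots> \<le> G_mass (5 * r)" by (rule G_mass_ge[OF b])
    finally show "Lp_pow p ?f2 \<le> G_mass (5 * r)" .
    have "Lp_pow p ?f3 \<le> (\<integral>\<^sup>+x. ennreal ((1 / r) powr p) * (ennreal (\<bar>U x\<bar> powr p) * indicator (N (5 * r)) x) \<partial>lborel)"
      unfolding Lp_pow_def
    proof (intro nn_integral_mono)
      fix x
      show "ennreal (\<bar>?f3 x\<bar> powr p) \<le> ennreal ((1 / r) powr p) * (ennreal (\<bar>U x\<bar> powr p) * indicator (N (5 * r)) x)"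
      proof (cases "x \<in> N (5 * r)")
        case True
        have "\<bar>?\<eta> (?y x) - ?\<eta> x\<bar> \<le> h / r"
          using cutoff_lipschitz[OF r, of "?y x" x] h nb by (simp add: dist_norm)
        then have "\<bar>(?\<eta> (?y x) - ?\<eta> x) / h\<bar> \<le> 1 / r" using h r by (simp add: abs_divide field_simps)
        then have "\<bar>?f3 x\<bar> \<le> 1 / r * \<bar>U x\<bar>" unfolding abs_mult by (rule mult_right_mono) simp
        then have "\<bar>?f3 x\<bar> powr p \<le> (1 / r * \<bar>U x\<bar>) powr p" using p0 by (intro powr_mono2) auto
        also have "\<dots> = (1 / r) powr p * \<bar>U x\<bar> powr p" by (rule powr_mult)
        finally show ?thesis using True by (simp add: ennreal_mult[symmetric] ennreal_leI)
      qed (use one p in simp)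
    qed
    also have "\<dots> = ennreal ((1 / r) powr p) * (\<integral>\<^sup>+x. ennreal (\<bar>U x\<bar> powr p) * indicator (N (5 * r)) x \<partial>lborel)"
      by (rule nn_integral_cmult) measurable
    finally show "Lp_pow p ?f3 \<le> ennreal ((1 / r) powr p) * (\<integral>\<^sup>+x. ennreal (\<bar>U x\<bar> powr p) * indicator (N (5 * r)) x \<partial>lborel)" .
  qed auto
  finally show ?thesis .
qed

text \<open>The approximant is a mollification of \<open>cutoff r x * U x\<close>. Comparing the
  mollified quotients with the mollified \<open>G b\<close> leaves errors controlled by the gradient
  energy in a thin layer, by continuity of translations, and by the mass of \<open>U\<close> in the
  layer weighted with the slope of the cutoff.\<close>

lemma test_function_approximation:
  assumes \<beta>: "\<beta> > 0" and r0: "r0 > 0"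
    and ball: "\<And>z r. z \<in> frontier \<Omega> \<Longrightarrow> 0 < r \<Longrightarrow> r \<le> r0 \<Longrightarrow> measure lebesgue (ball z r \<inter> - \<Omega>) \<ge> \<beta> * measure lebesgue (ball z r)"
    and e: "e > 0"
  shows "\<exists>\<phi>\<in>test_functions \<Omega>. Lp_pow p (\<lambda>x. U x - \<phi> x) \<le> ennreal e \<and>
    (\<forall>b\<in>Basis. Lp_pow p (\<lambda>x. G b x - frechet_derivative \<phi> (at x) b) \<le> ennreal e)"
proof -
  have p0: "p \<ge> 0" using p by simp
  define \<kappa> where "\<kappa> = layer_const \<beta>"
  have \<kappa>: "\<kappa> > 0" using \<beta> by (simp add: \<kappa>_def layer_const_def)
  define A where "A = 2 powr p"
  have A: "A > 0" by (simp add: A_def)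
  \<comment> \<open>The two summands are the total constants for the function and for a partial
    derivative, so each error is at most \<open>C * e1\<close>.\<close>
  define C where "C = A * (\<kappa> * r0 powr p + 1) + A * (1 + A * (1 + A * (1 + \<kappa> * 5 powr p)))"
  have C: "C > 0" using A \<kappa> r0 by (auto simp: C_def intro!: add_pos_pos mult_pos_pos)
  define e1 where "e1 = e / C"
  have e1: "e1 > 0" using e C by (simp add: e1_def)
  define c where "c = 1 + 6 * real DIM('a)"
  have "\<forall>\<^sub>F n in sequentially. G_mass (c * r0 / real (Suc n)) < ennreal e1"
    using e1 by (intro order_tendstoD(2)[OF G_mass_tendsto]) auto
  then obtain n where n: "G_mass (c * r0 / real (Suc n)) < ennreal e1" by (auto simp: eventually_sequentially)
  \<comment> \<open>The layer estimate is used at radius \<open>5 * r\<close>, which must not exceed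
    \<open>r0\<close>; its enlarged layer has width \<open>c * r0 / real (Suc n)\<close>, where
    \<open>n\<close> makes the gradient energy small.\<close>
  define r where "r = r0 / (5 * real (Suc n))"
  have r: "r > 0" "5 * r \<le> r0" using r0 by (auto simp: r_def field_simps)
  have m1: "G_mass (c * (5 * r)) \<le> ennreal e1"
  proof -
    have "c * (5 * r) = c * r0 / real (Suc n)" by (simp add: r_def field_simps)
    then show ?thesis using n by simp
  qed
  have m2: "G_mass (5 * r) \<le> ennreal e1"
    using r by (intro order_trans[OF G_mass_mono m1]) (auto simp: c_def)
  let ?S = "\<integral>\<^sup>+x. ennreal (\<bar>U x\<bar> powr p) * indicator (N (5 * r)) x \<partial>lborel"
  have S: "?S \<le> ennreal (\<kappa> * (5 * r) powr p * e1)"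
  proof -
    have "?S \<le> ennreal (\<kappa> * (5 * r) powr p) * G_mass (c * (5 * r))"
      unfolding \<kappa>_def c_def by (rule layer_estimate[OF \<beta>]) (use r ball in auto)
    also have "\<dots> \<le> ennreal (\<kappa> * (5 * r) powr p) * ennreal e1" by (intro mult_left_mono m1) auto
    finally show ?thesis using \<kappa> e1 by (simp add: ennreal_mult)
  qed
  define w where "w x = cutoff r x * U x" for x
  have [measurable]: "w \<in> borel_measurable borel" unfolding w_def[abs_def] by measurable
  have w_le: "\<bar>w x\<bar> \<le> \<bar>U x\<bar>" for x
    using cutoff_bounds[of r x] by (simp add: w_def abs_mult mult_left_le_one_le)
  have wi: "integrable lborel w"
    by (rule Bochner_Integration.integrable_bound[OF U_integrable]) (auto simp: w_le)
  have wp: "Lp_pow p w < \<infinity>"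
    using Lp_pow_mono_AE[OF p0, of w U] w_le Friedrichs by (auto intro: le_less_trans)
  have Uw: "Lp_pow p (\<lambda>x. U x - w x) \<le> ?S"
    unfolding Lp_pow_def
  proof (intro nn_integral_mono)
    fix x
    show "ennreal (\<bar>U x - w x\<bar> powr p) \<le> ennreal (\<bar>U x\<bar> powr p) * indicator (N (5 * r)) x"
    proof (cases "x \<in> N (5 * r)")
      case True
      have "\<bar>U x - w x\<bar> = \<bar>(1 - cutoff r x) * U x\<bar>" by (simp add: w_def left_diff_distrib)
      also have "\<dots> \<le> \<bar>U x\<bar>" using cutoff_bounds[of r x] by (auto simp: abs_mult intro!: mult_left_le_one_le)
      finally show ?thesis using True p0 by (auto intro!: ennreal_leI powr_mono2)
    next
      case False
      then have "cutoff r x = 1" using r by (intro cutoff_eq_1) (auto simp: near_Compl_def)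
      then show ?thesis using p by (simp add: w_def)
    qed
  qed
  have "\<exists>\<delta>>0. \<forall>\<epsilon> \<rho>. \<epsilon> < \<delta> \<longrightarrow> mollifier \<epsilon> \<rho> \<longrightarrow> Lp_pow p (\<lambda>x. mollify \<rho> (G b) x - G b x) \<le> ennreal e1" if "b \<in> Basis" for b
    using Lp_pow_mollify_diff[OF G_integrable[OF that] G_Lp[OF that] p e1] .
  then obtain \<delta> where \<delta>: "\<And>b. b \<in> Basis \<Longrightarrow> \<delta> b > 0"
    "\<And>b \<epsilon> \<rho>. b \<in> Basis \<Longrightarrow> \<epsilon> < \<delta> b \<Longrightarrow> mollifier \<epsilon> \<rho> \<Longrightarrow> Lp_pow p (\<lambda>x. mollify \<rho> (G b) x - G b x) \<le> ennreal e1"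
    by metis
  obtain \<delta>' where \<delta>': "\<delta>' > 0" "\<And>\<epsilon> \<rho>. \<epsilon> < \<delta>' \<Longrightarrow> mollifier \<epsilon> \<rho> \<Longrightarrow> Lp_pow p (\<lambda>x. mollify \<rho> w x - w x) \<le> ennreal e1"
    using Lp_pow_mollify_diff[OF wi wp p e1] by metis
  \<comment> \<open>At most \<open>r / 2\<close>, so the support moves from distance
    \<open>3 * r\<close> to no less than \<open>2 * r\<close>; the other bounds serve
    \<open>w\<close> and all components of \<open>G\<close> with one mollifier.\<close>
  define \<epsilon> where "\<epsilon> = Min (insert (r / 2) (insert (\<delta>' / 2) ((\<lambda>b. \<delta> b / 2) ` Basis)))"
  have \<epsilon>le: "\<epsilon> \<le> r / 2" "\<epsilon> \<le> \<delta>' / 2" "\<And>b. b \<in> Basis \<Longrightarrow> \<epsilon> \<le> \<delta> b / 2"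
    unfolding \<epsilon>_def by (intro Min_le; force)+
  have \<epsilon>: "\<epsilon> > 0" using r \<delta> \<delta>' by (auto simp: \<epsilon>_def)
  obtain \<rho> :: "'a \<Rightarrow> real" where \<rho>: "mollifier \<epsilon> \<rho>" using ex_mollifier[OF \<epsilon>] by blast
  define \<phi> where "\<phi> = mollify \<rho> w"
  have \<phi>m: "\<phi> \<in> borel_measurable borel" unfolding \<phi>_def by (rule mollify_measurable[OF \<rho>]) measurable
  have test: "\<phi> \<in> test_functions \<Omega>"
    unfolding \<phi>_def
  proof (rule mollify_test_function[OF \<rho> wi])
    have sub: "{x. 2 * r \<le> infdist x (- \<Omega>)} \<subseteq> \<Omega>"
    proof
      fix x assume "x \<in> {x. 2 * r \<le> infdist x (- \<Omega>)}"
      then have "infdist x (- \<Omega>) \<noteq> 0" using r by auto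
      then show "x \<in> \<Omega>" using infdist_Compl_zero[of x \<Omega>] by blast
    qed
    then show "{x. 2 * r \<le> infdist x (- \<Omega>)} \<subseteq> \<Omega>" .
    show "compact {x. 2 * r \<le> infdist x (- \<Omega>)}"
      using bounded_subset[OF bounded_\<Omega> sub]
      by (simp add: compact_eq_bounded_closed closed_Collect_le continuous_on_infdist)
    fix x y assume *: "w y \<noteq> 0" "norm (x - y) \<le> \<epsilon>"
    have "cutoff r y \<noteq> 0" using *(1) by (auto simp: w_def)
    then have "infdist y (- \<Omega>) > 3 * r" by (rule cutoff_nonzero[OF r(1)])
    moreover have "infdist y (- \<Omega>) \<le> infdist x (- \<Omega>) + \<epsilon>"
      using infdist_lipschitz[of y "- \<Omega>" x] *(2) by (simp add: dist_norm norm_minus_commute)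
    ultimately show "x \<in> {x. 2 * r \<le> infdist x (- \<Omega>)}" using \<epsilon>le(1) r by simp
  qed
  have "Lp_pow p (\<lambda>x. U x - \<phi> x) \<le> ennreal e"
  proof -
    have "Lp_pow p (\<lambda>x. U x - \<phi> x) = Lp_pow p (\<lambda>x. (U x - w x) - (mollify \<rho> w x - w x))" by (simp add: \<phi>_def)
    also have "\<dots> \<le> ennreal A * (Lp_pow p (\<lambda>x. U x - w x) + Lp_pow p (\<lambda>x. mollify \<rho> w x - w x))"
      unfolding A_def using \<phi>m p0 by (intro Lp_pow_diff) (auto simp: \<phi>_def)
    also have "\<dots> \<le> ennreal A * (ennreal (\<kappa> * r0 powr p * e1) + ennreal e1)"
    proof (intro mult_left_mono add_mono)
      have "\<kappa> * (5 * r) powr p * e1 \<le> \<kappa> * r0 powr p * e1"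
        using \<kappa> e1 r p0 by (intro mult_right_mono mult_left_mono powr_mono2) auto
      then show "Lp_pow p (\<lambda>x. U x - w x) \<le> ennreal (\<kappa> * r0 powr p * e1)"
        using Uw S by (meson ennreal_leI order_trans)
      show "Lp_pow p (\<lambda>x. mollify \<rho> w x - w x) \<le> ennreal e1"
        using \<delta>'(1) \<epsilon>le(2) by (intro \<delta>'(2)[OF _ \<rho>]) simp
    qed simp
    also have "\<dots> = ennreal (A * (\<kappa> * r0 powr p + 1) * e1)"
      using A \<kappa> e1 by (simp add: ennreal_mult[symmetric] ennreal_plus[symmetric] algebra_simps del: ennreal_plus)
    also have "\<dots> \<le> ennreal e"
    proof (rule ennreal_leI)
      have "A * (\<kappa> * r0 powr p + 1) * e1 \<le> C * e1"
        using A \<kappa> e1 by (intro mult_right_mono) (auto simp: C_def)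
      then show "A * (\<kappa> * r0 powr p + 1) * e1 \<le> e" using C by (simp add: e1_def)
    qed
    finally show ?thesis .
  qed
  moreover have "Lp_pow p (\<lambda>x. G b x - frechet_derivative \<phi> (at x) b) \<le> ennreal e" if b: "b \<in> Basis" for b
  proof -
    note [measurable] = G_borel[OF b]
    have mGm: "mollify \<rho> (G b) \<in> borel_measurable borel" by (rule mollify_measurable[OF \<rho>]) measurable
    have dm: "(\<lambda>x. frechet_derivative \<phi> (at x) b) \<in> borel_measurable borel"
    proof -
      have "Ck (Suc 0) \<phi>" using test by (simp add: test_functions_def)
      then have "Ck 0 (\<lambda>x. frechet_derivative \<phi> (at x) b)" using b by simp
      then show ?thesis by (intro borel_measurable_continuous_onI) simp
    qed
    obtain h1 where h1: "h1 > 0" "\<And>y. norm y < h1 \<Longrightarrow> Lp_pow p (\<lambda>x. G b (x + y) - G b x) \<le> ennreal e1"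
      using Lp_translation_continuous[OF G_integrable[OF b] G_Lp[OF b] p e1] by metis
    have Q: "Lp_pow p (\<lambda>x. frechet_derivative (mollify \<rho> w) (at x) b - mollify \<rho> (G b) x)
      \<le> ennreal (A * (e1 + A * (e1 + \<kappa> * 5 powr p * e1)))"
    proof (rule Lp_pow_mollify_partial_diff[OF \<rho> wi G_integrable[OF b] b p])
      show "min r (h1 / 2) > 0" using r h1 by simp
      fix h assume h: "0 < h" "h \<le> min r (h1 / 2)"
      have "Lp_pow p (\<lambda>x. (w (x + h *\<^sub>R b) - w x) / h - G b x)
        \<le> ennreal (2 powr p) * (Lp_pow p (\<lambda>x. seg_avg h b (G b) x - G b x)
          + ennreal (2 powr p) * (G_mass (5 * r) + ennreal ((1 / r) powr p) * ?S))"
        unfolding w_def using h by (intro Lp_pow_cutoff_quotient b r) auto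
      also have "\<dots> \<le> ennreal A * (ennreal e1 + ennreal A * (ennreal e1 + ennreal ((1 / r) powr p) * ennreal (\<kappa> * (5 * r) powr p * e1)))"
        unfolding A_def
      proof (intro mult_left_mono add_mono m2 S)
        show "Lp_pow p (\<lambda>x. seg_avg h b (G b) x - G b x) \<le> ennreal e1"
          unfolding seg_avg_def
        proof (rule Lp_pow_average_diff[OF emeasure_seg[OF h(1)] p])
          show "AE s in seg_measure h. Lp_pow p (\<lambda>x. G b (x + s *\<^sub>R b) - G b x) \<le> ennreal e1"
            using h h1(1) b by (intro eventually_mono[OF AE_seg[OF h(1)]] h1(2)) auto
        qed measurable
      qed auto
      \<comment> \<open>The decisive cancellation: the slope of the cutoff to the power
        \<open>p\<close> against the decay of \<open>U\<close> in the layer, leaving a constant free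
        of \<open>r\<close>.\<close>
      also have "ennreal ((1 / r) powr p) * ennreal (\<kappa> * (5 * r) powr p * e1) = ennreal (\<kappa> * 5 powr p * e1)"
      proof -
        have "(1 / r) powr p * (\<kappa> * (5 * r) powr p * e1) = \<kappa> * (5 powr p * (1 / r * r) powr p) * e1"
          using r by (simp only: powr_mult mult_ac)
        then show ?thesis using r \<kappa> e1 by (simp add: ennreal_mult[symmetric])
      qed
      also have "ennreal A * (ennreal e1 + ennreal A * (ennreal e1 + ennreal (\<kappa> * 5 powr p * e1)))
        = ennreal (A * (e1 + A * (e1 + \<kappa> * 5 powr p * e1)))"
        using A e1 \<kappa> by (simp add: ennreal_mult[symmetric] ennreal_plus[symmetric] del: ennreal_plus)
      finally show "Lp_pow p (\<lambda>x. (w (x + h *\<^sub>R b) - w x) / h - G b x) \<le> ennreal (A * (e1 + A * (e1 + \<kappa> * 5 powr p * e1)))" .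
    qed
    have "Lp_pow p (\<lambda>x. G b x - frechet_derivative \<phi> (at x) b)
      = Lp_pow p (\<lambda>x. (mollify \<rho> (G b) x - G b x) + (frechet_derivative \<phi> (at x) b - mollify \<rho> (G b) x))"
      by (simp add: Lp_pow_def abs_minus_commute)
    also have "\<dots> \<le> ennreal A * (Lp_pow p (\<lambda>x. mollify \<rho> (G b) x - G b x)
        + Lp_pow p (\<lambda>x. frechet_derivative \<phi> (at x) b - mollify \<rho> (G b) x))"
      unfolding A_def using mGm dm p0 by (intro Lp_pow_add) auto
    also have "\<dots> \<le> ennreal A * (ennreal e1 + ennreal (A * (e1 + A * (e1 + \<kappa> * 5 powr p * e1))))"
    proof (intro mult_left_mono add_mono)
      show "Lp_pow p (\<lambda>x. mollify \<rho> (G b) x - G b x) \<le> ennreal e1"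
        using \<delta>(1)[OF b] \<epsilon>le(3)[OF b] by (intro \<delta>(2)[OF b _ \<rho>]) simp
      show "Lp_pow p (\<lambda>x. frechet_derivative \<phi> (at x) b - mollify \<rho> (G b) x)
        \<le> ennreal (A * (e1 + A * (e1 + \<kappa> * 5 powr p * e1)))"
        unfolding \<phi>_def by (rule Q)
    qed simp
    also have "\<dots> = ennreal (A * (1 + A * (1 + A * (1 + \<kappa> * 5 powr p))) * e1)"
      using A e1 \<kappa> by (simp add: ennreal_mult[symmetric] ennreal_plus[symmetric] algebra_simps del: ennreal_plus)
    also have "\<dots> \<le> ennreal e"
    proof (rule ennreal_leI)
      have "A * (1 + A * (1 + A * (1 + \<kappa> * 5 powr p))) * e1 \<le> C * e1"
        using A \<kappa> e1 by (intro mult_right_mono) (auto simp: C_def)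
      then show "A * (1 + A * (1 + A * (1 + \<kappa> * 5 powr p))) * e1 \<le> e" using C by (simp add: e1_def)
    qed
    finally show ?thesis .
  qed
  ultimately show ?thesis using test by blast
qed

end


section \<open>A weak-type Hardy inequality\<close>

text \<open>The value \<open>A / t\<close> is admissible in the infimum that defines the
  rearrangement at \<open>t\<close>.\<close>

lemma weak_L1_norm_le:
  assumes "A > 0" and le: "\<And>t. t > 0 \<Longrightarrow> emeasure lebesgue {x \<in> \<Omega>. \<bar>f x\<bar> > t} \<le> ennreal (A / t)"
  shows "weak_L1_norm \<Omega> f \<le> ennreal A"
  unfolding weak_L1_norm_def
proof (rule SUP_least)
  fix t :: real assume "t \<in> {0<..}"
  then have t: "t > 0" by simp
  have "decr_rearrangement \<Omega> f t \<le> ennreal (A / t)"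
    unfolding decr_rearrangement_def
  proof (rule INF_lower)
    show "A / t \<in> {\<xi>. 0 \<le> \<xi> \<and> emeasure lebesgue {x \<in> \<Omega>. \<bar>f x\<bar> > \<xi>} \<le> ennreal t}"
      using le[of "A / t"] assms(1) t by simp
  qed
  then have "ennreal t * decr_rearrangement \<Omega> f t \<le> ennreal t * ennreal (A / t)"
    by (rule mult_left_mono) simp
  also have "\<dots> = ennreal A" using t assms(1) by (simp add: ennreal_mult[symmetric])
  finally show "ennreal t * decr_rearrangement \<Omega> f t \<le> ennreal A" .
qed

lemma level_set_lebesgue:
  assumes "f \<in> borel_measurable (lebesgue_on \<Omega>)" "\<Omega> \<in> sets lebesgue"
  shows "{x \<in> \<Omega>. \<bar>f x\<bar> > (t::real)} \<in> sets lebesgue"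
proof -
  have "{x \<in> space (lebesgue_on \<Omega>). t < \<bar>f x\<bar>} \<in> sets (lebesgue_on \<Omega>)"
    using assms(1) by measurable
  then show ?thesis
    using assms(2) by (simp add: sets_restrict_space_iff space_restrict_space)
qed

text \<open>If \<open>s\<close> is below the measure of \<open>{\<bar>f\<bar> > t}\<close>, every
  level admissible for the rearrangement at \<open>s\<close> is at least \<open>t\<close>, so
  \<open>s * t\<close> is at most the norm. Approaching the measure from below also covers the
  infinite case.\<close>

lemma weak_L1_norm_ge:
  assumes f: "f \<in> borel_measurable (lebesgue_on \<Omega>)" "\<Omega> \<in> sets lebesgue" and t: "t > 0"
  shows "ennreal t * emeasure lebesgue {x \<in> \<Omega>. \<bar>f x\<bar> > t} \<le> weak_L1_norm \<Omega> f"
proof -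
  let ?m = "emeasure lebesgue {x \<in> \<Omega>. \<bar>f x\<bar> > t}"
  define z where "z = weak_L1_norm \<Omega> f * ennreal (1 / t)"
  have tz: "ennreal t * z = weak_L1_norm \<Omega> f"
  proof -
    have "ennreal t * z = weak_L1_norm \<Omega> f * (ennreal t * ennreal (1 / t))" by (simp add: z_def mult_ac)
    also have "ennreal t * ennreal (1 / t) = 1" using t by (simp add: ennreal_mult[symmetric])
    finally show ?thesis by simp
  qed
  have "?m \<le> z"
  proof (rule dense_le)
    fix y assume y: "y < ?m"
    show "y \<le> z"
    proof (cases "y = 0")
      case False
      obtain s where s: "y = ennreal s" "s \<ge> 0" using y by (cases y) auto
      with False have s0: "s > 0" by (cases "s = 0") auto
      have "ennreal t \<le> decr_rearrangement \<Omega> f s"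
        unfolding decr_rearrangement_def
      proof (rule INF_greatest)
        fix \<xi> assume "\<xi> \<in> {\<xi>. 0 \<le> \<xi> \<and> emeasure lebesgue {x \<in> \<Omega>. \<bar>f x\<bar> > \<xi>} \<le> ennreal s}"
        then have \<xi>: "emeasure lebesgue {x \<in> \<Omega>. \<bar>f x\<bar> > \<xi>} < ?m" using y s by auto
        have "t \<le> \<xi>"
        proof (rule ccontr)
          assume "\<not> t \<le> \<xi>"
          then have "?m \<le> emeasure lebesgue {x \<in> \<Omega>. \<bar>f x\<bar> > \<xi>}"
            by (intro emeasure_mono level_set_lebesgue f) auto
          with \<xi> show False by simp
        qed
        then show "ennreal t \<le> ennreal \<xi>" by (rule ennreal_leI)
      qed
      then have "ennreal s * ennreal t \<le> ennreal s * decr_rearrangement \<Omega> f s" by (rule mult_left_mono) simp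
      also have "\<dots> \<le> weak_L1_norm \<Omega> f"
        unfolding weak_L1_norm_def using s0 by (intro SUP_upper) auto
      finally have "ennreal t * y \<le> ennreal t * z" unfolding tz s by (subst mult.commute)
      then show ?thesis using t by (subst (asm) ennreal_mult_le_mult_iff) auto
    qed simp
  qed
  then have "ennreal t * ?m \<le> ennreal t * z" by (rule mult_left_mono) simp
  then show ?thesis by (simp add: tz)
qed

text \<open>The distance of an interior point to the complement may exceed \<open>r0\<close>. A
  larger ball contains the one of radius \<open>r0\<close>, and the portion shrinks at most by the
  volume ratio \<open>(r0 / R) ^ DIM('a)\<close>.\<close>

lemma ball_portion_extend:
  fixes \<Omega> :: "'a::euclidean_space set" and \<beta> r0 R r :: real
  assumes \<beta>: "\<beta> > 0" and r0: "r0 > 0"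
    and ball: "\<And>r. 0 < r \<Longrightarrow> r \<le> r0 \<Longrightarrow> measure lebesgue (ball z r \<inter> - \<Omega>) \<ge> \<beta> * measure lebesgue (ball z r)"
    and "open \<Omega>" and r: "0 < r" "r \<le> R" "r0 \<le> R"
  shows "measure lebesgue (ball z r \<inter> - \<Omega>) \<ge> \<beta> * (r0 / R) ^ DIM('a) * measure lebesgue (ball z r)"
proof (cases "r \<le> r0")
  case True
  have "\<beta> * (r0 / R) ^ DIM('a) * measure lebesgue (ball z r) \<le> \<beta> * 1 * measure lebesgue (ball z r)"
    using \<beta> r0 r by (intro mult_right_mono mult_left_mono power_le_one) auto
  also have "\<dots> \<le> measure lebesgue (ball z r \<inter> - \<Omega>)" using ball[OF r(1) True] by simp
  finally show ?thesis .
next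
  case False
  have [measurable]: "- \<Omega> \<in> sets borel" using assms(4) by (intro borel_closed) auto
  have fin: "ball z t \<inter> - \<Omega> \<in> lmeasurable" for t
    by (rule bounded_set_imp_lmeasurable) (auto intro: bounded_subset[of "ball z t"])
  have vol: "measure lebesgue (ball z t) = unit_ball_vol (real DIM('a)) * t ^ DIM('a)" if "t \<ge> 0" for t
    using that by (simp add: measure_completion content_ball)
  have "\<beta> * (r0 / R) ^ DIM('a) * measure lebesgue (ball z r) = \<beta> * (unit_ball_vol (real DIM('a)) * (r0 * (r / R)) ^ DIM('a))"
    unfolding vol[OF less_imp_le[OF r(1)]] by (simp add: power_mult_distrib power_divide)
  also have "\<dots> \<le> \<beta> * (unit_ball_vol (real DIM('a)) * (r0 * 1) ^ DIM('a))"
    using \<beta> r0 r unit_ball_vol_nonneg[of "real DIM('a)"]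
    by (intro mult_left_mono power_mono) (auto simp: mult_left_le)
  also have "\<dots> = \<beta> * measure lebesgue (ball z r0)" unfolding vol[OF less_imp_le[OF r0]] by simp
  also have "\<dots> \<le> measure lebesgue (ball z r0 \<inter> - \<Omega>)" using ball[OF r0] by simp
  also have "\<dots> \<le> measure lebesgue (ball z r \<inter> - \<Omega>)"
    using False fin by (intro measure_mono_fmeasurable) (auto intro: fmeasurableD)
  finally show ?thesis .
qed

text \<open>The l^1 norm of the gradient: it bounds every directional derivative of unit length and
  can be integrated one direction at a time.\<close>

definition partials_sum :: "('a::euclidean_space \<Rightarrow> real) \<Rightarrow> 'a \<Rightarrow> real" where
  "partials_sum \<phi> x = (\<Sum>b\<in>Basis. \<bar>frechet_derivative \<phi> (at x) b\<bar>)"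

lemma partials_sum_nonneg: "partials_sum \<phi> x \<ge> 0"
  unfolding partials_sum_def by (intro sum_nonneg) auto

lemma partials_sum_continuous: "Ck 1 \<phi> \<Longrightarrow> continuous_on UNIV (partials_sum \<phi>)"
  unfolding partials_sum_def[abs_def] by (intro continuous_on_sum continuous_on_rabs) auto

lemma increment_le_partials_sum:
  fixes \<phi> :: "'a::euclidean_space \<Rightarrow> real"
  assumes "Ck 1 \<phi>"
  shows "ennreal \<bar>\<phi> (x + y) - \<phi> x\<bar> \<le> ennreal (norm y) * (\<integral>\<^sup>+s. ennreal (partials_sum \<phi> (x + s *\<^sub>R y)) * indicator {0..1} s \<partial>lborel)"
proof -
  let ?D = "\<lambda>z. frechet_derivative \<phi> (at z)"
  have hd: "(\<phi> has_derivative ?D z) (at z)" for z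
    using assms by (intro Ck_has_derivative[of 0]) simp
  have cD: "continuous_on UNIV (\<lambda>s. ?D (x + s *\<^sub>R y) y)"
  proof -
    have "continuous_on UNIV (\<lambda>s. ?D (x + s *\<^sub>R y) b)" if "b \<in> Basis" for b
    proof -
      have "continuous_on UNIV (\<lambda>z. ?D z b)" using assms that by simp
      then show ?thesis by (rule continuous_on_compose2) (auto intro!: continuous_intros)
    qed
    then have "continuous_on UNIV (\<lambda>s. \<Sum>b\<in>Basis. (y \<bullet> b) * ?D (x + s *\<^sub>R y) b)"
      by (intro continuous_intros)
    moreover have "?D z y = (\<Sum>b\<in>Basis. (y \<bullet> b) * ?D z b)" for z
      by (rule has_derivative_Basis_sum[OF hd])
    ultimately show ?thesis by presburger
  qed
  have "(\<integral>s. ?D (x + s *\<^sub>R y) y * indicator {0..1} s \<partial>lborel) = \<phi> (x + 1 *\<^sub>R y) - \<phi> (x + 0 *\<^sub>R y)"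
  proof (rule integral_FTC_Icc_real)
    fix s :: real
    have 1: "((\<lambda>s. x + s *\<^sub>R y) has_derivative (\<lambda>t. t *\<^sub>R y)) (at s)" by (auto intro!: derivative_eq_intros)
    interpret bounded_linear "?D (x + s *\<^sub>R y)" using hd by (rule has_derivative_bounded_linear)
    have "((\<lambda>s. \<phi> (x + s *\<^sub>R y)) has_derivative (\<lambda>t. ?D (x + s *\<^sub>R y) (t *\<^sub>R y))) (at s)"
      by (rule has_derivative_compose[OF 1 hd])
    moreover have "(\<lambda>t. ?D (x + s *\<^sub>R y) (t *\<^sub>R y)) = (*) (?D (x + s *\<^sub>R y) y)" by (simp add: scale fun_eq_iff)
    ultimately show "((\<lambda>s. \<phi> (x + s *\<^sub>R y)) has_real_derivative ?D (x + s *\<^sub>R y) y) (at s)"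
      by (simp add: has_field_derivative_def)
    show "isCont (\<lambda>s. ?D (x + s *\<^sub>R y) y) s" using cD by (simp add: continuous_on_eq_continuous_at)
  qed simp
  then have "\<phi> (x + y) - \<phi> x = (\<integral>s. ?D (x + s *\<^sub>R y) y * indicator {0..1} s \<partial>lborel)" by simp
  also have "ennreal \<bar>\<dots>\<bar> \<le> (\<integral>\<^sup>+s. ennreal (norm (?D (x + s *\<^sub>R y) y * indicator {0..1} s)) \<partial>lborel)"
  proof (cases "integrable lborel (\<lambda>s. ?D (x + s *\<^sub>R y) y * indicator {0..1::real} s)")
    case True
    then show ?thesis using integral_norm_bound_ennreal[OF True] by simp
  next
    \<comment> \<open>If the integrand were not integrable, its Bochner integral would be 0 by
      convention and the bound would be trivial.\<close>
    case False
    then show ?thesis by (simp add: not_integrable_integral_eq)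
  qed
  also have "\<dots> \<le> (\<integral>\<^sup>+s. ennreal (norm y) * (ennreal (partials_sum \<phi> (x + s *\<^sub>R y)) * indicator {0..1} s) \<partial>lborel)"
  proof (intro nn_integral_mono)
    fix s :: real
    have "\<bar>?D (x + s *\<^sub>R y) y\<bar> = \<bar>\<Sum>b\<in>Basis. (y \<bullet> b) * ?D (x + s *\<^sub>R y) b\<bar>"
      by (simp add: has_derivative_Basis_sum[OF hd, of "x + s *\<^sub>R y" y])
    also have "\<dots> \<le> (\<Sum>b\<in>Basis. \<bar>(y \<bullet> b) * ?D (x + s *\<^sub>R y) b\<bar>)" by (rule sum_abs)
    also have "\<dots> \<le> (\<Sum>b\<in>Basis. norm y * \<bar>?D (x + s *\<^sub>R y) b\<bar>)"
      by (intro sum_mono) (auto simp: abs_mult intro!: mult_right_mono Basis_le_norm)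
    also have "\<dots> = norm y * partials_sum \<phi> (x + s *\<^sub>R y)" by (simp add: partials_sum_def sum_distrib_left)
    finally show "ennreal (norm (?D (x + s *\<^sub>R y) y * indicator {0..1} s))
      \<le> ennreal (norm y) * (ennreal (partials_sum \<phi> (x + s *\<^sub>R y)) * indicator {0..1} s)"
      by (auto simp: indicator_def ennreal_mult[symmetric] partials_sum_nonneg intro!: ennreal_leI)
  qed
  also have "\<dots> = ennreal (norm y) * (\<integral>\<^sup>+s. ennreal (partials_sum \<phi> (x + s *\<^sub>R y)) * indicator {0..1} s \<partial>lborel)"
  proof (rule nn_integral_cmult)
    have [measurable]: "partials_sum \<phi> \<in> borel_measurable borel"
      by (intro borel_measurable_continuous_onI partials_sum_continuous assms)
    show "(\<lambda>s. ennreal (partials_sum \<phi> (x + s *\<^sub>R y)) * indicator {0..1} s) \<in> borel_measurable lborel" by measurable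
  qed
  finally show ?thesis .
qed

section \<open>Averages over balls and the covering argument\<close>

lemma nn_integral_scale:
  fixes f :: "'a::euclidean_space \<Rightarrow> ennreal"
  assumes [measurable]: "f \<in> borel_measurable borel" and "s > 0"
  shows "ennreal (s ^ DIM('a)) * (\<integral>\<^sup>+y. f (x + s *\<^sub>R y) \<partial>lborel) = (\<integral>\<^sup>+y. f y \<partial>lborel)"
proof -
  have "(\<integral>\<^sup>+y. f y \<partial>lborel) = (\<integral>\<^sup>+y. f y \<partial>(density (distr lborel borel (\<lambda>y. x + s *\<^sub>R y)) (\<lambda>_. ennreal (\<bar>s\<bar> ^ DIM('a)))))"
    using lborel_affine[of s x] assms(2) by simp
  also have "\<dots> = (\<integral>\<^sup>+y. ennreal (s ^ DIM('a)) * f (x + s *\<^sub>R y) \<partial>lborel)"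
    using assms(2) by (simp add: nn_integral_density nn_integral_distr)
  finally show ?thesis by (simp add: nn_integral_cmult)
qed

text \<open>Integrate the increment bound over the \<open>y\<close> in the ball of radius
  \<open>2 * r\<close> with \<open>x + y\<close> outside \<open>\<Omega>\<close>. For fixed
  \<open>s\<close> the substitution \<open>x + s *\<^sub>R y\<close> turns this ball into one of
  radius \<open>2 * r * s\<close>; its Jacobian \<open>s ^ DIM('a)\<close> cancels the same factor
  in the assumed bound at that radius, so the estimate is uniform in \<open>s\<close>.\<close>

lemma pointwise_average_bound:
  fixes \<phi> :: "'a::euclidean_space \<Rightarrow> real" and r \<tau> m :: real
  assumes \<phi>: "Ck 1 \<phi>" and r: "r > 0" and \<tau>: "\<tau> > 0"
    and m: "ennreal m \<le> emeasure lborel (ball x (2 * r) \<inter> - \<Omega>)" "m \<ge> 0" and \<Omega>: "open \<Omega>"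
    and zero: "\<And>y. y \<notin> \<Omega> \<Longrightarrow> \<phi> y = 0"
    and le: "\<And>\<rho>. 0 < \<rho> \<Longrightarrow> \<rho> \<le> 2 * r \<Longrightarrow>
      (\<integral>\<^sup>+y. ennreal (partials_sum \<phi> y) * indicator (ball x \<rho>) y \<partial>lborel) \<le> ennreal (\<tau> * \<rho> ^ DIM('a))"
  shows "\<bar>\<phi> x\<bar> * m \<le> 2 * r * (\<tau> * (2 * r) ^ DIM('a))"
proof -
  let ?g = "\<lambda>y. ennreal (partials_sum \<phi> y)"
  have [measurable]: "partials_sum \<phi> \<in> borel_measurable borel"
    by (intro borel_measurable_continuous_onI partials_sum_continuous \<phi>)
  have [measurable]: "\<phi> \<in> borel_measurable borel"
    by (intro borel_measurable_continuous_onI Ck_continuous[OF \<phi>])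
  have [measurable]: "ball x (2 * r) \<inter> - \<Omega> \<in> sets borel" "ball (0::'a) (2 * r) \<in> sets borel"
    using \<Omega> by (auto intro!: sets.Int borel_closed)
  have inner: "(\<integral>\<^sup>+y. ?g (x + s *\<^sub>R y) * indicator (ball 0 (2 * r)) y \<partial>lborel) \<le> ennreal (\<tau> * (2 * r) ^ DIM('a))"
    if s: "0 < s" "s \<le> 1" for s
  proof -
    have "ennreal (s ^ DIM('a)) * (\<integral>\<^sup>+y. ?g (x + s *\<^sub>R y) * indicator (ball 0 (2 * r)) y \<partial>lborel)
      = ennreal (s ^ DIM('a)) * (\<integral>\<^sup>+y. ?g (x + s *\<^sub>R y) * indicator (ball x (2 * r * s)) (x + s *\<^sub>R y) \<partial>lborel)"
      using s by (intro arg_cong2[where f="(*)"] nn_integral_cong refl) (auto simp: indicator_def dist_norm field_simps)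
    also have "\<dots> = (\<integral>\<^sup>+y. ?g y * indicator (ball x (2 * r * s)) y \<partial>lborel)"
    proof (rule nn_integral_scale[where f="\<lambda>y. ?g y * indicator (ball x (2 * r * s)) y"])
      have [measurable]: "ball x (2 * r * s) \<in> sets borel" by simp
      show "(\<lambda>y. ?g y * indicator (ball x (2 * r * s)) y) \<in> borel_measurable borel" by measurable
    qed (use s in simp)
    also have "\<dots> \<le> ennreal (\<tau> * (2 * r * s) ^ DIM('a))"
      using s r by (intro le) (auto simp: mult_left_le)
    also have "\<dots> = ennreal (s ^ DIM('a)) * ennreal (\<tau> * (2 * r) ^ DIM('a))"
      using s r \<tau> by (simp add: ennreal_mult[symmetric] power_mult_distrib mult_ac)
    finally show ?thesis using s by (subst (asm) ennreal_mult_le_mult_iff) auto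
  qed
  have "ennreal (\<bar>\<phi> x\<bar> * m) \<le> ennreal \<bar>\<phi> x\<bar> * emeasure lborel (ball x (2 * r) \<inter> - \<Omega>)"
    using m by (simp add: ennreal_mult mult_left_mono)
  also have "\<dots> = (\<integral>\<^sup>+y. ennreal \<bar>\<phi> x\<bar> * indicator (ball x (2 * r) \<inter> - \<Omega>) y \<partial>lborel)"
    by (rule nn_integral_cmult_indicator[symmetric]) simp
  also have "\<dots> = (\<integral>\<^sup>+y. ennreal \<bar>\<phi> x\<bar> * indicator (ball x (2 * r) \<inter> - \<Omega>) (y + x) \<partial>lborel)"
    by (rule nn_integral_translate[where f="\<lambda>y. ennreal \<bar>\<phi> x\<bar> * indicator (ball x (2 * r) \<inter> - \<Omega>) y", symmetric]) measurable
  also have "\<dots> \<le> (\<integral>\<^sup>+y. ennreal (2 * r) * ((\<integral>\<^sup>+s. ?g (x + s *\<^sub>R y) * indicator {0..1} s \<partial>lborel) * indicator (ball 0 (2 * r)) y) \<partial>lborel)"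
  proof (intro nn_integral_mono)
    fix y :: 'a
    show "ennreal \<bar>\<phi> x\<bar> * indicator (ball x (2 * r) \<inter> - \<Omega>) (y + x)
      \<le> ennreal (2 * r) * ((\<integral>\<^sup>+s. ?g (x + s *\<^sub>R y) * indicator {0..1} s \<partial>lborel) * indicator (ball 0 (2 * r)) y)"
    proof (cases "y + x \<in> ball x (2 * r) \<inter> - \<Omega>")
      case True
      then have y: "norm y < 2 * r" "x + y \<notin> \<Omega>" by (auto simp: dist_norm add.commute)
      have "ennreal \<bar>\<phi> x\<bar> \<le> ennreal (norm y) * (\<integral>\<^sup>+s. ?g (x + s *\<^sub>R y) * indicator {0..1} s \<partial>lborel)"
        using increment_le_partials_sum[OF \<phi>, of x y] zero[OF y(2)] by simp
      also have "\<dots> \<le> ennreal (2 * r) * (\<integral>\<^sup>+s. ?g (x + s *\<^sub>R y) * indicator {0..1} s \<partial>lborel)"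
        using y by (intro mult_right_mono ennreal_leI) auto
      finally show ?thesis using True y by simp
    qed simp
  qed
  also have "\<dots> = ennreal (2 * r) * (\<integral>\<^sup>+y. (\<integral>\<^sup>+s. ?g (x + s *\<^sub>R y) * indicator {0..1} s \<partial>lborel) * indicator (ball 0 (2 * r)) y \<partial>lborel)"
    by (rule nn_integral_cmult) measurable
  also have "(\<integral>\<^sup>+y. (\<integral>\<^sup>+s. ?g (x + s *\<^sub>R y) * indicator {0..1} s \<partial>lborel) * indicator (ball 0 (2 * r)) y \<partial>lborel)
    = (\<integral>\<^sup>+y. (\<integral>\<^sup>+s. ?g (x + s *\<^sub>R y) * indicator (ball 0 (2 * r)) y * indicator {0..1} s \<partial>lborel) \<partial>lborel)"
    by (intro nn_integral_cong) (subst nn_integral_multc[symmetric], measurable, auto intro!: nn_integral_cong simp: mult_ac)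
  also have "\<dots> = (\<integral>\<^sup>+s. (\<integral>\<^sup>+y. ?g (x + s *\<^sub>R y) * indicator (ball 0 (2 * r)) y * indicator {0..1} s \<partial>lborel) \<partial>lborel)"
    by (rule lborel_pair.Fubini'[symmetric]) measurable
  also have "\<dots> \<le> (\<integral>\<^sup>+s. ennreal (\<tau> * (2 * r) ^ DIM('a)) * indicator {0..1::real} s \<partial>lborel)"
  proof (rule nn_integral_mono_AE)
    \<comment> \<open>The scaling argument needs \<open>s > 0\<close>; the single point 0 is
      null.\<close>
    have "AE s in lborel. s \<noteq> (0::real)" by (rule AE_lborel_singleton)
    then show "AE s in lborel. (\<integral>\<^sup>+y. ?g (x + s *\<^sub>R y) * indicator (ball 0 (2 * r)) y * indicator {0..1} s \<partial>lborel)
      \<le> ennreal (\<tau> * (2 * r) ^ DIM('a)) * indicator {0..1::real} s"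
    proof (rule eventually_mono)
      fix s :: real assume "s \<noteq> 0"
      then show "(\<integral>\<^sup>+y. ?g (x + s *\<^sub>R y) * indicator (ball 0 (2 * r)) y * indicator {0..1} s \<partial>lborel)
        \<le> ennreal (\<tau> * (2 * r) ^ DIM('a)) * indicator {0..1::real} s"
        using inner[of s] by (cases "s \<in> {0..1}") auto
    qed
  qed
  also have "\<dots> = ennreal (\<tau> * (2 * r) ^ DIM('a))" by (subst nn_integral_cmult_indicator) auto
  finally have "ennreal (\<bar>\<phi> x\<bar> * m) \<le> ennreal (2 * r) * ennreal (\<tau> * (2 * r) ^ DIM('a))"
    by (simp add: mult_left_mono)
  then show ?thesis using r \<tau> by (simp add: ennreal_mult[symmetric])
qed

text \<open>Vitali selects countably many disjoint balls whose fivefold enlargements cover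
  \<open>S\<close>; the integrals of \<open>g\<close> over disjoint balls add up to at most the
  total. Bounded radii are a condition of the covering lemma.\<close>

lemma Vitali_weak_type:
  fixes g :: "'a::euclidean_space \<Rightarrow> ennreal" and \<rho> :: "'a \<Rightarrow> real"
  assumes [measurable]: "g \<in> borel_measurable borel" "S \<in> sets borel" and \<tau>: "\<tau> > 0"
    and \<rho>: "\<And>x. x \<in> S \<Longrightarrow> 0 < \<rho> x \<and> \<rho> x \<le> B"
    and big: "\<And>x. x \<in> S \<Longrightarrow> ennreal (\<tau> * \<rho> x ^ DIM('a)) \<le> (\<integral>\<^sup>+y. g y * indicator (ball x (\<rho> x)) y \<partial>lborel)"
  shows "emeasure lborel S \<le> ennreal (5 ^ DIM('a) * unit_ball_vol (real DIM('a)) / \<tau>) * (\<integral>\<^sup>+y. g y \<partial>lborel)"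
proof -
  have cov: "S \<subseteq> (\<Union>x\<in>S. ball x (\<rho> x))" using \<rho> by force
  obtain C where C: "countable C" "C \<subseteq> S"
    "pairwise (\<lambda>i j. disjnt (ball i (\<rho> i)) (ball j (\<rho> j))) C" "S \<subseteq> (\<Union>i\<in>C. ball i (5 * \<rho> i))"
    by (rule Vitali_covering_lemma_balls[OF cov \<rho>])
  let ?c = "5 ^ DIM('a) * unit_ball_vol (real DIM('a)) / \<tau>"
  have c: "?c \<ge> 0" using \<tau> by simp
  have "emeasure lborel S = (\<integral>\<^sup>+x. indicator S x \<partial>lborel)" by simp
  also have "\<dots> \<le> (\<integral>\<^sup>+x. (\<integral>\<^sup>+i. indicator (ball i (5 * \<rho> i)) x \<partial>count_space C) \<partial>lborel)"
  proof (intro nn_integral_mono)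
    fix x
    show "indicator S x \<le> (\<integral>\<^sup>+i. indicator (ball i (5 * \<rho> i)) x \<partial>count_space C)"
    proof (cases "x \<in> S")
      case True
      then obtain i where i: "i \<in> C" "x \<in> ball i (5 * \<rho> i)" using C(4) by blast
      have "indicator (ball i (5 * \<rho> i)) x \<le> (\<integral>\<^sup>+i. indicator (ball i (5 * \<rho> i)) x \<partial>count_space C)"
        by (rule nn_integral_ge_point[OF i(1)])
      with i True show ?thesis by simp
    qed simp
  qed
  also have "\<dots> = (\<integral>\<^sup>+i. (\<integral>\<^sup>+x. indicator (ball i (5 * \<rho> i)) x \<partial>lborel) \<partial>count_space C)"
    using C(1) by (intro nn_integral_count_space_nn_integral) (auto intro!: borel_measurable_indicator)
  also have "\<dots> \<le> (\<integral>\<^sup>+i. ennreal ?c * (\<integral>\<^sup>+y. g y * indicator (ball i (\<rho> i)) y \<partial>lborel) \<partial>count_space C)"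
  proof (intro nn_integral_mono)
    fix i assume "i \<in> space (count_space C)"
    then have i: "i \<in> S" using C(2) by auto
    have "(\<integral>\<^sup>+x. indicator (ball i (5 * \<rho> i)) x \<partial>lborel) = ennreal (unit_ball_vol (real DIM('a)) * (5 * \<rho> i) ^ DIM('a))"
      using \<rho>[OF i] by (simp add: emeasure_ball)
    also have "\<dots> = ennreal ?c * ennreal (\<tau> * \<rho> i ^ DIM('a))"
      using \<rho>[OF i] \<tau> by (simp add: ennreal_mult[symmetric] power_mult_distrib)
    also have "\<dots> \<le> ennreal ?c * (\<integral>\<^sup>+y. g y * indicator (ball i (\<rho> i)) y \<partial>lborel)"
      by (intro mult_left_mono big i) simp
    finally show "(\<integral>\<^sup>+x. indicator (ball i (5 * \<rho> i)) x \<partial>lborel) \<le> ennreal ?c * (\<integral>\<^sup>+y. g y * indicator (ball i (\<rho> i)) y \<partial>lborel)" .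
  qed
  also have "\<dots> = ennreal ?c * (\<integral>\<^sup>+i. emeasure (density lborel g) (ball i (\<rho> i)) \<partial>count_space C)"
    by (subst nn_integral_cmult) (auto simp: emeasure_density)
  also have "(\<integral>\<^sup>+i. emeasure (density lborel g) (ball i (\<rho> i)) \<partial>count_space C) = emeasure (density lborel g) (\<Union>i\<in>C. ball i (\<rho> i))"
    using C(1,3) by (intro emeasure_UN_countable[symmetric]) (auto simp: disjoint_family_on_def pairwise_def disjnt_def)
  also have "\<dots> \<le> (\<integral>\<^sup>+y. g y \<partial>lborel)"
  proof -
    have "(\<Union>i\<in>C. ball i (\<rho> i)) \<in> sets borel" using C(1) by (intro sets.countable_UN') auto
    then show ?thesis by (subst emeasure_density) (auto intro!: nn_integral_mono simp: indicator_def)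
  qed
  finally show ?thesis by (simp add: mult_left_mono)
qed

text \<open>The ball at a steep point is found by contradiction: if every radius up to
  \<open>2 * R\<close> had gradient integral below \<open>\<tau> * \<rho> ^ DIM('a)\<close>, then
  \<open>pointwise_average_bound\<close> would force \<open>\<bar>\<phi> x\<bar>\<close> below
  \<open>t\<close> times the distance.\<close>

lemma weak_type_test_functions:
  fixes \<Omega> :: "'a::euclidean_space set"
  assumes \<Omega>: "open \<Omega>" "bounded \<Omega>" and \<beta>: "\<beta> > 0" and r0: "r0 > 0"
    and ball: "\<And>z r. z \<in> frontier \<Omega> \<Longrightarrow> 0 < r \<Longrightarrow> r \<le> r0 \<Longrightarrow> measure lebesgue (ball z r \<inter> - \<Omega>) \<ge> \<beta> * measure lebesgue (ball z r)"
  obtains C where "C > 0" "\<And>\<phi> t. \<phi> \<in> test_functions \<Omega> \<Longrightarrow> t > 0 \<Longrightarrow>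
    emeasure lborel (steep \<Omega> \<phi> t) \<le> ennreal (C / t) * (\<integral>\<^sup>+y. ennreal (partials_sum \<phi> y) \<partial>lborel)"
proof -
  obtain R1 where R1: "R1 > 0" "\<And>x. x \<in> \<Omega> \<Longrightarrow> norm x \<le> R1"
    using bounded_pos[of \<Omega>] \<Omega>(2) by auto
  obtain z0 where z0: "z0 \<in> - \<Omega>" using \<Omega>(2) not_bounded_UNIV by (metis ComplI UNIV_I subsetI top.extremum_uniqueI)
  \<comment> \<open>A common bound for \<open>r0\<close> and for twice the distance to the
    complement on \<open>\<Omega>\<close>, so that the outer portion is available at every radius
    used.\<close>
  define R where "R = max r0 (2 * (R1 + norm z0))"
  have dR: "2 * infdist x (- \<Omega>) \<le> R" if "x \<in> \<Omega>" for x
  proof -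
    have "infdist x (- \<Omega>) \<le> dist x z0" using z0 by (rule infdist_le)
    also have "\<dots> \<le> norm x + norm z0" unfolding dist_norm by (rule norm_triangle_ineq4)
    finally show ?thesis using R1(2)[OF that] by (simp add: R_def)
  qed
  have R: "R > 0" "r0 \<le> R" using r0 by (auto simp: R_def)
  define \<omega> where "\<omega> = unit_ball_vol (real DIM('a))"
  have \<omega>: "\<omega> > 0" by (simp add: \<omega>_def)
  define \<beta>' where "\<beta>' = \<beta> * (r0 / R) ^ DIM('a)"
  have \<beta>': "\<beta>' > 0" using \<beta> r0 R by (simp add: \<beta>'_def)
  \<comment> \<open>What remains of the constant \<open>2 * r * (2 * r) ^ DIM('a)\<close> after
    division by the outer portion \<open>\<beta>' * (\<omega> * r ^ DIM('a))\<close>, up to one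
    factor \<open>r\<close>.\<close>
  define K where "K = 2 * 2 ^ DIM('a) / (\<beta>' * \<omega>)"
  have K: "K > 0" using \<beta>' \<omega> by (simp add: K_def)
  define C where "C = 5 ^ DIM('a) * \<omega> * (4 * K)"
  show thesis
  proof (rule that[of C])
    show "C > 0" using K \<omega> by (simp add: C_def)
    fix \<phi> :: "'a \<Rightarrow> real" and t :: real assume \<phi>: "\<phi> \<in> test_functions \<Omega>" and t: "t > 0"
    have Ck: "Ck k \<phi>" for k using \<phi> by (simp add: test_functions_def)
    have [measurable]: "\<phi> \<in> borel_measurable borel" "partials_sum \<phi> \<in> borel_measurable borel"
      using Ck_continuous[OF Ck] partials_sum_continuous[OF Ck] by (auto intro: borel_measurable_continuous_onI)
    \<comment> \<open>With \<open>r\<close> twice the distance, the resulting bound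
      \<open>K * \<tau> * r\<close> is \<open>t / 2\<close> times the distance, against the assumed
      lower bound with factor \<open>t\<close>.\<close>
    define \<tau> where "\<tau> = t / (4 * K)"
    have \<tau>: "\<tau> > 0" using t K by (simp add: \<tau>_def)
    have "\<exists>\<rho>. 0 < \<rho> \<and> \<rho> \<le> 2 * R \<and> ennreal (\<tau> * \<rho> ^ DIM('a)) \<le> (\<integral>\<^sup>+y. ennreal (partials_sum \<phi> y) * indicator (ball x \<rho>) y \<partial>lborel)"
      if x: "x \<in> steep \<Omega> \<phi> t" for x
    proof (rule ccontr)
      assume no: "\<not> ?thesis"
      have x\<Omega>: "x \<in> \<Omega>" and big: "\<bar>\<phi> x\<bar> > t * infdist x (- \<Omega>)" using x by (auto simp: steep_def)
      define r where "r = 2 * infdist x (- \<Omega>)"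
      have d: "infdist x (- \<Omega>) > 0" by (rule infdist_Compl_pos[OF \<Omega> x\<Omega>])
      then have r: "r > 0" "r \<le> R" "infdist x (- \<Omega>) < r" using dR[OF x\<Omega>] by (auto simp: r_def)
      obtain z where z: "z \<in> frontier \<Omega>" "dist x z < r" using frontier_point_near[OF \<Omega> x\<Omega> r(3)] by blast
      define m where "m = \<beta>' * (\<omega> * r ^ DIM('a))"
      have m: "m > 0" using \<beta>' \<omega> r by (simp add: m_def)
      have em: "ennreal m \<le> emeasure lborel (ball x (2 * r) \<inter> - \<Omega>)"
      proof -
        have [measurable]: "ball y s \<inter> - \<Omega> \<in> sets borel" for y s using \<Omega> by (auto intro!: sets.Int borel_closed)
        have fin: "emeasure lborel (ball z r \<inter> - \<Omega>) < \<infinity>" by (intro emeasure_bounded_finite) auto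
        have "m \<le> measure lebesgue (ball z r \<inter> - \<Omega>)"
          using ball_portion_extend[OF \<beta> r0 ball[OF z(1)] \<Omega>(1) r(1,2) R(2)] r
          by (simp add: m_def \<beta>'_def \<omega>_def measure_completion content_ball)
        then have "ennreal m \<le> emeasure lborel (ball z r \<inter> - \<Omega>)"
          using fin by (subst emeasure_eq_ennreal_measure) (auto simp: measure_completion intro: ennreal_leI)
        also have "\<dots> \<le> emeasure lborel (ball x (2 * r) \<inter> - \<Omega>)"
        proof (intro emeasure_mono)
          show "ball z r \<inter> - \<Omega> \<subseteq> ball x (2 * r) \<inter> - \<Omega>"
          proof
            fix y assume "y \<in> ball z r \<inter> - \<Omega>"
            then show "y \<in> ball x (2 * r) \<inter> - \<Omega>" using z(2) dist_triangle[of x y z] by auto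
          qed
        qed simp
        finally show ?thesis .
      qed
      have zero: "\<phi> y = 0" if "y \<notin> \<Omega>" for y
        using \<phi> that closure_subset[of "{x. \<phi> x \<noteq> 0}"] by (auto simp: test_functions_def)
      have "\<bar>\<phi> x\<bar> * m \<le> 2 * r * (\<tau> * (2 * r) ^ DIM('a))"
      proof (rule pointwise_average_bound[OF Ck r(1) \<tau> em _ \<Omega>(1) zero])
        fix \<rho> assume "0 < \<rho>" "\<rho> \<le> 2 * r"
        then show "(\<integral>\<^sup>+y. ennreal (partials_sum \<phi> y) * indicator (ball x \<rho>) y \<partial>lborel) \<le> ennreal (\<tau> * \<rho> ^ DIM('a))"
          using no r(2) by (force simp: not_le)
      qed (use m in auto)
      also have "\<dots> = (K * \<tau> * r) * m"
        using \<beta>' \<omega> r by (simp add: K_def m_def power_mult_distrib)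
      finally have "\<bar>\<phi> x\<bar> \<le> K * \<tau> * r" using m by simp
      also have "\<dots> = t * infdist x (- \<Omega>) / 2" using K by (simp add: \<tau>_def r_def)
      finally show False using big d t by (smt (verit) mult_pos_pos field_sum_of_halves)
    qed
    then obtain \<rho> where \<rho>: "\<And>x. x \<in> steep \<Omega> \<phi> t \<Longrightarrow> 0 < \<rho> x \<and> \<rho> x \<le> 2 * R"
      "\<And>x. x \<in> steep \<Omega> \<phi> t \<Longrightarrow> ennreal (\<tau> * \<rho> x ^ DIM('a)) \<le> (\<integral>\<^sup>+y. ennreal (partials_sum \<phi> y) * indicator (ball x (\<rho> x)) y \<partial>lborel)"
      by metis
    have "emeasure lborel (steep \<Omega> \<phi> t) \<le> ennreal (5 ^ DIM('a) * unit_ball_vol (real DIM('a)) / \<tau>) * (\<integral>\<^sup>+y. ennreal (partials_sum \<phi> y) \<partial>lborel)"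
      using \<tau> \<rho> \<Omega>(1) by (intro Vitali_weak_type[where \<rho>=\<rho> and B="2 * R"] steep_sets) auto
    also have "5 ^ DIM('a) * unit_ball_vol (real DIM('a)) / \<tau> = C / t"
      using K t by (simp add: C_def \<tau>_def \<omega>_def field_simps)
    finally show "emeasure lborel (steep \<Omega> \<phi> t) \<le> ennreal (C / t) * (\<integral>\<^sup>+y. ennreal (partials_sum \<phi> y) \<partial>lborel)" .
  qed
qed

text \<open>L^1 closeness controls \<open>W - \<psi>\<close> above a fixed threshold only, whereas
  the steep set compares with the distance, which has no positive lower bound. Restricting to
  distance above \<eta> gives such a threshold, and Chebyshev's error is made arbitrarily small
  before \<eta> tends to 0. Halving \<open>t\<close> accounts for the factor 2.\<close>

lemma steep_approximation:
  fixes W :: "'a::euclidean_space \<Rightarrow> real" and C D t :: real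
  assumes \<Omega>: "open \<Omega>" "bounded \<Omega>" and W [measurable]: "W \<in> borel_measurable borel"
    and C: "C > 0" "\<And>\<phi> t. \<phi> \<in> test_functions \<Omega> \<Longrightarrow> t > 0 \<Longrightarrow>
      emeasure lborel (steep \<Omega> \<phi> t) \<le> ennreal (C / t) * (\<integral>\<^sup>+y. ennreal (partials_sum \<phi> y) \<partial>lborel)"
    and approx: "\<And>\<delta>. \<delta> > 0 \<Longrightarrow> \<exists>\<psi>\<in>test_functions \<Omega>. Lp_pow 1 (\<lambda>x. W x - \<psi> x) \<le> ennreal \<delta> \<and>
      (\<integral>\<^sup>+y. ennreal (partials_sum \<psi> y) \<partial>lborel) \<le> ennreal D"
    and D: "D \<ge> 0" and t: "t > 0"
  shows "emeasure lborel (steep \<Omega> W t) \<le> ennreal (2 * C * D / t)"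
proof -
  have st [measurable]: "steep \<Omega> W t \<in> sets borel" using \<Omega>(1) W by (rule steep_sets)
  let ?F = "\<lambda>\<eta>. {x \<in> steep \<Omega> W t. infdist x (- \<Omega>) > \<eta>}"
  have Fs [measurable]: "?F \<eta> \<in> sets borel" for \<eta>
  proof -
    have "{x. infdist x (- \<Omega>) > \<eta>} \<in> sets borel" by measurable
    moreover have "?F \<eta> = steep \<Omega> W t \<inter> {x. infdist x (- \<Omega>) > \<eta>}" by blast
    ultimately show ?thesis using st by simp
  qed
  have far: "emeasure lborel (?F \<eta>) \<le> ennreal (2 * C * D / t)" if \<eta>: "\<eta> > 0" for \<eta>
  proof (rule ennreal_le_epsilon)
    fix e :: real assume e: "e > 0"
    \<comment> \<open>At distance above \<open>\<eta>\<close>, half of \<open>t\<close> times the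
      distance exceeds \<open>a\<close>; so either \<open>W - \<psi>\<close> exceeds
      \<open>a\<close>, or \<open>\<psi>\<close> is steep at level \<open>t / 2\<close>.\<close>
    define a where "a = t * \<eta> / 2"
    have a: "a > 0" using t \<eta> by (simp add: a_def)
    obtain \<psi> where \<psi>: "\<psi> \<in> test_functions \<Omega>" "Lp_pow 1 (\<lambda>x. W x - \<psi> x) \<le> ennreal (a * e)"
      "(\<integral>\<^sup>+y. ennreal (partials_sum \<psi> y) \<partial>lborel) \<le> ennreal D"
      using approx[of "a * e"] a e by auto
    have Ck: "Ck 0 \<psi>" using \<psi>(1) by (simp add: test_functions_def)
    have [measurable]: "\<psi> \<in> borel_measurable borel"
      by (intro borel_measurable_continuous_onI Ck_continuous[OF Ck])
    let ?S = "{x. \<bar>W x - \<psi> x\<bar> > a}"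
    have S [measurable]: "?S \<in> sets borel" by measurable
    have st2: "steep \<Omega> \<psi> (t / 2) \<in> sets borel" using \<Omega>(1) by (intro steep_sets) auto
    have "?F \<eta> \<subseteq> ?S \<union> steep \<Omega> \<psi> (t / 2)"
    proof
      fix x assume x: "x \<in> ?F \<eta>"
      then have 1: "x \<in> \<Omega>" "\<bar>W x\<bar> > t * infdist x (- \<Omega>)" "infdist x (- \<Omega>) > \<eta>" by (auto simp: steep_def)
      then have "a \<le> t / 2 * infdist x (- \<Omega>)" using t by (simp add: a_def)
      then have "\<bar>W x - \<psi> x\<bar> > a \<or> \<bar>\<psi> x\<bar> > t / 2 * infdist x (- \<Omega>)" using 1(2) by (auto simp: abs_if split: if_splits)
      with 1 show "x \<in> ?S \<union> steep \<Omega> \<psi> (t / 2)" by (auto simp: steep_def)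
    qed
    then have "emeasure lborel (?F \<eta>) \<le> emeasure lborel (?S \<union> steep \<Omega> \<psi> (t / 2))"
      using st2 by (intro emeasure_mono) auto
    also have "\<dots> \<le> emeasure lborel ?S + emeasure lborel (steep \<Omega> \<psi> (t / 2))"
      using st2 by (intro emeasure_subadditive) auto
    also have "\<dots> \<le> ennreal e + ennreal (2 * C * D / t)"
    proof (intro add_mono)
      have "ennreal a * emeasure lborel ?S = (\<integral>\<^sup>+x. ennreal a * indicator ?S x \<partial>lborel)"
        by (rule nn_integral_cmult_indicator[symmetric]) simp
      also have "\<dots> \<le> Lp_pow 1 (\<lambda>x. W x - \<psi> x)"
        unfolding Lp_pow_1 by (intro nn_integral_mono) (auto simp: indicator_def intro!: ennreal_leI)
      also have "\<dots> \<le> ennreal a * ennreal e" using \<psi>(2) a e by (simp add: ennreal_mult)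
      finally show "emeasure lborel ?S \<le> ennreal e" using a by (subst (asm) ennreal_mult_le_mult_iff) auto
      have "emeasure lborel (steep \<Omega> \<psi> (t / 2)) \<le> ennreal (C / (t / 2)) * (\<integral>\<^sup>+y. ennreal (partials_sum \<psi> y) \<partial>lborel)"
        using t by (intro C(2) \<psi>(1)) auto
      also have "\<dots> \<le> ennreal (C / (t / 2)) * ennreal D" by (intro mult_left_mono \<psi>(3)) auto
      also have "\<dots> = ennreal (2 * C * D / t)" using C(1) D t by (simp add: ennreal_mult[symmetric] mult_ac)
      finally show "emeasure lborel (steep \<Omega> \<psi> (t / 2)) \<le> ennreal (2 * C * D / t)" .
    qed
    finally show "emeasure lborel (?F \<eta>) \<le> ennreal (2 * C * D / t) + ennreal e" by (simp add: add.commute)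
  qed
  \<comment> \<open>The bound is free of \<open>\<eta>\<close>, so it passes to the increasing
    union, which is the whole steep set because the distance is positive in
    \<open>\<Omega>\<close>.\<close>
  have "emeasure lborel (\<Union>n. ?F (1 / real (Suc n))) = (SUP n. emeasure lborel (?F (1 / real (Suc n))))"
  proof (rule SUP_emeasure_incseq[symmetric])
    show "incseq (\<lambda>n. ?F (1 / real (Suc n)))"
    proof (intro monoI subsetI)
      fix m n :: nat and x assume "m \<le> n" and x: "x \<in> ?F (1 / real (Suc m))"
      then have "1 / real (Suc n) \<le> 1 / real (Suc m)" by (simp add: frac_le)
      with x show "x \<in> ?F (1 / real (Suc n))" by auto
    qed
  qed (use Fs in auto)
  also have "\<dots> \<le> ennreal (2 * C * D / t)" by (intro SUP_least far) simp
  also have "(\<Union>n. ?F (1 / real (Suc n))) = steep \<Omega> W t"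
  proof (intro equalityI subsetI)
    fix x assume x: "x \<in> steep \<Omega> W t"
    then have "infdist x (- \<Omega>) > 0" by (intro infdist_Compl_pos \<Omega>) (simp add: steep_def)
    then obtain n where "1 / real (Suc n) < infdist x (- \<Omega>)"
      using nat_approx_posE by blast
    with x show "x \<in> (\<Union>n. ?F (1 / real (Suc n)))" by blast
  qed auto
  finally show ?thesis .
qed

text \<open>The support has positive distance \<open>d\<close> from the complement and
  \<open>\<phi>\<close> is bounded by some \<open>B\<close>; the added 1 in
  \<open>(B + 1) / d\<close> keeps the factor positive.\<close>

lemma test_function_le_infdist:
  fixes \<Omega> :: "'a::euclidean_space set"
  assumes "\<phi> \<in> test_functions \<Omega>" "open \<Omega>" "bounded \<Omega>"
  obtains K where "K > 0" "\<And>x. \<bar>\<phi> x\<bar> \<le> K * infdist x (- \<Omega>)"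
proof -
  define S where "S = closure {x. \<phi> x \<noteq> 0}"
  have S: "compact S" "S \<subseteq> \<Omega>" and Ck: "Ck 0 \<phi>" using assms(1) by (auto simp: S_def test_functions_def)
  have \<phi>S: "\<phi> x = 0" if "x \<notin> S" for x using that closure_subset[of "{x. \<phi> x \<noteq> 0}"] by (auto simp: S_def)
  have ne: "- \<Omega> \<noteq> {}" using assms(3) not_bounded_UNIV by (metis Compl_empty_eq double_complement)
  have "\<exists>d>0. \<forall>x\<in>S. \<forall>y\<in>- \<Omega>. d \<le> dist x y"
    using S assms(2) by (intro separate_compact_closed) auto
  then obtain d where d: "d > 0" "\<And>x y. x \<in> S \<Longrightarrow> y \<in> - \<Omega> \<Longrightarrow> d \<le> dist x y" by metis
  have id: "d \<le> infdist x (- \<Omega>)" if "x \<in> S" for x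
    unfolding infdist_notempty[OF ne] using d(2)[OF that] by (intro cINF_greatest ne) auto
  obtain R where R: "\<And>x. norm x > R \<Longrightarrow> \<phi> x = 0" using test_functions_bounded_support[OF assms(1)] by blast
  obtain B where B: "B \<ge> 0" "\<And>x. \<bar>\<phi> x\<bar> \<le> B"
    using bounded_continuous_bounded_support[OF Ck_continuous[OF Ck] R] by blast
  show thesis
  proof (rule that[of "(B + 1) / d"])
    show "(B + 1) / d > 0" using B d by simp
    show "\<bar>\<phi> x\<bar> \<le> (B + 1) / d * infdist x (- \<Omega>)" for x
    proof (cases "x \<in> S")
      case True
      have "\<bar>\<phi> x\<bar> \<le> (B + 1) / d * d" using B(2)[of x] d(1) by simp
      also have "\<dots> \<le> (B + 1) / d * infdist x (- \<Omega>)" using id[OF True] B d by (intro mult_left_mono) auto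
      finally show ?thesis .
    next
      case False
      then show ?thesis using \<phi>S B d infdist_nonneg[of x "- \<Omega>"] by simp
    qed
  qed
qed

text \<open>Split \<open>U\<close> into \<open>W = U - \<phi>\<close> and \<open>\<phi>\<close> and
  halve the level. The steep set of \<open>W\<close> contributes \<open>e / t\<close> for every
  \<open>E\<close>, while the bounded quotient of \<open>\<phi>\<close> contributes a multiple of
  the measure of \<open>E\<close>. Measures of \<open>E k\<close> tend to 0 by dominated
  convergence, and \<open>e\<close> is arbitrary.\<close>

lemma weak_L1_a_if_approximable:
  fixes \<Omega> :: "'a::euclidean_space set" and U :: "'a \<Rightarrow> real" and G :: "'a \<Rightarrow> 'a \<Rightarrow> real"
  assumes \<Omega>: "open \<Omega>" "bounded \<Omega>" and U [measurable]: "U \<in> borel_measurable borel"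
    and G: "\<And>b. b \<in> Basis \<Longrightarrow> G b \<in> borel_measurable borel"
    and C: "C > 0" "\<And>\<phi> t. \<phi> \<in> test_functions \<Omega> \<Longrightarrow> t > 0 \<Longrightarrow>
      emeasure lborel (steep \<Omega> \<phi> t) \<le> ennreal (C / t) * (\<integral>\<^sup>+y. ennreal (partials_sum \<phi> y) \<partial>lborel)"
    and approx: "\<And>e. e > 0 \<Longrightarrow> \<exists>\<phi>\<in>test_functions \<Omega>. Lp_pow 1 (\<lambda>x. U x - \<phi> x) \<le> ennreal e \<and>
      (\<forall>b\<in>Basis. Lp_pow 1 (\<lambda>x. G b x - frechet_derivative \<phi> (at x) b) \<le> ennreal e)"
    and f: "f \<in> borel_measurable (lebesgue_on \<Omega>)"
    and fU: "AE x in lebesgue. x \<in> \<Omega> \<longrightarrow> f x = U x / infdist x (- \<Omega>)"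
  shows "f \<in> weak_L1_a \<Omega>"
proof -
  have \<Omega>m: "\<Omega> \<in> sets lebesgue" "\<Omega> \<in> sets borel" using \<Omega> by auto
  have \<Omega>fin: "emeasure lebesgue \<Omega> < \<infinity>" using emeasure_bounded_finite[OF \<Omega>(2)] \<Omega>m by simp
  have key: "\<exists>K>0. \<forall>E\<in>sets lebesgue. E \<subseteq> \<Omega> \<longrightarrow> (\<forall>t>0. emeasure lebesgue {x \<in> \<Omega>. \<bar>f x * indicator E x\<bar> > t}
      \<le> ennreal ((e + K * measure lebesgue E) / t))" if e: "e > 0" for e :: real
  proof -
    \<comment> \<open>The weak-type bound at level \<open>t / 2\<close> with gradient mass
      \<open>4 * DIM('a) * e'\<close> is \<open>16 * C * DIM('a) * e' / t\<close>, which is to be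
      \<open>e / t\<close>.\<close>
    define e' where "e' = e / (16 * C * DIM('a))"
    have e': "e' > 0" using e C by (simp add: e'_def)
    obtain \<phi> where \<phi>: "\<phi> \<in> test_functions \<Omega>"
      "\<And>b. b \<in> Basis \<Longrightarrow> Lp_pow 1 (\<lambda>x. G b x - frechet_derivative \<phi> (at x) b) \<le> ennreal e'"
      using approx[OF e'] by blast
    have Ck\<phi>: "Ck k \<phi>" for k using \<phi>(1) by (simp add: test_functions_def)
    have dm: "(\<lambda>x. frechet_derivative \<psi> (at x) b) \<in> borel_measurable borel" if "Ck 1 \<psi>" "b \<in> Basis" for \<psi> :: "'a \<Rightarrow> real" and b
      using that by (intro borel_measurable_continuous_onI) simp
    have [measurable]: "\<phi> \<in> borel_measurable borel"
      by (intro borel_measurable_continuous_onI Ck_continuous[OF Ck\<phi>[of 0]])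
    define W where "W x = U x - \<phi> x" for x
    have Wm [measurable]: "W \<in> borel_measurable borel" unfolding W_def[abs_def] by measurable
    have st: "emeasure lborel (steep \<Omega> W t) \<le> ennreal (2 * C * (4 * DIM('a) * e') / t)" if t: "t > 0" for t
    proof (rule steep_approximation[OF \<Omega> Wm C(1) C(2) _ _ t])
      fix \<delta> :: real assume \<delta>: "\<delta> > 0"
      obtain \<zeta> where \<zeta>: "\<zeta> \<in> test_functions \<Omega>" "Lp_pow 1 (\<lambda>x. U x - \<zeta> x) \<le> ennreal (min \<delta> e')"
        "\<And>b. b \<in> Basis \<Longrightarrow> Lp_pow 1 (\<lambda>x. G b x - frechet_derivative \<zeta> (at x) b) \<le> ennreal (min \<delta> e')"
        using approx[of "min \<delta> e'"] \<delta> e' by auto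
      have Ck\<zeta>: "Ck k \<zeta>" for k using \<zeta>(1) by (simp add: test_functions_def)
      \<comment> \<open>Approximants of \<open>W\<close>: as \<open>\<zeta>\<close> approaches
        \<open>U\<close>, the L^1 norms of the partial derivatives of \<open>\<psi>\<close> stay
        below \<open>4 * e'\<close>, since those of \<open>\<zeta>\<close> and \<open>\<phi>\<close>
        are both within \<open>e'\<close> of \<open>G\<close>.\<close>
      define \<psi> where "\<psi> x = \<zeta> x - \<phi> x" for x
      have Ck\<psi>: "Ck k \<psi>" for k unfolding \<psi>_def[abs_def] by (intro Ck_diff Ck\<zeta> Ck\<phi>)
      have "\<psi> \<in> test_functions \<Omega>"
      proof (rule test_functionsI[OF Ck\<psi>])
        show "compact (closure {x. \<zeta> x \<noteq> 0} \<union> closure {x. \<phi> x \<noteq> 0})" "closure {x. \<zeta> x \<noteq> 0} \<union> closure {x. \<phi> x \<noteq> 0} \<subseteq> \<Omega>"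
          using \<zeta>(1) \<phi>(1) by (auto simp: test_functions_def)
        show "\<psi> x = 0" if "x \<notin> closure {x. \<zeta> x \<noteq> 0} \<union> closure {x. \<phi> x \<noteq> 0}" for x
        proof -
          have "\<zeta> x = 0" "\<phi> x = 0"
            using that closure_subset[of "{x. \<phi> x \<noteq> 0}"] closure_subset[of "{x. \<zeta> x \<noteq> 0}"] by blast+
          then show ?thesis by (simp add: \<psi>_def)
        qed
      qed
      moreover have "Lp_pow 1 (\<lambda>x. W x - \<psi> x) \<le> ennreal \<delta>"
        using order_trans[OF \<zeta>(2) ennreal_leI[of "min \<delta> e'" \<delta>]] by (simp add: W_def \<psi>_def)
      moreover have "(\<integral>\<^sup>+y. ennreal (partials_sum \<psi> y) \<partial>lborel) \<le> ennreal (4 * DIM('a) * e')"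
      proof -
        have d\<psi>: "frechet_derivative \<psi> (at x) b = frechet_derivative \<zeta> (at x) b - frechet_derivative \<phi> (at x) b" for x b
        proof -
          have "(\<psi> has_derivative (\<lambda>h. frechet_derivative \<zeta> (at x) h - frechet_derivative \<phi> (at x) h)) (at x)"
            unfolding \<psi>_def[abs_def]
            by (intro has_derivative_diff Ck_has_derivative[of 0] Ck\<zeta> Ck\<phi>)
          from frechet_derivative_at[OF this, symmetric] show ?thesis by simp
        qed
        have "(\<integral>\<^sup>+y. ennreal (partials_sum \<psi> y) \<partial>lborel) = (\<integral>\<^sup>+y. (\<Sum>b\<in>Basis. ennreal \<bar>frechet_derivative \<psi> (at y) b\<bar>) \<partial>lborel)"
          by (simp add: partials_sum_def)
        also have "\<dots> = (\<Sum>b\<in>Basis. Lp_pow 1 (\<lambda>x. frechet_derivative \<psi> (at x) b))"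
          unfolding Lp_pow_1 using dm[OF Ck\<psi>] by (intro nn_integral_sum) measurable
        also have "\<dots> \<le> (\<Sum>b\<in>(Basis::'a set). ennreal (4 * e'))"
        proof (rule sum_mono)
          fix b :: 'a assume b: "b \<in> Basis"
          note [measurable] = G[OF b] dm[OF Ck\<phi> b] dm[OF Ck\<zeta> b]
          have "Lp_pow 1 (\<lambda>x. frechet_derivative \<psi> (at x) b)
            = Lp_pow 1 (\<lambda>x. (G b x - frechet_derivative \<phi> (at x) b) - (G b x - frechet_derivative \<zeta> (at x) b))"
            by (simp add: d\<psi>)
          also have "\<dots> \<le> ennreal (2 powr 1) * (Lp_pow 1 (\<lambda>x. G b x - frechet_derivative \<phi> (at x) b) + Lp_pow 1 (\<lambda>x. G b x - frechet_derivative \<zeta> (at x) b))"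
            by (intro Lp_pow_diff) auto
          also have "\<dots> \<le> ennreal (2 powr 1) * (ennreal e' + ennreal e')"
            by (intro mult_left_mono add_mono \<phi>(2) b order_trans[OF \<zeta>(3)[OF b]] ennreal_leI) auto
          also have "\<dots> = ennreal (4 * e')"
            using e' by (simp add: ennreal_mult[symmetric] ennreal_plus[symmetric] numeral_mult_ennreal del: ennreal_plus)
          finally show "Lp_pow 1 (\<lambda>x. frechet_derivative \<psi> (at x) b) \<le> ennreal (4 * e')" .
        qed
        also have "\<dots> = ennreal (4 * DIM('a) * e')"
          using e' by (subst sum_ennreal) (auto simp: mult_ac)
        finally show ?thesis .
      qed
      ultimately show "\<exists>\<psi>\<in>test_functions \<Omega>. Lp_pow 1 (\<lambda>x. W x - \<psi> x) \<le> ennreal \<delta> \<and>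
        (\<integral>\<^sup>+y. ennreal (partials_sum \<psi> y) \<partial>lborel) \<le> ennreal (4 * DIM('a) * e')" by blast
    qed (use e' in auto)
    obtain K where K: "K > 0" "\<And>x. \<bar>\<phi> x\<bar> \<le> K * infdist x (- \<Omega>)"
      using test_function_le_infdist[OF \<phi>(1) \<Omega>] by blast
    have "emeasure lebesgue {x \<in> \<Omega>. \<bar>f x * indicator E x\<bar> > t} \<le> ennreal ((e + 2 * K * measure lebesgue E) / t)"
      if E: "E \<in> sets lebesgue" "E \<subseteq> \<Omega>" and t: "t > 0" for E t
    proof -
      \<comment> \<open>The quotient of \<open>\<phi>\<close> is at most \<open>K\<close> and can
        exceed \<open>t / 2\<close> only if \<open>t < 2 * K\<close>; then 1 is at most
        \<open>2 * K / t\<close>, which supplies the factor in front of the measure of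
        \<open>E\<close>.\<close>
      define E' where "E' = (if t < 2 * K then E else {})"
      have E'm: "E' \<in> sets lebesgue" using E by (simp add: E'_def)
      have stm: "steep \<Omega> W (t / 2) \<in> sets borel" using \<Omega>(1) Wm by (rule steep_sets)
      have "emeasure lebesgue {x \<in> \<Omega>. \<bar>f x * indicator E x\<bar> > t} \<le> emeasure lebesgue (steep \<Omega> W (t / 2) \<union> E')"
      proof (rule emeasure_mono_AE)
        show "AE x in lebesgue. x \<in> {x \<in> \<Omega>. \<bar>f x * indicator E x\<bar> > t} \<longrightarrow> x \<in> steep \<Omega> W (t / 2) \<union> E'"
          using fU
        proof (rule eventually_mono, intro impI)
          fix x assume fx: "x \<in> \<Omega> \<longrightarrow> f x = U x / infdist x (- \<Omega>)" and "x \<in> {x \<in> \<Omega>. \<bar>f x * indicator E x\<bar> > t}"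
          then have x: "x \<in> \<Omega>" "\<bar>f x * indicator E x\<bar> > t" by auto
          then have xE: "x \<in> E" using t by (cases "x \<in> E") auto
          have d: "infdist x (- \<Omega>) > 0" by (rule infdist_Compl_pos[OF \<Omega> x(1)])
          have "t < \<bar>U x\<bar> / infdist x (- \<Omega>)" using x fx xE d by (simp add: abs_divide)
          then have big: "t * infdist x (- \<Omega>) < \<bar>U x\<bar>" using d by (simp add: field_simps)
          show "x \<in> steep \<Omega> W (t / 2) \<union> E'"
          proof (rule ccontr)
            assume no: "x \<notin> steep \<Omega> W (t / 2) \<union> E'"
            then have "\<bar>W x\<bar> \<le> t / 2 * infdist x (- \<Omega>)" "t \<ge> 2 * K" using x(1) xE by (auto simp: steep_def E'_def split: if_splits)
            moreover have "\<bar>U x\<bar> \<le> \<bar>W x\<bar> + \<bar>\<phi> x\<bar>" by (simp add: W_def)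
            moreover have "\<bar>\<phi> x\<bar> \<le> t / 2 * infdist x (- \<Omega>)"
              using K(2)[of x] \<open>t \<ge> 2 * K\<close> d by (intro order_trans[OF K(2)] mult_right_mono) auto
            ultimately show False using big by (simp add: field_simps)
          qed
        qed
      qed (use E'm stm in auto)
      also have "\<dots> \<le> emeasure lebesgue (steep \<Omega> W (t / 2)) + emeasure lebesgue E'"
        using E'm stm by (intro emeasure_subadditive) auto
      also have "\<dots> \<le> ennreal (e / t) + ennreal (2 * K * measure lebesgue E / t)"
      proof (intro add_mono)
        have "emeasure lebesgue (steep \<Omega> W (t / 2)) \<le> ennreal (2 * C * (4 * DIM('a) * e') / (t / 2))"
          using st[of "t / 2"] t stm by simp
        also have "2 * C * (4 * DIM('a) * e') / (t / 2) = e / t"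
          using C(1) t by (simp add: e'_def)
        finally show "emeasure lebesgue (steep \<Omega> W (t / 2)) \<le> ennreal (e / t)" .
        show "emeasure lebesgue E' \<le> ennreal (2 * K * measure lebesgue E / t)"
        proof (cases "t < 2 * K")
          case True
          have "emeasure lebesgue E < \<infinity>" using emeasure_mono[OF E(2) \<Omega>m(1)] \<Omega>fin by (rule le_less_trans)
          then have "emeasure lebesgue E = ennreal (measure lebesgue E)" by (intro emeasure_eq_ennreal_measure) auto
          also have "\<dots> \<le> ennreal (2 * K / t * measure lebesgue E)"
            using True t mult_right_mono[of 1 "2 * K / t" "measure lebesgue E"] by (intro ennreal_leI) auto
          finally show ?thesis using True by (simp add: E'_def)
        qed (simp add: E'_def)
      qed
      also have "\<dots> = ennreal ((e + 2 * K * measure lebesgue E) / t)"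
        using e K t by (simp add: ennreal_plus[symmetric] add_divide_distrib del: ennreal_plus)
      finally show ?thesis .
    qed
    then show ?thesis using K(1) by (intro exI[of _ "2 * K"]) auto
  qed
  have le: "weak_L1_norm \<Omega> (\<lambda>x. f x * indicator E x) \<le> ennreal (e + K * measure lebesgue E)"
    if "e > 0" "K > 0" "\<And>t. t > 0 \<Longrightarrow> emeasure lebesgue {x \<in> \<Omega>. \<bar>f x * indicator E x\<bar> > t}
      \<le> ennreal ((e + K * measure lebesgue E) / t)" for e K :: real and E
    using that by (intro weak_L1_norm_le) (auto intro!: add_pos_nonneg)
  have "f \<in> weak_L1 \<Omega>"
  proof -
    obtain K where K: "K > 0" "\<And>t. t > 0 \<Longrightarrow> emeasure lebesgue {x \<in> \<Omega>. \<bar>f x * indicator \<Omega> x\<bar> > t}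
      \<le> ennreal ((1 + K * measure lebesgue \<Omega>) / t)"
      using key[of 1] \<Omega>m by auto
    have "emeasure lebesgue {x \<in> \<Omega>. \<bar>f x\<bar> > t} \<le> ennreal ((1 + K * measure lebesgue \<Omega>) / t)" if "t > 0" for t
    proof -
      have "{x \<in> \<Omega>. \<bar>f x * indicator \<Omega> x\<bar> > t} = {x \<in> \<Omega>. \<bar>f x\<bar> > t}" by auto
      then show ?thesis using K(2)[OF that] by simp
    qed
    then have "weak_L1_norm \<Omega> f \<le> ennreal (1 + K * measure lebesgue \<Omega>)"
      using K(1) by (intro weak_L1_norm_le) (auto intro!: add_pos_nonneg)
    then show ?thesis using f by (auto simp: weak_L1_def intro: le_less_trans)
  qed
  moreover have "(\<lambda>k. weak_L1_norm \<Omega> (\<lambda>x. f x * indicator (E k) x)) \<longlonglongrightarrow> 0"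
    if E: "\<And>k. E k \<in> sets lebesgue \<and> E k \<subseteq> \<Omega>" and lim: "AE x in lebesgue_on \<Omega>. (\<lambda>k. indicator (E k) x :: real) \<longlonglongrightarrow> 0"
    for E :: "nat \<Rightarrow> 'a set"
  proof -
    have "AE x in lebesgue. x \<in> \<Omega> \<longrightarrow> (\<lambda>k. indicator (E k) x :: real) \<longlonglongrightarrow> 0"
      using lim \<Omega>m by (subst (asm) AE_restrict_space_iff) auto
    then have ev: "AE x in lebesgue. indicator \<Omega> x = (0::ennreal) \<or> (\<forall>\<^sub>F k in sequentially. x \<notin> E k)"
    proof (rule eventually_mono)
      fix x assume *: "x \<in> \<Omega> \<longrightarrow> (\<lambda>k. indicator (E k) x :: real) \<longlonglongrightarrow> 0"
      show "indicator \<Omega> x = (0::ennreal) \<or> (\<forall>\<^sub>F k in sequentially. x \<notin> E k)"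
      proof (cases "x \<in> \<Omega>")
        case True
        then have "\<forall>\<^sub>F k in sequentially. indicator (E k) x < (1::real)" using * by (intro order_tendstoD(2)) auto
        then have "\<forall>\<^sub>F k in sequentially. x \<notin> E k" by (rule eventually_mono) (auto simp: indicator_def split: if_splits)
        then show ?thesis by simp
      qed simp
    qed
    have "(\<lambda>k. \<integral>\<^sup>+x. indicator \<Omega> x * indicator (E k) x \<partial>lebesgue) \<longlonglongrightarrow> 0"
      using \<Omega>m \<Omega>fin E ev by (intro nn_integral_vanishing) (auto intro!: borel_measurable_indicator)
    moreover have "(\<integral>\<^sup>+x. indicator \<Omega> x * indicator (E k) x \<partial>lebesgue) = emeasure lebesgue (E k)" for k
    proof -
      have "(\<integral>\<^sup>+x. indicator \<Omega> x * indicator (E k) x \<partial>lebesgue) = (\<integral>\<^sup>+x. indicator (E k) x \<partial>lebesgue)"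
        using E[of k] by (intro nn_integral_cong) (auto simp: indicator_def)
      then show ?thesis using E[of k] by simp
    qed
    ultimately have "(\<lambda>k. emeasure lebesgue (E k)) \<longlonglongrightarrow> ennreal 0" by simp
    then have mE: "(\<lambda>k. measure lebesgue (E k)) \<longlonglongrightarrow> 0"
      unfolding measure_def by (rule tendsto_enn2real) simp
    show ?thesis
    proof (rule order_tendstoI)
      fix a :: ennreal assume "0 < a"
      then obtain e where e: "e > 0" "ennreal e < a"
        by (metis ennreal_0 ennreal_less_zero_iff dense ennreal_cases less_top_ennreal order.strict_trans2 top_greatest ennreal_enn2real)
      obtain K where K: "K > 0" "\<And>E t. E \<in> sets lebesgue \<Longrightarrow> E \<subseteq> \<Omega> \<Longrightarrow> t > 0 \<Longrightarrow>
          emeasure lebesgue {x \<in> \<Omega>. \<bar>f x * indicator E x\<bar> > t} \<le> ennreal ((e / 2 + K * measure lebesgue E) / t)"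
        using key[of "e / 2"] e(1) by auto
      have "\<forall>\<^sub>F k in sequentially. measure lebesgue (E k) < e / (2 * K)"
        using e K by (intro order_tendstoD(2)[OF mE]) auto
      then show "\<forall>\<^sub>F k in sequentially. weak_L1_norm \<Omega> (\<lambda>x. f x * indicator (E k) x) < a"
      proof (rule eventually_mono)
        fix k assume k: "measure lebesgue (E k) < e / (2 * K)"
        have "weak_L1_norm \<Omega> (\<lambda>x. f x * indicator (E k) x) \<le> ennreal (e / 2 + K * measure lebesgue (E k))"
          using e K E[of k] by (intro le) auto
        also have "\<dots> \<le> ennreal e" using k K by (intro ennreal_leI) (simp add: field_simps)
        also have "\<dots> < a" by (rule e(2))
        finally show "weak_L1_norm \<Omega> (\<lambda>x. f x * indicator (E k) x) < a" .
      qed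
    qed simp
  qed
  ultimately show ?thesis unfolding weak_L1_a_def by blast
qed


section \<open>Borel representatives and the characterisation of zero traces\<close>

text \<open>A Borel function equal to \<open>f\<close> almost everywhere in \<open>\<Omega>\<close>
  and to 0 outside. It is at once the zero extension and the passage from
  \<open>lebesgue_on \<Omega>\<close> to \<open>lborel\<close>.\<close>

definition borel_version :: "'a::euclidean_space set \<Rightarrow> ('a \<Rightarrow> real) \<Rightarrow> ('a \<Rightarrow> real) \<Rightarrow> bool" where
  "borel_version \<Omega> f F \<longleftrightarrow> f \<in> borel_measurable (lebesgue_on \<Omega>) \<and> F \<in> borel_measurable borel \<and>
     (\<forall>x. x \<notin> \<Omega> \<longrightarrow> F x = 0) \<and> (AE x in lebesgue. x \<in> \<Omega> \<longrightarrow> f x = F x)"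

lemma ex_borel_version:
  assumes "open \<Omega>" "f \<in> borel_measurable (lebesgue_on \<Omega>)"
  shows "\<exists>F. borel_version \<Omega> f F"
proof -
  have \<Omega>: "\<Omega> \<in> sets borel" using assms(1) by simp
  have "(\<lambda>x. indicator \<Omega> x *\<^sub>R f x) \<in> borel_measurable lebesgue"
    using assms(2) \<Omega> by (subst (asm) borel_measurable_restrict_space_iff) auto
  then obtain g where g: "g \<in> borel_measurable lborel" "AE x in lborel. indicator \<Omega> x *\<^sub>R f x = g x"
    using completion_ex_borel_measurable_real by blast
  have "borel_version \<Omega> f (\<lambda>x. indicator \<Omega> x * g x)"
    unfolding borel_version_def
  proof (intro conjI assms)
    show "(\<lambda>x. indicator \<Omega> x * g x) \<in> borel_measurable borel" using g(1) \<Omega> by simp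
    show "AE x in lebesgue. x \<in> \<Omega> \<longrightarrow> f x = indicator \<Omega> x * g x"
      using AE_completion[OF g(2)] by (rule eventually_mono) (auto simp: indicator_def)
  qed simp
  then show ?thesis by blast
qed

lemma borel_version_indicator_measurable:
  assumes "borel_version \<Omega> f F" "open \<Omega>"
  shows "(\<lambda>x. indicator \<Omega> x * f x) \<in> borel_measurable lebesgue"
proof -
  have "f \<in> borel_measurable (lebesgue_on \<Omega>)" using assms(1) by (simp add: borel_version_def)
  then have "(\<lambda>x. indicator \<Omega> x *\<^sub>R f x) \<in> borel_measurable lebesgue"
    using assms(2) by (subst (asm) borel_measurable_restrict_space_iff) auto
  then show ?thesis by simp
qed

lemma integral_borel_version:
  assumes v: "borel_version \<Omega> f F" and \<Omega>: "open \<Omega>" and [measurable]: "\<psi> \<in> borel_measurable borel"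
  shows "(LINT x|lebesgue_on \<Omega>. f x * \<psi> x) = (\<integral>x. F x * \<psi> x \<partial>lborel)"
proof -
  have [measurable]: "F \<in> borel_measurable borel" using v by (simp add: borel_version_def)
  have "(LINT x|lebesgue_on \<Omega>. f x * \<psi> x) = (\<integral>x. (indicator \<Omega> x * f x) * \<psi> x \<partial>lebesgue)"
    using \<Omega> by (subst integral_restrict_space) (auto simp: mult.assoc)
  also have "\<dots> = (\<integral>x. F x * \<psi> x \<partial>lebesgue)"
  proof (rule integral_cong_AE)
    show "(\<lambda>x. (indicator \<Omega> x * f x) * \<psi> x) \<in> borel_measurable lebesgue"
      by (intro borel_measurable_times borel_version_indicator_measurable[OF v \<Omega>] measurable_completion) simp
    show "(\<lambda>x. F x * \<psi> x) \<in> borel_measurable lebesgue" by (intro measurable_completion) simp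
    have "AE x in lebesgue. x \<in> \<Omega> \<longrightarrow> f x = F x" using v by (simp add: borel_version_def)
    then show "AE x in lebesgue. (indicator \<Omega> x * f x) * \<psi> x = F x * \<psi> x"
      by (rule eventually_mono) (use v in \<open>auto simp: borel_version_def indicator_def\<close>)
  qed
  also have "\<dots> = (\<integral>x. F x * \<psi> x \<partial>lborel)" by (intro integral_completion) simp
  finally show ?thesis .
qed

lemma nn_integral_borel_version:
  assumes v: "borel_version \<Omega> f F" and \<Omega>: "open \<Omega>" and "p > 0"
  shows "(\<integral>\<^sup>+x. ennreal (\<bar>f x\<bar> powr p) \<partial>lebesgue_on \<Omega>) = Lp_pow p F"
proof -
  have [measurable]: "F \<in> borel_measurable borel" using v by (simp add: borel_version_def)
  have "(\<integral>\<^sup>+x. ennreal (\<bar>f x\<bar> powr p) \<partial>lebesgue_on \<Omega>) = (\<integral>\<^sup>+x. ennreal (\<bar>f x\<bar> powr p) * indicator \<Omega> x \<partial>lebesgue)"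
    using \<Omega> by (intro nn_integral_restrict_space) auto
  also have "\<dots> = (\<integral>\<^sup>+x. ennreal (\<bar>F x\<bar> powr p) \<partial>lebesgue)"
  proof (rule nn_integral_cong_AE)
    have "AE x in lebesgue. x \<in> \<Omega> \<longrightarrow> f x = F x" using v by (simp add: borel_version_def)
    then show "AE x in lebesgue. ennreal (\<bar>f x\<bar> powr p) * indicator \<Omega> x = ennreal (\<bar>F x\<bar> powr p)"
      by (rule eventually_mono) (use v assms(3) in \<open>auto simp: borel_version_def indicator_def\<close>)
  qed
  also have "\<dots> = Lp_pow p F" unfolding Lp_pow_def by (rule nn_integral_completion)
  finally show ?thesis .
qed

lemma Lp_space_iff_Lp_pow:
  assumes v: "borel_version \<Omega> f F" and \<Omega>: "open \<Omega>" and p: "p > 0"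
  shows "f \<in> Lp_space \<Omega> p \<longleftrightarrow> Lp_pow p F < \<infinity>"
proof -
  have [measurable]: "f \<in> borel_measurable (lebesgue_on \<Omega>)" using v by (simp add: borel_version_def)
  show ?thesis
    unfolding Lp_space_def using nn_integral_borel_version[OF assms] by (simp add: integrable_iff_bounded)
qed

lemma integral_powr_borel_version:
  assumes v: "borel_version \<Omega> f F" and \<Omega>: "open \<Omega>" and p: "p > 0"
  shows "(LINT x|lebesgue_on \<Omega>. \<bar>f x\<bar> powr p) = enn2real (Lp_pow p F)"
proof -
  have [measurable]: "f \<in> borel_measurable (lebesgue_on \<Omega>)" using v by (simp add: borel_version_def)
  show ?thesis using nn_integral_borel_version[OF assms] by (subst integral_eq_nn_integral) auto
qed

text \<open>\<open>f\<close> is the pointwise limit of its restrictions to an exhaustion by compact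
  sets, each integrable and hence measurable. This gives chosen weak derivatives a Borel
  representative.\<close>

lemma locally_integrable_measurable:
  assumes "open \<Omega>" "locally_integrable \<Omega> f"
  shows "f \<in> borel_measurable (lebesgue_on \<Omega>)"
proof -
  obtain C where C: "\<And>n. compact (C n)" "\<And>n. C n \<subseteq> \<Omega>" "\<And>n. C n \<subseteq> interior (C (Suc n))" "(\<Union>n. C n) = \<Omega>"
    using open_Union_compact_subsets[OF assms(1)] by (metis (full_types))
  have inc: "C m \<subseteq> C n" if "m \<le> n" for m n
  proof (rule lift_Suc_mono_le[of C, OF _ that])
    fix n show "C n \<subseteq> C (Suc n)" using C(3)[of n] interior_subset by blast
  qed
  have "(\<lambda>x. indicator \<Omega> x *\<^sub>R f x) \<in> borel_measurable lebesgue"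
  proof (rule borel_measurable_LIMSEQ_metric)
    fix n
    have "set_integrable lebesgue (C n) f" using assms(2) C by (auto simp: locally_integrable_def)
    then show "(\<lambda>x. indicator (C n) x *\<^sub>R f x) \<in> borel_measurable lebesgue"
      unfolding set_integrable_def by (rule borel_measurable_integrable)
  next
    fix x
    show "(\<lambda>n. indicator (C n) x *\<^sub>R f x) \<longlonglongrightarrow> indicator \<Omega> x *\<^sub>R f x"
    proof (cases "x \<in> \<Omega>")
      case True
      then obtain m where m: "x \<in> C m" using C(4) by blast
      have "\<forall>\<^sub>F n in sequentially. indicator (C n) x *\<^sub>R f x = indicator \<Omega> x *\<^sub>R f x"
        using eventually_ge_at_top[of m]
      proof eventually_elim
        case (elim n)
        then have "x \<in> C n" using inc m by blast
        then show ?case using True by simp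
      qed
      then show ?thesis by (rule tendsto_eventually)
    next
      case False
      then have "x \<notin> C n" for n using C(4) by blast
      then show ?thesis using False by simp
    qed
  qed
  then show ?thesis using assms(1) by (subst borel_measurable_restrict_space_iff) auto
qed

lemma locally_integrable_iff_borel:
  assumes v: "borel_version \<Omega> f F" and \<Omega>: "open \<Omega>"
  shows "locally_integrable \<Omega> f \<longleftrightarrow> locally_integrable_borel \<Omega> F"
proof -
  have F [measurable]: "F \<in> borel_measurable borel" using v by (simp add: borel_version_def)
  have "set_integrable lebesgue K f \<longleftrightarrow> integrable lborel (\<lambda>x. indicator K x * F x)"
    if K: "compact K" "K \<subseteq> \<Omega>" for K
  proof -
    have [measurable]: "K \<in> sets borel" using K by (simp add: borel_compact)
    have "integrable lebesgue (\<lambda>x. indicator K x * f x) \<longleftrightarrow> integrable lebesgue (\<lambda>x. indicator K x * F x)"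
    proof (rule integrable_cong_AE)
      have "(\<lambda>x. indicator K x * (indicator \<Omega> x * f x)) \<in> borel_measurable lebesgue"
        by (intro borel_measurable_times borel_version_indicator_measurable[OF v \<Omega>] measurable_completion) simp
      also have "(\<lambda>x. indicator K x * (indicator \<Omega> x * f x)) = (\<lambda>x. indicator K x * f x)"
        using K by (intro ext) (auto simp: indicator_def)
      finally show "(\<lambda>x. indicator K x * f x) \<in> borel_measurable lebesgue" .
      show "(\<lambda>x. indicator K x * F x) \<in> borel_measurable lebesgue" by (intro measurable_completion) simp
      have "AE x in lebesgue. x \<in> \<Omega> \<longrightarrow> f x = F x" using v by (simp add: borel_version_def)
      then show "AE x in lebesgue. indicator K x * f x = indicator K x * F x"
        by (rule eventually_mono) (use K in \<open>auto simp: indicator_def\<close>)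
    qed
    then show ?thesis by (simp add: set_integrable_def integrable_completion)
  qed
  then show ?thesis unfolding locally_integrable_def locally_integrable_borel_def using F by auto
qed

section \<open>Calculus of test functions and transfer of weak derivatives\<close>

lemma test_functions_frechet_derivative:
  assumes "\<phi> \<in> test_functions \<Omega>" "b \<in> Basis"
  shows "(\<lambda>x. frechet_derivative \<phi> (at x) b) \<in> test_functions \<Omega>"
proof (rule test_functionsI)
  let ?K = "closure {x. \<phi> x \<noteq> 0}"
  show "compact ?K" "?K \<subseteq> \<Omega>" using assms(1) by (auto simp: test_functions_def)
  show "Ck k (\<lambda>x. frechet_derivative \<phi> (at x) b)" for k
    using assms by (intro smooth_frechet_derivative) (auto simp: test_functions_def)
  fix x assume x: "x \<notin> ?K"
  have "(\<phi> has_derivative (\<lambda>h. 0)) (at x)"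
  proof (rule has_derivative_transform_within_open[of "\<lambda>x. 0" "\<lambda>h. 0" x UNIV "- ?K" \<phi>])
    show "open (- ?K)" by (rule open_Compl[OF closed_closure])
    show "x \<in> - ?K" using x by blast
    show "0 = \<phi> y" if "y \<in> - ?K" for y using that closure_subset[of "{x. \<phi> x \<noteq> 0}"] by auto
  qed (rule has_derivative_const)
  from frechet_derivative_at[OF this, symmetric] show "frechet_derivative \<phi> (at x) b = 0" by simp
qed

lemma test_functions_mult:
  assumes "\<phi> \<in> test_functions \<Omega>" "\<psi> \<in> test_functions \<Omega>"
  shows "(\<lambda>x. \<phi> x * \<psi> x) \<in> test_functions \<Omega>"
proof (rule test_functionsI[of _ "closure {x. \<phi> x \<noteq> 0}"])
  show "\<phi> x * \<psi> x = 0" if "x \<notin> closure {x. \<phi> x \<noteq> 0}" for x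
    using that closure_subset[of "{x. \<phi> x \<noteq> 0}"] by auto
qed (use assms in \<open>auto simp: test_functions_def intro: Ck_mult\<close>)

text \<open>Difference quotients integrate to 0 by translation invariance and converge uniformly to
  the partial derivative. Steps of length at most 1 keep everything inside the ball of radius
  \<open>R + 1\<close>, so uniform convergence suffices.\<close>

lemma integral_partial_test_function:
  fixes \<phi> :: "'a::euclidean_space \<Rightarrow> real"
  assumes \<phi>: "\<phi> \<in> test_functions \<Omega>" and b: "b \<in> Basis"
  shows "(\<integral>x. frechet_derivative \<phi> (at x) b \<partial>lborel) = 0"
proof -
  obtain R where R: "\<And>x. norm x > R \<Longrightarrow> \<phi> x = 0" using test_functions_bounded_support[OF \<phi>] by blast
  have Ck: "Ck k \<phi>" for k using \<phi> by (simp add: test_functions_def)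
  let ?D = "\<lambda>x. frechet_derivative \<phi> (at x) b"
  have cD: "continuous_on UNIV ?D" using Ck[of 1] b by simp
  have D0: "?D x = 0" if "norm x > R" for x using frechet_derivative_zero_outside[of R \<phi>, OF R that] by simp
  have iD: "integrable lborel ?D" by (rule integrable_continuous_bounded_support[OF cD D0])
  have i\<phi>: "integrable lborel \<phi>" by (rule integrable_continuous_bounded_support[OF Ck_continuous[OF Ck[of 0]] R])
  have [measurable]: "\<phi> \<in> borel_measurable borel" using i\<phi> by simp
  define V where "V = measure lborel (cball (0::'a) (R + 1))"
  have V: "V \<ge> 0" by (simp add: V_def)
  have "\<bar>\<integral>x. ?D x \<partial>lborel\<bar> \<le> 0 + e" if e: "e > 0" for e
  proof -
    define e' where "e' = e / (V + 1)"
    have e': "e' > 0" using e V by (simp add: e'_def)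
    obtain d where d: "d > 0" "\<And>z h. norm h < d \<Longrightarrow> \<bar>\<phi> (z + h) - \<phi> z - frechet_derivative \<phi> (at z) h\<bar> \<le> e' * norm h"
      using C1_uniform_linearization[OF Ck R e'] by metis
    define h where "h = min (d / 2) 1"
    have h: "h > 0" "h < d" "h \<le> 1" using d(1) by (auto simp: h_def)
    let ?q = "\<lambda>x. (\<phi> (x + h *\<^sub>R b) - \<phi> x) / h"
    have iq: "integrable lborel ?q" using integrable_translate[OF i\<phi>, of "h *\<^sub>R b"] i\<phi> by simp
    have "(\<integral>x. ?q x \<partial>lborel) = ((\<integral>x. \<phi> (x + h *\<^sub>R b) \<partial>lborel) - (\<integral>x. \<phi> x \<partial>lborel)) / h"
      using integrable_translate[OF i\<phi>, of "h *\<^sub>R b"] i\<phi> by simp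
    also have "\<dots> = 0" by (subst lborel_integral_translate) auto
    finally have "(\<integral>x. ?D x \<partial>lborel) = - (\<integral>x. ?q x - ?D x \<partial>lborel)" using iq iD by simp
    then have "\<bar>\<integral>x. ?D x \<partial>lborel\<bar> = \<bar>\<integral>x. ?q x - ?D x \<partial>lborel\<bar>" by simp
    also have "\<dots> \<le> (\<integral>x. \<bar>?q x - ?D x\<bar> \<partial>lborel)" by (rule integral_abs_bound)
    also have "\<dots> \<le> (\<integral>x. e' * indicator (cball (0::'a) (R + 1)) x \<partial>lborel)"
    proof (rule integral_mono)
      show "integrable lborel (\<lambda>x. \<bar>?q x - ?D x\<bar>)" using iq iD by simp
      show "integrable lborel (\<lambda>x. e' * indicator (cball (0::'a) (R + 1)) x :: real)"
        using emeasure_bounded_finite[of "cball (0::'a) (R + 1)"] by simp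
      fix x :: 'a
      show "\<bar>?q x - ?D x\<bar> \<le> e' * indicator (cball 0 (R + 1)) x"
      proof (cases "x \<in> cball 0 (R + 1)")
        case True
        have hd: "(\<phi> has_derivative frechet_derivative \<phi> (at x)) (at x)"
          by (rule Ck_has_derivative[of 0]) (rule Ck)
        interpret bounded_linear "frechet_derivative \<phi> (at x)" using hd by (rule has_derivative_bounded_linear)
        have "frechet_derivative \<phi> (at x) (h *\<^sub>R b) = h * ?D x" by (simp add: scale)
        then have "?q x - ?D x = (\<phi> (x + h *\<^sub>R b) - \<phi> x - frechet_derivative \<phi> (at x) (h *\<^sub>R b)) / h"
          using h by (simp add: field_simps)
        moreover have "\<bar>\<phi> (x + h *\<^sub>R b) - \<phi> x - frechet_derivative \<phi> (at x) (h *\<^sub>R b)\<bar> \<le> e' * h"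
          using d(2)[of "h *\<^sub>R b" x] h b by simp
        ultimately have "\<bar>?q x - ?D x\<bar> \<le> e'" using h by (simp add: abs_divide field_simps)
        with True show ?thesis by simp
      next
        case False
        have "norm x \<le> norm (x + h *\<^sub>R b) + norm (h *\<^sub>R b)"
          using norm_triangle_ineq4[of "x + h *\<^sub>R b" "h *\<^sub>R b"] by simp
        then have "norm x > R" "norm (x + h *\<^sub>R b) > R" using False h b by auto
        then show ?thesis using R D0 False by simp
      qed
    qed
    also have "\<dots> = e' * V" by (simp add: V_def)
    also have "\<dots> \<le> e" using e V by (simp add: e'_def field_simps)
    finally show ?thesis by simp
  qed
  then have "\<bar>\<integral>x. ?D x \<partial>lborel\<bar> \<le> 0" by (rule field_le_epsilon)
  then show ?thesis by simp
qed

lemma test_function_locally_integrable: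
  assumes "\<phi> \<in> test_functions \<Omega>"
  shows "locally_integrable_borel \<Omega> \<phi>"
proof -
  have c: "continuous_on UNIV \<phi>" using assms Ck_continuous[of 0 \<phi>] by (simp add: test_functions_def)
  have "integrable lborel (\<lambda>x. indicator K x * \<phi> x)" if "compact K" for K
    using borel_integrable_compact[OF that continuous_on_subset[OF c]] by simp
  with c show ?thesis unfolding locally_integrable_borel_def by (simp add: borel_measurable_continuous_onI)
qed

text \<open>Integration by parts for two test functions is the vanishing integral of the derivative
  of their product.\<close>

lemma weak_partial_borel_diff_test_function:
  assumes w: "weak_partial_borel \<Omega> b U G" and \<phi>: "\<phi> \<in> test_functions \<Omega>" and b: "b \<in> Basis"
  shows "weak_partial_borel \<Omega> b (\<lambda>x. U x - \<phi> x) (\<lambda>x. G x - frechet_derivative \<phi> (at x) b)"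
proof -
  let ?D = "\<lambda>f x. frechet_derivative f (at x) b"
  have U: "locally_integrable_borel \<Omega> U" and G: "locally_integrable_borel \<Omega> G"
    and eq: "\<And>\<psi>. \<psi> \<in> test_functions \<Omega> \<Longrightarrow> (\<integral>x. U x * ?D \<psi> x \<partial>lborel) = - (\<integral>x. G x * \<psi> x \<partial>lborel)"
    using w by (auto simp: weak_partial_borel_def)
  have \<phi>D: "?D \<phi> \<in> test_functions \<Omega>" by (rule test_functions_frechet_derivative[OF \<phi> b])
  have diff: "locally_integrable_borel \<Omega> (\<lambda>x. f x - g x)"
    if "locally_integrable_borel \<Omega> f" "locally_integrable_borel \<Omega> g" for f g
    using that unfolding locally_integrable_borel_def by (auto simp: right_diff_distrib)
  have "(\<integral>x. (U x - \<phi> x) * ?D \<psi> x \<partial>lborel) = - (\<integral>x. (G x - ?D \<phi> x) * \<psi> x \<partial>lborel)"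
    if \<psi>: "\<psi> \<in> test_functions \<Omega>" for \<psi>
  proof -
    note i = integrable_times_test_function
    have \<psi>D: "?D \<psi> \<in> test_functions \<Omega>" by (rule test_functions_frechet_derivative[OF \<psi> b])
    have i\<phi>: "integrable lborel (\<lambda>x. \<phi> x * ?D \<psi> x)" "integrable lborel (\<lambda>x. ?D \<phi> x * \<psi> x)"
      using i[OF test_function_locally_integrable[OF \<phi>] \<psi>D] i[OF test_function_locally_integrable[OF \<phi>D] \<psi>] .
    have "(\<integral>x. \<phi> x * ?D \<psi> x + ?D \<phi> x * \<psi> x \<partial>lborel) = (\<integral>x. ?D (\<lambda>x. \<phi> x * \<psi> x) x \<partial>lborel)"
    proof (intro Bochner_Integration.integral_cong refl)
      fix x
      have "((\<lambda>x. \<phi> x * \<psi> x) has_derivative (\<lambda>h. \<phi> x * frechet_derivative \<psi> (at x) h + frechet_derivative \<phi> (at x) h * \<psi> x)) (at x)"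
        using \<phi> \<psi> by (intro has_derivative_mult Ck_has_derivative[of 0]) (auto simp: test_functions_def simp del: Ck.simps)
      from frechet_derivative_at[OF this, symmetric]
      show "\<phi> x * ?D \<psi> x + ?D \<phi> x * \<psi> x = ?D (\<lambda>x. \<phi> x * \<psi> x) x" by simp
    qed
    also have "\<dots> = 0" by (rule integral_partial_test_function[OF test_functions_mult[OF \<phi> \<psi>] b])
    finally have "(\<integral>x. \<phi> x * ?D \<psi> x \<partial>lborel) = - (\<integral>x. ?D \<phi> x * \<psi> x \<partial>lborel)" using i\<phi> by simp
    then show ?thesis
      using eq[OF \<psi>] i[OF U \<psi>D] i[OF G \<psi>] i\<phi> by (simp add: left_diff_distrib)
  qed
  then show ?thesis
    unfolding weak_partial_borel_def using U G \<phi> \<phi>D by (auto intro: diff test_function_locally_integrable)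
qed

lemma has_weak_partial_iff_borel:
  assumes \<Omega>: "open \<Omega>" and b: "b \<in> Basis" and U: "borel_version \<Omega> u U" and V: "borel_version \<Omega> v V"
    and u: "locally_integrable \<Omega> u"
  shows "has_weak_partial \<Omega> b u v \<longleftrightarrow> weak_partial_borel \<Omega> b U V"
proof -
  have "(LINT x|lebesgue_on \<Omega>. u x * frechet_derivative \<phi> (at x) b) = (\<integral>x. U x * frechet_derivative \<phi> (at x) b \<partial>lborel)"
    "(LINT x|lebesgue_on \<Omega>. v x * \<phi> x) = (\<integral>x. V x * \<phi> x \<partial>lborel)"
    if "\<phi> \<in> test_functions \<Omega>" for \<phi>
    using integral_borel_version[OF U \<Omega>] integral_borel_version[OF V \<Omega>]
      test_function_locally_integrable[OF that] test_function_locally_integrable[OF test_functions_frechet_derivative[OF that b]]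
    by (auto simp: locally_integrable_borel_def)
  then show ?thesis
    unfolding has_weak_partial_def weak_partial_borel_def
    using locally_integrable_iff_borel[OF U \<Omega>] locally_integrable_iff_borel[OF V \<Omega>] u by simp
qed

lemma borel_version_diff_test_function:
  assumes "borel_version \<Omega> u U" "\<phi> \<in> test_functions \<Omega>" "open \<Omega>"
  shows "borel_version \<Omega> (\<lambda>x. u x - \<phi> x) (\<lambda>x. U x - \<phi> x)"
proof -
  have \<phi>0: "\<phi> x = 0" if "x \<notin> \<Omega>" for x
    using assms(2) that closure_subset[of "{x. \<phi> x \<noteq> 0}"] by (auto simp: test_functions_def)
  have [measurable]: "\<phi> \<in> borel_measurable borel"
    using test_function_locally_integrable[OF assms(2)] by (simp add: locally_integrable_borel_def)
  have "\<phi> \<in> borel_measurable (lebesgue_on \<Omega>)"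
    by (intro measurable_restrict_space1 measurable_completion) simp
  then show ?thesis
    using assms(1) \<phi>0 unfolding borel_version_def by (auto elim: eventually_mono)
qed

lemma weak_partial_borel_version:
  assumes \<Omega>: "open \<Omega>" and wd: "weakly_differentiable \<Omega> u" and b: "b \<in> Basis" and U: "borel_version \<Omega> u U"
  obtains V where "borel_version \<Omega> (weak_partial \<Omega> b u) V" "weak_partial_borel \<Omega> b U V"
proof -
  have u: "locally_integrable \<Omega> u" and ex: "\<exists>v. has_weak_partial \<Omega> b u v"
    using wd b by (auto simp: weakly_differentiable_def)
  have wp: "has_weak_partial \<Omega> b u (weak_partial \<Omega> b u)"
    unfolding weak_partial_def by (rule someI_ex[OF ex])
  then have "weak_partial \<Omega> b u \<in> borel_measurable (lebesgue_on \<Omega>)"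
    by (intro locally_integrable_measurable[OF \<Omega>]) (simp add: has_weak_partial_def)
  then obtain V where V: "borel_version \<Omega> (weak_partial \<Omega> b u) V" using ex_borel_version[OF \<Omega>] by blast
  show thesis
    using that[OF V] has_weak_partial_iff_borel[OF \<Omega> b U V u] wp by simp
qed

text \<open>\<open>weak_partial\<close> is chosen separately for each function, so the
  representative for \<open>u - \<phi>\<close> has no evident relation to the one for
  \<open>u\<close>. Uniqueness almost everywhere identifies it inside the integral.\<close>

lemma weak_partial_diff_test_function:
  assumes \<Omega>: "open \<Omega>" and wd: "weakly_differentiable \<Omega> u" and b: "b \<in> Basis" and U: "borel_version \<Omega> u U"
    and w: "weak_partial_borel \<Omega> b U V" and V: "\<And>x. x \<notin> \<Omega> \<Longrightarrow> V x = 0" and \<phi>: "\<phi> \<in> test_functions \<Omega>" and p: "p > 0"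
  shows "(LINT x|lebesgue_on \<Omega>. \<bar>weak_partial \<Omega> b (\<lambda>x. u x - \<phi> x) x\<bar> powr p)
    = enn2real (Lp_pow p (\<lambda>x. V x - frechet_derivative \<phi> (at x) b))"
proof -
  let ?D = "\<lambda>x. frechet_derivative \<phi> (at x) b"
  have \<phi>D: "?D \<in> test_functions \<Omega>" by (rule test_functions_frechet_derivative[OF \<phi> b])
  have V0: "locally_integrable_borel \<Omega> V" using w by (simp add: weak_partial_borel_def)
  have u\<phi>: "borel_version \<Omega> (\<lambda>x. u x - \<phi> x) (\<lambda>x. U x - \<phi> x)" by (rule borel_version_diff_test_function[OF U \<phi> \<Omega>])
  have w\<phi>: "weak_partial_borel \<Omega> b (\<lambda>x. U x - \<phi> x) (\<lambda>x. V x - ?D x)"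
    by (rule weak_partial_borel_diff_test_function[OF w \<phi> b])
  have D0: "?D x = 0" if "x \<notin> \<Omega>" for x
    using \<phi>D that closure_subset[of "{x. ?D x \<noteq> 0}"] by (auto simp: test_functions_def)
  have Vv: "borel_version \<Omega> (\<lambda>x. V x - ?D x) (\<lambda>x. V x - ?D x)"
  proof -
    have "(\<lambda>x. V x - ?D x) \<in> borel_measurable borel"
      using w\<phi> by (simp add: weak_partial_borel_def locally_integrable_borel_def)
    moreover from this have "(\<lambda>x. V x - ?D x) \<in> borel_measurable (lebesgue_on \<Omega>)"
      by (intro measurable_restrict_space1 measurable_completion) simp
    ultimately show ?thesis unfolding borel_version_def using V D0 by simp
  qed
  have li: "locally_integrable \<Omega> (\<lambda>x. u x - \<phi> x)"
    using w\<phi> locally_integrable_iff_borel[OF u\<phi> \<Omega>] by (simp add: weak_partial_borel_def)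
  have "\<exists>v. has_weak_partial \<Omega> b (\<lambda>x. u x - \<phi> x) v"
    using has_weak_partial_iff_borel[OF \<Omega> b u\<phi> Vv li] w\<phi> by blast
  then have wp: "has_weak_partial \<Omega> b (\<lambda>x. u x - \<phi> x) (weak_partial \<Omega> b (\<lambda>x. u x - \<phi> x))"
    unfolding weak_partial_def by (rule someI_ex)
  then have "weak_partial \<Omega> b (\<lambda>x. u x - \<phi> x) \<in> borel_measurable (lebesgue_on \<Omega>)"
    by (intro locally_integrable_measurable[OF \<Omega>]) (simp add: has_weak_partial_def)
  then obtain W where W: "borel_version \<Omega> (weak_partial \<Omega> b (\<lambda>x. u x - \<phi> x)) W" using ex_borel_version[OF \<Omega>] by blast
  have "weak_partial_borel \<Omega> b (\<lambda>x. U x - \<phi> x) W"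
    using has_weak_partial_iff_borel[OF \<Omega> b u\<phi> W li] wp by simp
  from weak_partial_borel_unique[OF \<Omega> this w\<phi>]
  have "AE x in lborel. W x = V x - ?D x"
    by (rule eventually_mono) (use W V D0 in \<open>auto simp: borel_version_def\<close>)
  then have "Lp_pow p W = Lp_pow p (\<lambda>x. V x - ?D x)"
    unfolding Lp_pow_def by (intro nn_integral_cong_AE) (auto elim: eventually_mono)
  then show ?thesis using integral_powr_borel_version[OF W \<Omega> p] by simp
qed

section \<open>Gradient norms and the two implications\<close>

lemma weak_grad_Lp_space_iff:
  assumes \<Omega>: "open \<Omega>" and p: "p \<ge> 1" and m: "\<And>b. b \<in> Basis \<Longrightarrow> weak_partial \<Omega> b u \<in> borel_measurable (lebesgue_on \<Omega>)"
  shows "(\<lambda>x. norm (weak_grad \<Omega> u x)) \<in> Lp_space \<Omega> p \<longleftrightarrow> (\<forall>b\<in>Basis. weak_partial \<Omega> b u \<in> Lp_space \<Omega> p)"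
proof
  have wb: "weak_grad \<Omega> u x \<bullet> b = weak_partial \<Omega> b u x" if "b \<in> Basis" for b x
    unfolding weak_grad_def using that by (simp add: inner_sum_left inner_Basis if_distrib cong: if_cong)
  have gm: "(\<lambda>x. norm (weak_grad \<Omega> u x)) \<in> borel_measurable (lebesgue_on \<Omega>)"
    unfolding weak_grad_def using m by measurable
  {
    assume L: "(\<lambda>x. norm (weak_grad \<Omega> u x)) \<in> Lp_space \<Omega> p"
    show "\<forall>b\<in>Basis. weak_partial \<Omega> b u \<in> Lp_space \<Omega> p"
    proof
      fix b :: 'a assume b: "b \<in> Basis"
      note [measurable] = m[OF b]
      have "integrable (lebesgue_on \<Omega>) (\<lambda>x. \<bar>weak_partial \<Omega> b u x\<bar> powr p)"
      proof (rule Bochner_Integration.integrable_bound)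
        show "integrable (lebesgue_on \<Omega>) (\<lambda>x. \<bar>norm (weak_grad \<Omega> u x)\<bar> powr p)" using L by (simp add: Lp_space_def)
        show "AE x in lebesgue_on \<Omega>. norm (\<bar>weak_partial \<Omega> b u x\<bar> powr p) \<le> norm (\<bar>norm (weak_grad \<Omega> u x)\<bar> powr p)"
          using Basis_le_norm[OF b] p wb[OF b] by (auto intro!: AE_I2 powr_mono2) (metis)
      qed measurable
      then show "weak_partial \<Omega> b u \<in> Lp_space \<Omega> p" using m[OF b] by (simp add: Lp_space_def)
    qed
  }
  {
    assume L: "\<forall>b\<in>Basis. weak_partial \<Omega> b u \<in> Lp_space \<Omega> p"
    have "integrable (lebesgue_on \<Omega>) (\<lambda>x. \<bar>norm (weak_grad \<Omega> u x)\<bar> powr p)"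
    proof (rule Bochner_Integration.integrable_bound)
      show "integrable (lebesgue_on \<Omega>) (\<lambda>x. DIM('a) powr p * (\<Sum>b\<in>Basis. \<bar>weak_partial \<Omega> b u x\<bar> powr p))"
        using L by (auto simp: Lp_space_def)
      show "(\<lambda>x. \<bar>norm (weak_grad \<Omega> u x)\<bar> powr p) \<in> borel_measurable (lebesgue_on \<Omega>)" using gm by measurable
      show "AE x in lebesgue_on \<Omega>. norm (\<bar>norm (weak_grad \<Omega> u x)\<bar> powr p) \<le> norm (DIM('a) powr p * (\<Sum>b\<in>Basis. \<bar>weak_partial \<Omega> b u x\<bar> powr p))"
      proof (rule AE_I2)
        fix x
        let ?S = "\<Sum>b\<in>Basis. \<bar>weak_partial \<Omega> b u x\<bar> powr p"
        have S: "?S \<ge> 0" by (intro sum_nonneg) auto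
        define M where "M = Max ((\<lambda>b. \<bar>weak_partial \<Omega> b u x\<bar>) ` Basis)"
        have Mle: "\<bar>weak_partial \<Omega> b u x\<bar> \<le> M" if "b \<in> Basis" for b unfolding M_def using that by simp
        have "M \<in> (\<lambda>b. \<bar>weak_partial \<Omega> b u x\<bar>) ` Basis" unfolding M_def by (intro Max_in) auto
        then obtain c where c: "c \<in> Basis" "M = \<bar>weak_partial \<Omega> c u x\<bar>" by blast
        have "norm (weak_grad \<Omega> u x) \<le> (\<Sum>b\<in>Basis. \<bar>weak_partial \<Omega> b u x\<bar>)"
          unfolding weak_grad_def by (rule order_trans[OF norm_sum]) simp
        also have "\<dots> \<le> (\<Sum>b\<in>(Basis::'a set). M)" by (intro sum_mono Mle)
        also have "\<dots> = DIM('a) * M" by simp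
        finally have "norm (weak_grad \<Omega> u x) powr p \<le> (DIM('a) * M) powr p" using p by (intro powr_mono2) auto
        also have "\<dots> = DIM('a) powr p * \<bar>weak_partial \<Omega> c u x\<bar> powr p" using c by (simp add: powr_mult)
        also have "\<dots> \<le> DIM('a) powr p * ?S"
          using c(1) by (intro mult_left_mono member_le_sum) auto
        finally show "norm (\<bar>norm (weak_grad \<Omega> u x)\<bar> powr p) \<le> norm (DIM('a) powr p * ?S)" using S by simp
      qed
    qed
    then show "(\<lambda>x. norm (weak_grad \<Omega> u x)) \<in> Lp_space \<Omega> p" using gm by (simp add: Lp_space_def)
  }
qed

text \<open>In place of Hoelder's inequality, \<open>\<bar>f\<bar>\<close> is bounded by a small
  constant \<open>a\<close> plus a multiple of its p-th power; this follows from
  \<open>le_one_add_powr\<close> for \<open>\<bar>f\<bar> / a\<close>.\<close>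

lemma Lp_pow_1_le_Lp_pow:
  fixes S :: "'a::euclidean_space set"
  assumes "open S" "bounded S" "p \<ge> 1" "e > 0"
  obtains d where "d > 0" "\<And>f. f \<in> borel_measurable borel \<Longrightarrow> (\<And>x. x \<notin> S \<Longrightarrow> f x = 0) \<Longrightarrow> Lp_pow p f \<le> ennreal d \<Longrightarrow> Lp_pow 1 f \<le> ennreal e"
proof -
  have [measurable]: "S \<in> sets borel" using assms(1) by simp
  define v where "v = measure lborel S"
  have v: "v \<ge> 0" "emeasure lborel S = ennreal v"
    using emeasure_bounded_finite[OF assms(2)] by (auto simp: v_def emeasure_eq_ennreal_measure)
  \<comment> \<open>The constant part integrates to at most \<open>e / 2\<close> over
    \<open>S\<close>, and \<open>d\<close> is chosen so that the power part is at most
    \<open>e / 2\<close> too. The added 1 covers a null set \<open>S\<close>.\<close>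
  define a where "a = e / (2 * (v + 1))"
  have a: "a > 0" using assms(4) v by (simp add: a_def)
  define d where "d = e / (2 * a) * a powr p"
  have d: "d > 0" using a assms(4) by (simp add: d_def)
  have "Lp_pow 1 f \<le> ennreal e"
    if [measurable]: "f \<in> borel_measurable borel" and f0: "\<And>x. x \<notin> S \<Longrightarrow> f x = 0" and f: "Lp_pow p f \<le> ennreal d" for f
  proof -
    have "Lp_pow 1 f \<le> (\<integral>\<^sup>+x. ennreal a * indicator S x + ennreal (a / a powr p) * ennreal (\<bar>f x\<bar> powr p) \<partial>lborel)"
      unfolding Lp_pow_1
    proof (intro nn_integral_mono)
      fix x
      show "ennreal \<bar>f x\<bar> \<le> ennreal a * indicator S x + ennreal (a / a powr p) * ennreal (\<bar>f x\<bar> powr p)"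
      proof (cases "x \<in> S")
        case True
        have "\<bar>f x\<bar> / a \<le> 1 + (\<bar>f x\<bar> / a) powr p" using a by (intro le_one_add_powr assms) auto
        then have "\<bar>f x\<bar> \<le> a * (1 + (\<bar>f x\<bar> / a) powr p)" using a by (simp add: field_simps)
        also have "\<dots> = a + a / a powr p * \<bar>f x\<bar> powr p" using a by (simp add: powr_divide field_simps)
        finally have "ennreal \<bar>f x\<bar> \<le> ennreal (a + a / a powr p * \<bar>f x\<bar> powr p)" by (rule ennreal_leI)
        then show ?thesis using True a by (simp add: ennreal_mult[symmetric] ennreal_plus[symmetric] del: ennreal_plus)
      qed (simp add: f0)
    qed
    also have "\<dots> = ennreal a * ennreal v + ennreal (a / a powr p) * Lp_pow p f"
      unfolding Lp_pow_def v(2)[symmetric]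
      by (subst nn_integral_add) (auto simp: nn_integral_cmult nn_integral_cmult_indicator)
    also have "\<dots> \<le> ennreal a * ennreal v + ennreal (a / a powr p) * ennreal d"
      by (intro add_left_mono mult_left_mono f) auto
    also have "\<dots> = ennreal (a * v + e / 2)"
    proof -
      have "a / a powr p * d = e / 2" using a by (simp add: d_def)
      then show ?thesis using a v(1) assms(4) d by (simp add: ennreal_mult[symmetric] ennreal_plus[symmetric] del: ennreal_plus)
    qed
    also have "\<dots> \<le> ennreal e"
    proof (rule ennreal_leI)
      have "a * v \<le> a * (v + 1)" using a by simp
      also have "\<dots> = e / 2"
      proof -
        have "e / (2 * w) * w = e / 2" if "w \<noteq> 0" for w using that by simp
        from this[of "v + 1"] show ?thesis using v(1) by (simp only: a_def)
      qed
      finally show "a * v + e / 2 \<le> e" by simp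
    qed
    finally show ?thesis .
  qed
  with d show thesis using that by blast
qed

lemma zero_trace_if_weak_L1_a:
  fixes \<Omega> :: "'a::euclidean_space set"
  assumes p: "p > 1" and \<Omega>: "open \<Omega>" "bounded \<Omega>" and obp: "outer_ball_portion \<Omega>" and wd: "weakly_differentiable \<Omega> u"
    and grad: "(\<lambda>x. norm (weak_grad \<Omega> u x)) \<in> Lp_space \<Omega> p"
    and weak: "(\<lambda>x. u x / infdist x (frontier \<Omega>)) \<in> weak_L1_a \<Omega>"
  shows "u \<in> W1p_0 \<Omega> p"
proof -
  have p0: "p > 0" "p \<ge> 1" using p by auto
  have \<Omega>m: "\<Omega> \<in> sets lebesgue" using \<Omega> by simp
  have "locally_integrable \<Omega> u" using wd by (simp add: weakly_differentiable_def)
  then obtain U where U: "borel_version \<Omega> u U"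
    using ex_borel_version[OF \<Omega>(1)] locally_integrable_measurable[OF \<Omega>(1)] by blast
  have "\<exists>V. borel_version \<Omega> (weak_partial \<Omega> b u) V \<and> weak_partial_borel \<Omega> b U V" if "b \<in> Basis" for b
    using weak_partial_borel_version[OF \<Omega>(1) wd that U] by blast
  then obtain G where G: "\<And>b. b \<in> Basis \<Longrightarrow> borel_version \<Omega> (weak_partial \<Omega> b u) (G b)"
    "\<And>b. b \<in> Basis \<Longrightarrow> weak_partial_borel \<Omega> b U (G b)" by metis
  have Um [measurable]: "U \<in> borel_measurable borel" and U0: "\<And>x. x \<notin> \<Omega> \<Longrightarrow> U x = 0"
    using U by (auto simp: borel_version_def)
  have Gm: "G b \<in> borel_measurable borel" and G0: "\<And>x. x \<notin> \<Omega> \<Longrightarrow> G b x = 0" if "b \<in> Basis" for b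
    using G(1)[OF that] by (auto simp: borel_version_def)
  have wpL: "\<forall>b\<in>Basis. weak_partial \<Omega> b u \<in> Lp_space \<Omega> p"
    using weak_grad_Lp_space_iff[OF \<Omega>(1) p0(2), of u] G(1) grad by (simp add: borel_version_def)
  have GL: "Lp_pow p (G b) < \<infinity>" if "b \<in> Basis" for b
    using Lp_space_iff_Lp_pow[OF G(1)[OF that] \<Omega>(1) p0(1)] wpL that by blast
  have Gi: "integrable lborel (G b)" if "b \<in> Basis" for b
    using Gm[OF that] GL[OF that] p0(2) \<Omega>(2) G0[OF that] by (rule integrable_if_Lp_pow_bounded_support)
  let ?f = "\<lambda>x. u x / infdist x (frontier \<Omega>)"
  have fm: "?f \<in> borel_measurable (lebesgue_on \<Omega>)" using weak by (simp add: weak_L1_a_def weak_L1_def)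
  \<comment> \<open>The absolute continuity is applied to the superlevel sets of the quotient
    itself. Their indicators vanish eventually at every point because the quotient is
    finite.\<close>
  define S where "S k = {x \<in> \<Omega>. \<bar>?f x\<bar> > real k}" for k :: nat
  have Sm: "S k \<in> sets lebesgue" for k unfolding S_def by (rule level_set_lebesgue[OF fm \<Omega>m])
  have Ssteep: "emeasure lborel (steep \<Omega> U (real k)) = emeasure lebesgue (S k)" for k
  proof -
    have st: "steep \<Omega> U (real k) \<in> sets borel" using \<Omega>(1) Um by (rule steep_sets)
    have "emeasure lebesgue (S k) = emeasure lebesgue (steep \<Omega> U (real k))"
    proof (rule emeasure_eq_AE)
      have "AE x in lebesgue. x \<in> \<Omega> \<longrightarrow> u x = U x" using U by (simp add: borel_version_def)
      then show "AE x in lebesgue. x \<in> S k \<longleftrightarrow> x \<in> steep \<Omega> U (real k)"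
      proof (rule eventually_mono)
        fix x assume *: "x \<in> \<Omega> \<longrightarrow> u x = U x"
        show "x \<in> S k \<longleftrightarrow> x \<in> steep \<Omega> U (real k)"
        proof (cases "x \<in> \<Omega>")
          case True
          have d: "infdist x (- \<Omega>) > 0" by (rule infdist_Compl_pos[OF \<Omega> True])
          show ?thesis using True * d by (simp add: S_def steep_def infdist_frontier_eq[OF \<Omega> True] abs_divide field_simps)
        qed (simp add: S_def steep_def)
      qed
    qed (use st Sm in auto)
    then show ?thesis using st by simp
  qed
  have "(\<lambda>k. weak_L1_norm \<Omega> (\<lambda>x. ?f x * indicator (S k) x)) \<longlonglongrightarrow> 0"
  proof -
    have "AE x in lebesgue_on \<Omega>. (\<lambda>k. indicator (S k) x :: real) \<longlonglongrightarrow> 0"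
    proof (rule AE_I2)
      fix x
      obtain n :: nat where n: "\<bar>?f x\<bar> \<le> real n" using real_arch_simple by blast
      have "\<forall>\<^sub>F k in sequentially. indicator (S k) x = (0 :: real)"
        using eventually_ge_at_top[of n] by eventually_elim (use n in \<open>auto simp: S_def indicator_def\<close>)
      then show "(\<lambda>k. indicator (S k) x :: real) \<longlonglongrightarrow> 0" by (rule tendsto_eventually)
    qed
    moreover have "\<forall>k. S k \<in> sets lebesgue \<and> S k \<subseteq> \<Omega>" using Sm by (auto simp: S_def)
    ultimately show ?thesis using weak unfolding weak_L1_a_def by blast
  qed
  then have lim: "(\<lambda>k. of_nat k * emeasure lborel (steep \<Omega> U (real k))) \<longlonglongrightarrow> 0"
  proof (rule tendsto_sandwich[OF _ _ tendsto_const, rotated 2])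
    show "\<forall>\<^sub>F k in sequentially. of_nat k * emeasure lborel (steep \<Omega> U (real k)) \<le> weak_L1_norm \<Omega> (\<lambda>x. ?f x * indicator (S k) x)"
      using eventually_gt_at_top[of 0]
    proof eventually_elim
      case (elim k)
      have m: "(\<lambda>x. ?f x * indicator (S k) x) \<in> borel_measurable (lebesgue_on \<Omega>)"
      proof (intro borel_measurable_times fm)
        show "indicator (S k) \<in> borel_measurable (lebesgue_on \<Omega>)"
          by (intro measurable_restrict_space1 borel_measurable_indicator Sm)
      qed
      have "ennreal (real k) * emeasure lebesgue {x \<in> \<Omega>. \<bar>?f x * indicator (S k) x\<bar> > real k} \<le> weak_L1_norm \<Omega> (\<lambda>x. ?f x * indicator (S k) x)"
        using elim by (intro weak_L1_norm_ge[OF m \<Omega>m]) simp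
      \<comment> \<open>Restriction to \<open>S k\<close> keeps the level set at height
        \<open>k\<close>, so \<open>k\<close> times its measure is at most the norm that tends to
        0.\<close>
      also have "{x \<in> \<Omega>. \<bar>?f x * indicator (S k) x\<bar> > real k} = S k"
        by (auto simp: S_def indicator_def)
      finally show ?case by (simp add: Ssteep ennreal_of_nat_eq_real_of_nat)
    qed
  qed simp
  interpret zero_extension \<Omega> U G p
  proof
    show "AE x in lborel. U (x + h *\<^sub>R b) - U x = h * seg_avg h b (G b) x" if "b \<in> Basis" "h > 0" for b h
      by (rule translation_formula[OF \<Omega> that G(2)[OF that(1)] Gi[OF that(1)] U0 G0[OF that(1)] lim])
  qed (use \<Omega> p0 Um Gm U0 G0 GL in auto)
  obtain \<beta> r0 where \<beta>: "\<beta> > 0" and r0: "r0 > 0"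
    and ball: "\<forall>z\<in>frontier \<Omega>. \<forall>r\<in>{0<..r0}. measure lebesgue (ball z r \<inter> - \<Omega>) \<ge> \<beta> * measure lebesgue (ball z r)"
    using obp unfolding outer_ball_portion_def by blast
  have uL: "u \<in> Lp_space \<Omega> p" using Lp_space_iff_Lp_pow[OF U \<Omega>(1) p0(1)] Friedrichs by simp
  have "\<exists>\<phi>\<in>test_functions \<Omega>. W1p_norm \<Omega> p (\<lambda>x. u x - \<phi> x) < \<epsilon>" if \<epsilon>: "\<epsilon> > 0" for \<epsilon>
  proof -
    \<comment> \<open>The \<open>1 + DIM('a)\<close> integrals in the norm together are at most
      \<open>\<epsilon> powr p / 2\<close>; the half gives the strict inequality.\<close>
    define e where "e = \<epsilon> powr p / (2 * (1 + DIM('a)))"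
    have e: "e > 0" using \<epsilon> by (simp add: e_def)
    obtain \<phi> where \<phi>: "\<phi> \<in> test_functions \<Omega>" "Lp_pow p (\<lambda>x. U x - \<phi> x) \<le> ennreal e"
      "\<And>b. b \<in> Basis \<Longrightarrow> Lp_pow p (\<lambda>x. G b x - frechet_derivative \<phi> (at x) b) \<le> ennreal e"
      using test_function_approximation[OF \<beta> r0 _ e] ball by auto
    have 1: "(LINT x|lebesgue_on \<Omega>. \<bar>u x - \<phi> x\<bar> powr p) \<le> e"
      using integral_powr_borel_version[OF borel_version_diff_test_function[OF U \<phi>(1) \<Omega>(1)] \<Omega>(1) p0(1)]
        enn2real_mono[OF \<phi>(2)] e by simp
    have 2: "(LINT x|lebesgue_on \<Omega>. \<bar>weak_partial \<Omega> b (\<lambda>x. u x - \<phi> x) x\<bar> powr p) \<le> e" if "b \<in> Basis" for b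
      using weak_partial_diff_test_function[OF \<Omega>(1) wd that U G(2)[OF that] G0[OF that] \<phi>(1) p0(1)]
        enn2real_mono[OF \<phi>(3)[OF that]] e by simp
    let ?I = "(LINT x|lebesgue_on \<Omega>. \<bar>u x - \<phi> x\<bar> powr p)
       + (\<Sum>b\<in>Basis. LINT x|lebesgue_on \<Omega>. \<bar>weak_partial \<Omega> b (\<lambda>x. u x - \<phi> x) x\<bar> powr p)"
    have "?I \<le> e + (\<Sum>b\<in>(Basis::'a set). e)" by (intro add_mono sum_mono 1 2)
    also have "\<dots> = (1 + DIM('a)) * e" by (simp add: distrib_right)
    also have "\<dots> = \<epsilon> powr p / 2"
    proof -
      have "w * (c / (2 * w)) = c / 2" if "w \<noteq> 0" for w c :: real using that by simp
      from this[of "1 + DIM('a)"] show ?thesis by (simp add: e_def)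
    qed
    also have "\<dots> < \<epsilon> powr p" using \<epsilon> by simp
    finally have "?I < \<epsilon> powr p" .
    moreover have "?I \<ge> 0" by (intro add_nonneg_nonneg sum_nonneg Bochner_Integration.integral_nonneg) auto
    ultimately have "?I powr (1 / p) < (\<epsilon> powr p) powr (1 / p)" using p0 by (intro powr_less_mono2) auto
    also have "\<dots> = \<epsilon>" using \<epsilon> p0 by (simp add: powr_powr)
    finally show ?thesis using \<phi>(1) by (auto simp: W1p_norm_def)
  qed
  then show ?thesis using uL wd wpL by (simp add: W1p_0_def W1p_def)
qed

text \<open>Closeness in the Sobolev norm is weakened to L^1 closeness of the function and its
  partial derivatives, the form that \<open>weak_L1_a_if_approximable\<close> takes.\<close>

lemma weak_L1_a_if_zero_trace:
  fixes \<Omega> :: "'a::euclidean_space set"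
  assumes p: "p > 1" and \<Omega>: "open \<Omega>" "bounded \<Omega>" and obp: "outer_ball_portion \<Omega>" and u: "u \<in> W1p_0 \<Omega> p"
  shows "(\<lambda>x. norm (weak_grad \<Omega> u x)) \<in> Lp_space \<Omega> p"
    and "(\<lambda>x. u x / infdist x (frontier \<Omega>)) \<in> weak_L1_a \<Omega>"
proof -
  have p0: "p > 0" "p \<ge> 1" using p by auto
  have wd: "weakly_differentiable \<Omega> u" and wpL: "\<forall>b\<in>Basis. weak_partial \<Omega> b u \<in> Lp_space \<Omega> p"
    and uL: "u \<in> Lp_space \<Omega> p"
    and approx: "\<And>\<epsilon>. \<epsilon> > 0 \<Longrightarrow> \<exists>\<phi>\<in>test_functions \<Omega>. W1p_norm \<Omega> p (\<lambda>x. u x - \<phi> x) < \<epsilon>"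
    using u by (auto simp: W1p_0_def W1p_def)
  show "(\<lambda>x. norm (weak_grad \<Omega> u x)) \<in> Lp_space \<Omega> p"
    using weak_grad_Lp_space_iff[OF \<Omega>(1) p0(2), of u] wpL by (auto simp: Lp_space_def)
  have um: "u \<in> borel_measurable (lebesgue_on \<Omega>)" using uL by (simp add: Lp_space_def)
  obtain U where U: "borel_version \<Omega> u U" using ex_borel_version[OF \<Omega>(1) um] by blast
  have "\<exists>V. borel_version \<Omega> (weak_partial \<Omega> b u) V \<and> weak_partial_borel \<Omega> b U V" if "b \<in> Basis" for b
    using weak_partial_borel_version[OF \<Omega>(1) wd that U] by blast
  then obtain G where G: "\<And>b. b \<in> Basis \<Longrightarrow> borel_version \<Omega> (weak_partial \<Omega> b u) (G b)"
    "\<And>b. b \<in> Basis \<Longrightarrow> weak_partial_borel \<Omega> b U (G b)" by metis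
  have Um [measurable]: "U \<in> borel_measurable borel" and U0: "\<And>x. x \<notin> \<Omega> \<Longrightarrow> U x = 0"
    using U by (auto simp: borel_version_def)
  have Gm: "G b \<in> borel_measurable borel" and G0: "\<And>x. x \<notin> \<Omega> \<Longrightarrow> G b x = 0" if "b \<in> Basis" for b
    using G(1)[OF that] by (auto simp: borel_version_def)
  have UL: "Lp_pow p U < \<infinity>" using Lp_space_iff_Lp_pow[OF U \<Omega>(1) p0(1)] uL by simp
  have GL: "Lp_pow p (G b) < \<infinity>" if "b \<in> Basis" for b
    using Lp_space_iff_Lp_pow[OF G(1)[OF that] \<Omega>(1) p0(1)] wpL that by blast
  have test_Lp: "Lp_pow p \<phi> < \<infinity>" if \<phi>: "\<phi> \<in> test_functions \<Omega>" for \<phi>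
  proof -
    have c: "continuous_on UNIV \<phi>" using \<phi> Ck_continuous[of 0 \<phi>] by (simp add: test_functions_def)
    obtain R where R: "\<And>x. norm x > R \<Longrightarrow> \<phi> x = 0" using test_functions_bounded_support[OF \<phi>] by blast
    have "continuous_on UNIV (\<lambda>x. \<bar>\<phi> x\<bar> powr p)"
      using c p0 by (intro continuous_on_powr' continuous_on_rabs continuous_on_const) auto
    then have "integrable lborel (\<lambda>x. \<bar>\<phi> x\<bar> powr p)"
      by (rule integrable_continuous_bounded_support[of _ R]) (use R p0 in auto)
    then show ?thesis by (simp add: integrable_iff_bounded Lp_pow_def)
  qed
  have test_m: "\<phi> \<in> borel_measurable borel" if "\<phi> \<in> test_functions \<Omega>" for \<phi>
    using test_function_locally_integrable[OF that] by (simp add: locally_integrable_borel_def)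
  have test_0: "\<phi> x = 0" if "\<phi> \<in> test_functions \<Omega>" "x \<notin> \<Omega>" for \<phi> x
    using that closure_subset[of "{x. \<phi> x \<noteq> 0}"] by (auto simp: test_functions_def)
  \<comment> \<open>A Bochner integral of a function that is not integrable and
    \<open>enn2real\<close> of infinity are both 0, so a small norm carries information only once
    finiteness is known.\<close>
  have diff_fin: "Lp_pow p (\<lambda>x. F x - \<phi> x) < \<infinity>"
    if "\<phi> \<in> test_functions \<Omega>" "Lp_pow p F < \<infinity>" "F \<in> borel_measurable borel" for F \<phi>
  proof -
    have "Lp_pow p (\<lambda>x. F x - \<phi> x) \<le> ennreal (2 powr p) * (Lp_pow p F + Lp_pow p \<phi>)"
      using that p0 test_m[OF that(1)] by (intro Lp_pow_diff) auto
    also have "\<dots> < \<infinity>" using that test_Lp[OF that(1)] by (simp add: ennreal_mult_less_top)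
    finally show ?thesis .
  qed
  have L1_approx: "\<exists>\<phi>\<in>test_functions \<Omega>. Lp_pow 1 (\<lambda>x. U x - \<phi> x) \<le> ennreal e \<and>
      (\<forall>b\<in>Basis. Lp_pow 1 (\<lambda>x. G b x - frechet_derivative \<phi> (at x) b) \<le> ennreal e)" if e: "e > 0" for e
  proof -
    obtain d where d: "d > 0" "\<And>f. f \<in> borel_measurable borel \<Longrightarrow> (\<And>x. x \<notin> \<Omega> \<Longrightarrow> f x = 0) \<Longrightarrow>
        Lp_pow p f \<le> ennreal d \<Longrightarrow> Lp_pow 1 f \<le> ennreal e"
      using Lp_pow_1_le_Lp_pow[OF \<Omega> p0(2) e] by blast
    define \<epsilon> where "\<epsilon> = d powr (1 / p)"
    have \<epsilon>: "\<epsilon> > 0" using d by (simp add: \<epsilon>_def)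
    obtain \<phi> where \<phi>: "\<phi> \<in> test_functions \<Omega>" "W1p_norm \<Omega> p (\<lambda>x. u x - \<phi> x) < \<epsilon>" using approx[OF \<epsilon>] by blast
    let ?J = "LINT x|lebesgue_on \<Omega>. \<bar>u x - \<phi> x\<bar> powr p"
    let ?K = "\<lambda>b. LINT x|lebesgue_on \<Omega>. \<bar>weak_partial \<Omega> b (\<lambda>x. u x - \<phi> x) x\<bar> powr p"
    have J0: "?J \<ge> 0" and K0: "\<And>b. ?K b \<ge> 0" by (auto intro: Bochner_Integration.integral_nonneg)
    have S0: "(\<Sum>b\<in>Basis. ?K b) \<ge> 0" by (intro sum_nonneg K0)
    have "?J + (\<Sum>b\<in>Basis. ?K b) \<le> d"
    proof (rule ccontr)
      assume "\<not> ?thesis"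
      then have "d powr (1 / p) \<le> (?J + (\<Sum>b\<in>Basis. ?K b)) powr (1 / p)" using d(1) p0 by (intro powr_mono2) auto
      then show False using \<phi>(2) by (simp add: W1p_norm_def \<epsilon>_def)
    qed
    then have Jd: "?J \<le> d" and Sd: "(\<Sum>b\<in>Basis. ?K b) \<le> d" using J0 S0 by linarith+
    have le: "Lp_pow p f \<le> ennreal d" if "Lp_pow p f < \<infinity>" "enn2real (Lp_pow p f) \<le> d" for f :: "'a \<Rightarrow> real"
    proof -
      have "Lp_pow p f = ennreal (enn2real (Lp_pow p f))" using that(1) by (simp add: ennreal_enn2real)
      also have "\<dots> \<le> ennreal d" using that(2) by (rule ennreal_leI)
      finally show ?thesis .
    qed
    have "Lp_pow 1 (\<lambda>x. U x - \<phi> x) \<le> ennreal e"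
    proof (rule d(2))
      show "Lp_pow p (\<lambda>x. U x - \<phi> x) \<le> ennreal d"
        using Jd integral_powr_borel_version[OF borel_version_diff_test_function[OF U \<phi>(1) \<Omega>(1)] \<Omega>(1) p0(1)]
        by (intro le diff_fin \<phi> UL Um) simp
    qed (use Um test_m[OF \<phi>(1)] U0 test_0[OF \<phi>(1)] in auto)
    moreover have "Lp_pow 1 (\<lambda>x. G b x - frechet_derivative \<phi> (at x) b) \<le> ennreal e" if b: "b \<in> Basis" for b
    proof (rule d(2))
      have \<phi>D: "(\<lambda>x. frechet_derivative \<phi> (at x) b) \<in> test_functions \<Omega>"
        by (rule test_functions_frechet_derivative[OF \<phi>(1) b])
      show "(\<lambda>x. G b x - frechet_derivative \<phi> (at x) b) \<in> borel_measurable borel"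
        using Gm[OF b] test_m[OF \<phi>D] by simp
      show "G b x - frechet_derivative \<phi> (at x) b = 0" if "x \<notin> \<Omega>" for x
        using G0[OF b that] test_0[OF \<phi>D that] by simp
      have "?K b \<le> (\<Sum>b\<in>Basis. ?K b)" using b K0 by (intro member_le_sum) auto
      then have "?K b \<le> d" using Sd by simp
      then show "Lp_pow p (\<lambda>x. G b x - frechet_derivative \<phi> (at x) b) \<le> ennreal d"
        using weak_partial_diff_test_function[OF \<Omega>(1) wd b U G(2)[OF b] G0[OF b] \<phi>(1) p0(1)]
        by (intro le diff_fin \<phi>D GL b Gm) simp
    qed
    ultimately show ?thesis using \<phi>(1) by blast
  qed
  obtain \<beta> r0 where \<beta>: "\<beta> > 0" and r0: "r0 > 0"
    and ball: "\<forall>z\<in>frontier \<Omega>. \<forall>r\<in>{0<..r0}. measure lebesgue (ball z r \<inter> - \<Omega>) \<ge> \<beta> * measure lebesgue (ball z r)"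
    using obp unfolding outer_ball_portion_def by blast
  obtain C where C: "C > 0" "\<And>\<phi> t. \<phi> \<in> test_functions \<Omega> \<Longrightarrow> t > 0 \<Longrightarrow>
    emeasure lborel (steep \<Omega> \<phi> t) \<le> ennreal (C / t) * (\<integral>\<^sup>+y. ennreal (partials_sum \<phi> y) \<partial>lborel)"
    using weak_type_test_functions[OF \<Omega> \<beta> r0] ball by auto
  have idm: "(\<lambda>x. infdist x (frontier \<Omega>)) \<in> borel_measurable (lebesgue_on \<Omega>)"
    by (intro measurable_restrict_space1 measurable_completion) simp
  show "(\<lambda>x. u x / infdist x (frontier \<Omega>)) \<in> weak_L1_a \<Omega>"
  proof (rule weak_L1_a_if_approximable[OF \<Omega> Um Gm C L1_approx])
    show "(\<lambda>x. u x / infdist x (frontier \<Omega>)) \<in> borel_measurable (lebesgue_on \<Omega>)"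
      by (intro borel_measurable_divide um idm)
    have "AE x in lebesgue. x \<in> \<Omega> \<longrightarrow> u x = U x" using U by (simp add: borel_version_def)
    then show "AE x in lebesgue. x \<in> \<Omega> \<longrightarrow> u x / infdist x (frontier \<Omega>) = U x / infdist x (- \<Omega>)"
      by (rule eventually_mono) (use infdist_frontier_eq[OF \<Omega>] in auto)
  qed
qed

theorem theorem1p1:
  fixes \<Omega> :: "(real ^ 'n) set" and p :: real and u :: "real ^ 'n \<Rightarrow> real"
  assumes "1 < p"
    and "open \<Omega>" and "connected \<Omega>" and "bounded \<Omega>"
    and "outer_ball_portion \<Omega>"
    and "\<exists>C>0. \<exists>s\<^sub>0>0. \<forall>s\<in>{0<..<s\<^sub>0}. isoperimetric_fun \<Omega> s \<ge> ennreal (C * s)"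
    and "weakly_differentiable \<Omega> u"
  shows "((\<lambda>x. norm (weak_grad \<Omega> u x)) \<in> Lp_space \<Omega> p \<and>
          (\<lambda>x. u x / infdist x (frontier \<Omega>)) \<in> weak_L1_a \<Omega>)
         \<longleftrightarrow> u \<in> W1p_0 \<Omega> p"
  using zero_trace_if_weak_L1_a[OF assms(1,2,4,5,7)] weak_L1_a_if_zero_trace[OF assms(1,2,4,5)] by blast

end
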